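(* Let $\pi:X\to B$ be a surjective morphism of smooth affine algebraic varieties over $\mathbb{C}$, so that $\mathbb{C}[B]$ is naturally embedded into $\mathbb{C}[X]$ via $\pi^*$, let $n=\dim X$, and let $X$ be equipped with an algebraic volume form $\omega$. Suppose that $\eta\in\mathrm{IVF}_\omega(X)$ is such that $\mathbb{C}[B]\subset\operatorname{Ker}\eta$. Let $\alpha_1,\dots,\alpha_k$ be regular functions on $B$ without common zeros and $D_i=(\alpha_i\circ\pi)^{-1}(0)$. Suppose that $\xi_1,\dots,\xi_k\in\mathrm{IVF}_\omega(X)$ are such that for each $i$ one has $\alpha_i\in\operatorname{Ker}\xi_i$ (so that $\xi_i$ is tangent to $D_i$) and the pair $(\xi_i,\eta)$ is semi-compatible on $X_i=X\setminus D_i$. Suppose also that the fields $\{\xi_i\}_{i=1}^k$ generate a $\mathbb{C}[X]$-module $N$ such that for every point $x\in X$ the localization of $N$ at $x$ coincides with the localization at $x$ of the $\mathbb{C}[X]$-module generated by the fields $\{\xi_j\mid\alpha_j(x)\neq0\}$ (where $\alpha_j$ is viewed as a function on $X$). Then $\mathrm{d}^{-1}(\Theta(\mathrm{Lie}_{alg}^\omega(X)))$ contains a $\mathbb{C}[X]$-submodule of $\mathcal{C}_{n-2}(X)$ that consists of all $(n-2)$-forms that can be presented as $\tau=\iota_\zeta\iota_\eta\omega$ with $\zeta$ running over $JN$ for some nontrivial (i.e. nonzero) ideal $J$ in $\mathbb{C}[X]$.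
   Context: All varieties are irreducible. An algebraic volume form is a nowhere vanishing algebraic top-degree form. $\iota$ denotes the interior product. A vector field is complete if it is generated by a holomorphic $\mathbb{C}_+$-action. $\mathrm{AVF}_\omega(X)$ is the space of algebraic vector fields on $X$ with zero $\omega$-divergence (zero Lie derivative of $\omega$), $\mathrm{IVF}_\omega(X)$ is its subset of complete fields, and $\mathrm{Lie}_{alg}^\omega(X)$ is the Lie algebra generated by $\mathrm{IVF}_\omega(X)$. $\mathcal{C}_k(X)$, $\mathcal{Z}_k(X)$, $\mathcal{B}_k(X)$ denote the spaces of algebraic, closed algebraic, and exact algebraic (differentials of algebraic forms) $k$-forms on $X$. $\Theta:\mathrm{AVF}_\omega(X)\to\mathcal{Z}_{n-1}(X)$ is the isomorphism $\xi\mapsto\iota_\xi\omega$, and $\mathrm{d}:\mathcal{C}_{n-2}(X)\to\mathcal{B}_{n-1}(X)$ is the exterior differential. Vector fields are identified with derivations, and $\operatorname{Ker}$ denotes the kernel in the ring of regular functions. A pair $(\xi,\eta)$ of nontrivial complete algebraic vector fields on a smooth affine variety $X'$ is semi-compatible if the linear span of $\operatorname{Ker}\xi\cdot\operatorname{Ker}\eta$ contains a nonzero ideal of $\mathbb{C}[X']$. *)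

theory Defs
  imports "HOL-Analysis.Analysis" "HOL-Library.Function_Algebras"
begin

(* Sums, products and zero of functions are pointwise (Function_Algebras).  A regular function
   on a subset S of complex^'n is represented by its extension by 0 outside S, so that
   functions that agree on S are equal in HOL. *)

type_synonym 'n rfun = "complex^'n \<Rightarrow> complex"
type_synonym 'n vfield = "'n rfun \<Rightarrow> 'n rfun"
type_synonym 'n dform = "'n vfield list \<Rightarrow> 'n rfun"


section \<open>Affine varieties\<close>

inductive_set poly_funs :: "('n::finite) rfun set" where
  const: "(\<lambda>_. c) \<in> poly_funs"
| coord: "(\<lambda>x. x $ i) \<in> poly_funs"
| add: "p \<in> poly_funs \<Longrightarrow> q \<in> poly_funs \<Longrightarrow> (\<lambda>x. p x + q x) \<in> poly_funs"
| mult: "p \<in> poly_funs \<Longrightarrow> q \<in> poly_funs \<Longrightarrow> (\<lambda>x. p x * q x) \<in> poly_funs"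

definition zclosed :: "(complex^'n::finite) set \<Rightarrow> bool" where
  "zclosed X \<longleftrightarrow> (\<exists>P\<subseteq>poly_funs. X = {x. \<forall>p\<in>P. p x = 0})"

definition affine_variety :: "(complex^'n::finite) set \<Rightarrow> bool" where
  "affine_variety X \<longleftrightarrow> zclosed X \<and> X \<noteq> {} \<and>
     (\<forall>Y Z. zclosed Y \<and> zclosed Z \<and> X = Y \<union> Z \<longrightarrow> X = Y \<or> X = Z)"

(* Krull dimension: the supremum of the lengths of chains of irreducible closed subsets.
   The set of lengths is bounded by CARD('n), so the supremum on nat is a genuine one. *)
definition variety_dim :: "(complex^'n::finite) set \<Rightarrow> nat" where
  "variety_dim X = Sup {n. \<exists>Z. (\<forall>i\<le>n. affine_variety (Z i) \<and> Z i \<subseteq> X) \<and>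
                               (\<forall>i<n. Z i \<subset> Z (Suc i))}"

definition zariski_tangent :: "(complex^'n::finite) set \<Rightarrow> complex^'n \<Rightarrow> (complex^'n) set" where
  "zariski_tangent X x =
     {v. \<forall>p\<in>poly_funs. (\<forall>y\<in>X. p y = 0) \<longrightarrow> frechet_derivative p (at x) v = 0}"

definition smooth_affine_variety :: "(complex^'n::finite) set \<Rightarrow> bool" where
  "smooth_affine_variety X \<longleftrightarrow> affine_variety X \<and>
     (\<forall>x\<in>X. vec.dim (zariski_tangent X x) = variety_dim X)"

definition zero_outside :: "(complex^'n) set \<Rightarrow> 'n rfun \<Rightarrow> 'n rfun" where
  "zero_outside S f = (\<lambda>x. if x \<in> S then f x else 0)"

definition coord_ring :: "(complex^'n::finite) set \<Rightarrow> 'n rfun set" where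
  "coord_ring X = zero_outside X ` poly_funs"

definition principal_open :: "(complex^'n) set \<Rightarrow> 'n rfun \<Rightarrow> (complex^'n) set" where
  "principal_open X a = X - {x\<in>X. a x = 0}"

(* The coordinate ring of the affine variety principal_open X a is the localization of
   the one of X at the powers of a. *)
definition coord_ring_open :: "(complex^'n::finite) set \<Rightarrow> 'n rfun \<Rightarrow> 'n rfun set" where
  "coord_ring_open X a =
     {zero_outside (principal_open X a) (\<lambda>x. f x / a x ^ m) | f m. f \<in> coord_ring X}"

definition is_morphism ::
  "(complex^'n::finite \<Rightarrow> complex^'m::finite) \<Rightarrow> (complex^'n) set \<Rightarrow> (complex^'m) set \<Rightarrow> bool" where
  "is_morphism \<pi> X B \<longleftrightarrow> \<pi> ` X \<subseteq> B \<and> (\<forall>j. zero_outside X (\<lambda>x. \<pi> x $ j) \<in> coord_ring X)"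

definition pullback :: "(complex^'n) set \<Rightarrow> (complex^'n \<Rightarrow> complex^'m) \<Rightarrow> 'm rfun \<Rightarrow> 'n rfun" where
  "pullback X \<pi> f = zero_outside X (f \<circ> \<pi>)"

definition is_ideal :: "'n rfun set \<Rightarrow> 'n rfun set \<Rightarrow> bool" where
  "is_ideal A J \<longleftrightarrow> J \<subseteq> A \<and> 0 \<in> J \<and> (\<forall>f\<in>J. \<forall>g\<in>J. f + g \<in> J) \<and> (\<forall>f\<in>A. \<forall>g\<in>J. f * g \<in> J)"


section \<open>Algebraic vector fields as derivations\<close>

(* Vector fields are set to 0 outside the ring A, so that derivations that agree on A are
   equal in HOL. *)
definition vfields :: "'n rfun set \<Rightarrow> 'n vfield set" where
  "vfields A = {\<xi>. (\<forall>f. f \<notin> A \<longrightarrow> \<xi> f = 0) \<and> (\<forall>f\<in>A. \<xi> f \<in> A) \<and>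
     (\<forall>f\<in>A. \<forall>g\<in>A. \<xi> (f + g) = \<xi> f + \<xi> g) \<and>
     (\<forall>c. \<forall>f\<in>A. \<xi> (\<lambda>x. c * f x) = (\<lambda>x. c * \<xi> f x)) \<and>
     (\<forall>f\<in>A. \<forall>g\<in>A. \<xi> (f * g) = f * \<xi> g + g * \<xi> f)}"

definition ker :: "'n rfun set \<Rightarrow> 'n vfield \<Rightarrow> 'n rfun set" where
  "ker A \<xi> = {f\<in>A. \<xi> f = 0}"

definition bracket :: "'n vfield \<Rightarrow> 'n vfield \<Rightarrow> 'n vfield" where
  "bracket \<xi> \<eta> = (\<lambda>f. \<xi> (\<eta> f) - \<eta> (\<xi> f))"

definition vf_scale :: "'n rfun \<Rightarrow> 'n vfield \<Rightarrow> 'n vfield" where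
  "vf_scale h \<xi> = (\<lambda>f. h * \<xi> f)"

inductive_set lie_generated :: "'n vfield set \<Rightarrow> 'n vfield set" for S where
  base: "\<xi> \<in> S \<Longrightarrow> \<xi> \<in> lie_generated S"
| zero: "0 \<in> lie_generated S"
| add: "\<xi> \<in> lie_generated S \<Longrightarrow> \<eta> \<in> lie_generated S \<Longrightarrow> \<xi> + \<eta> \<in> lie_generated S"
| scale: "\<xi> \<in> lie_generated S \<Longrightarrow> vf_scale (\<lambda>_. c) \<xi> \<in> lie_generated S"
| bracket: "\<xi> \<in> lie_generated S \<Longrightarrow> \<eta> \<in> lie_generated S \<Longrightarrow> bracket \<xi> \<eta> \<in> lie_generated S"

definition complex_linear ::
  "(complex \<times> (complex^'n) \<Rightarrow> complex^'n) \<Rightarrow> bool" where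
  "complex_linear L \<longleftrightarrow> (\<forall>z w. L (z + w) = L z + L w) \<and>
     (\<forall>c u v. L (c * u, c *s v) = c *s (L (u, v)))"

(* S is locally closed in complex^'n, so a map on UNIV \<times> S is holomorphic iff it extends
   locally to a holomorphic map of the ambient space. *)
definition holomorphic_flow ::
  "(complex^'n::finite) set \<Rightarrow> (complex \<times> (complex^'n) \<Rightarrow> complex^'n) \<Rightarrow> bool" where
  "holomorphic_flow S \<Phi> \<longleftrightarrow> (\<forall>z \<in> UNIV \<times> S. \<exists>U F. open U \<and> z \<in> U \<and>
     (\<forall>w\<in>U. \<exists>L. complex_linear L \<and> (F has_derivative L) (at w)) \<and>
     (\<forall>w \<in> U \<inter> (UNIV \<times> S). F w = \<Phi> w))"

definition holomorphic_action ::
  "(complex^'n::finite) set \<Rightarrow> (complex \<times> (complex^'n) \<Rightarrow> complex^'n) \<Rightarrow> bool" where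
  "holomorphic_action S \<Phi> \<longleftrightarrow> holomorphic_flow S \<Phi> \<and>
     (\<forall>t. \<forall>x\<in>S. \<Phi> (t, x) \<in> S) \<and> (\<forall>x\<in>S. \<Phi> (0, x) = x) \<and>
     (\<forall>s t. \<forall>x\<in>S. \<Phi> (s + t, x) = \<Phi> (s, \<Phi> (t, x)))"

definition complete_vf :: "(complex^'n::finite) set \<Rightarrow> 'n rfun set \<Rightarrow> 'n vfield \<Rightarrow> bool" where
  "complete_vf S A \<xi> \<longleftrightarrow> (\<exists>\<Phi>. holomorphic_action S \<Phi> \<and>
     (\<forall>f\<in>A. \<forall>x\<in>S. ((\<lambda>t. f (\<Phi> (t, x))) has_field_derivative \<xi> f x) (at 0)))"

(* S is the set of points of a smooth affine variety and A its coordinate ring. *)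
definition semi_compatible ::
  "(complex^'n::finite) set \<Rightarrow> 'n rfun set \<Rightarrow> 'n vfield \<Rightarrow> 'n vfield \<Rightarrow> bool" where
  "semi_compatible S A \<xi> \<eta> \<longleftrightarrow>
     \<xi> \<in> vfields A \<and> \<eta> \<in> vfields A \<and> \<xi> \<noteq> 0 \<and> \<eta> \<noteq> 0 \<and>
     complete_vf S A \<xi> \<and> complete_vf S A \<eta> \<and>
     (\<exists>J. is_ideal A J \<and> J \<noteq> {0} \<and>
        J \<subseteq> module.span (\<lambda>c f x. c * f x) {f * g | f g. f \<in> ker A \<xi> \<and> g \<in> ker A \<eta>})"

definition restricts_to_open ::
  "(complex^'n::finite) set \<Rightarrow> 'n rfun \<Rightarrow> 'n vfield \<Rightarrow> 'n vfield \<Rightarrow> bool" where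
  "restricts_to_open X a \<xi> \<xi>' \<longleftrightarrow> \<xi>' \<in> vfields (coord_ring_open X a) \<and>
     (\<forall>f\<in>coord_ring X.
        \<xi>' (zero_outside (principal_open X a) f) = zero_outside (principal_open X a) (\<xi> f))"

(* The restrictions exist and are unique (quotient rule). *)
definition semi_compatible_on_open ::
  "(complex^'n::finite) set \<Rightarrow> 'n rfun \<Rightarrow> 'n vfield \<Rightarrow> 'n vfield \<Rightarrow> bool" where
  "semi_compatible_on_open X a \<xi> \<eta> \<longleftrightarrow>
     (\<exists>\<xi>' \<eta>'. restricts_to_open X a \<xi> \<xi>' \<and> restricts_to_open X a \<eta> \<eta>' \<and>
        semi_compatible (principal_open X a) (coord_ring_open X a) \<xi>' \<eta>')"

definition vf_module_generated :: "'n rfun set \<Rightarrow> 'i set \<Rightarrow> ('i \<Rightarrow> 'n vfield) \<Rightarrow> 'n vfield set" where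
  "vf_module_generated A I \<xi> = {\<Sum>i\<in>I. vf_scale (h i) (\<xi> i) | h. \<forall>i\<in>I. h i \<in> A}"

definition ideal_times_module :: "'n rfun set \<Rightarrow> 'n vfield set \<Rightarrow> 'n vfield set" where
  "ideal_times_module J N =
     {\<Sum>l<m. vf_scale (h l) (\<nu> l) | (m::nat) h \<nu>. \<forall>l<m. h l \<in> J \<and> \<nu> l \<in> N}"

(* The fraction \<nu> / s in the localization of the module vfields A at the point x, as an
   equivalence class of pairs of numerator and denominator. *)
definition vf_fraction ::
  "'n rfun set \<Rightarrow> complex^'n \<Rightarrow> 'n vfield \<Rightarrow> 'n rfun \<Rightarrow> ('n vfield \<times> 'n rfun) set" where
  "vf_fraction A x \<nu> s = {(\<mu>, t). \<mu> \<in> vfields A \<and> t \<in> A \<and> t x \<noteq> 0 \<and>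
     (\<exists>u\<in>A. u x \<noteq> 0 \<and> vf_scale (u * t) \<nu> = vf_scale (u * s) \<mu>)}"

(* For a submodule N of vfields A, its localization at x as a subset of the one of vfields A. *)
definition vf_localization ::
  "'n rfun set \<Rightarrow> complex^'n \<Rightarrow> 'n vfield set \<Rightarrow> ('n vfield \<times> 'n rfun) set set" where
  "vf_localization A x N = {vf_fraction A x \<nu> s | \<nu> s. \<nu> \<in> N \<and> s \<in> A \<and> s x \<noteq> 0}"


section \<open>Algebraic differential forms\<close>

(* On a smooth affine variety X the tangent bundle is an algebraic vector bundle whose sections
   are the derivations of the coordinate ring A, and an algebraic k-form is an alternating
   A-multilinear map that sends k vector fields to a function.  The arguments form a list, and
   the value is 0 on lists of a wrong length or with an entry that is not a vector field. *)
definition forms :: "'n rfun set \<Rightarrow> nat \<Rightarrow> 'n dform set" where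
  "forms A k = {\<tau>.
     (\<forall>vs. \<not> (length vs = k \<and> set vs \<subseteq> vfields A) \<longrightarrow> \<tau> vs = 0) \<and>
     (\<forall>vs. length vs = k \<and> set vs \<subseteq> vfields A \<longrightarrow>
        \<tau> vs \<in> A \<and>
        (\<not> distinct vs \<longrightarrow> \<tau> vs = 0) \<and>
        (\<forall>i<k. \<forall>\<xi>\<in>vfields A. \<tau> (vs[i := vs ! i + \<xi>]) = \<tau> vs + \<tau> (vs[i := \<xi>])) \<and>
        (\<forall>i<k. \<forall>h\<in>A. \<tau> (vs[i := vf_scale h (vs ! i)]) = h * \<tau> vs))}"

definition interior_product :: "'n vfield \<Rightarrow> 'n dform \<Rightarrow> 'n dform" where
  "interior_product \<xi> \<tau> = (\<lambda>vs. \<tau> (\<xi> # vs))"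

definition delete_nth :: "nat \<Rightarrow> 'a list \<Rightarrow> 'a list" where
  "delete_nth i vs = take i vs @ drop (Suc i) vs"

(* Koszul's formula (without a factor 1/(k+1)). *)
definition ext_deriv :: "'n rfun set \<Rightarrow> 'n dform \<Rightarrow> 'n dform" where
  "ext_deriv A \<tau> = (\<lambda>vs. if set vs \<subseteq> vfields A then
     (\<Sum>i<length vs. (-1) ^ i * (vs ! i) (\<tau> (delete_nth i vs))) +
     (\<Sum>j<length vs. \<Sum>i<j. (-1) ^ (i + j) *
        \<tau> (bracket (vs ! i) (vs ! j) # delete_nth i (delete_nth j vs)))
   else 0)"

definition lie_derivative :: "'n rfun set \<Rightarrow> 'n vfield \<Rightarrow> 'n dform \<Rightarrow> 'n dform" where
  "lie_derivative A \<xi> \<tau> = (\<lambda>vs. if set vs \<subseteq> vfields A then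
     \<xi> (\<tau> vs) - (\<Sum>i<length vs. \<tau> (vs[i := bracket \<xi> (vs ! i)]))
   else 0)"

(* The vectors of vector fields at x exhaust the tangent space of the smooth variety X at x,
   so the condition says that the form vanishes at no point. *)
definition volume_form :: "(complex^'n::finite) set \<Rightarrow> 'n dform \<Rightarrow> bool" where
  "volume_form X \<omega> \<longleftrightarrow> \<omega> \<in> forms (coord_ring X) (variety_dim X) \<and>
     (\<forall>x\<in>X. \<exists>vs. \<omega> vs x \<noteq> 0)"

definition is_form_submodule :: "'n rfun set \<Rightarrow> nat \<Rightarrow> 'n dform set \<Rightarrow> bool" where
  "is_form_submodule A k M \<longleftrightarrow> M \<subseteq> forms A k \<and> 0 \<in> M \<and>
     (\<forall>\<sigma>\<in>M. \<forall>\<tau>\<in>M. \<sigma> + \<tau> \<in> M) \<and> (\<forall>h\<in>A. \<forall>\<tau>\<in>M. (\<lambda>vs. h * \<tau> vs) \<in> M)"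

definition AVF :: "(complex^'n::finite) set \<Rightarrow> 'n dform \<Rightarrow> 'n vfield set" where
  "AVF X \<omega> = {\<xi> \<in> vfields (coord_ring X). lie_derivative (coord_ring X) \<xi> \<omega> = 0}"

definition IVF :: "(complex^'n::finite) set \<Rightarrow> 'n dform \<Rightarrow> 'n vfield set" where
  "IVF X \<omega> = {\<xi> \<in> AVF X \<omega>. complete_vf X (coord_ring X) \<xi>}"

definition Lie_alg :: "(complex^'n::finite) set \<Rightarrow> 'n dform \<Rightarrow> 'n vfield set" where
  "Lie_alg X \<omega> = lie_generated (IVF X \<omega>)"

definition Theta :: "'n dform \<Rightarrow> 'n vfield \<Rightarrow> 'n dform" where
  "Theta \<omega> \<xi> = interior_product \<xi> \<omega>"

definition d_preimage :: "(complex^'n::finite) set \<Rightarrow> nat \<Rightarrow> 'n dform set \<Rightarrow> 'n dform set" where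
  "d_preimage X k S = {\<tau> \<in> forms (coord_ring X) k. ext_deriv (coord_ring X) \<tau> \<in> S}"

end

theory Submission
  imports Defs "HOL-Computational_Algebra.Fundamental_Theorem_Algebra"
begin

text \<open>If \<open>\<xi>\<close> and \<open>\<eta>\<close> are divergence-free, then \<open>d \<iota>\<^sub>\<xi> \<iota>\<^sub>\<eta> \<omega> = \<iota>\<^bsub>[\<xi>,\<eta>]\<^esub> \<omega>\<close>. Hence every form
  \<open>v \<iota>\<^sub>\<xi> \<iota>\<^sub>\<eta> \<omega>\<close> with \<open>\<xi> = \<xi>\<^sub>i\<close> and \<open>v\<close> in the span \<open>V\<^sub>i\<close> of \<open>Ker \<xi>\<^sub>i \<cdot> Ker \<eta>\<close> is admissible, and
  \<open>E = \<Sum>\<^sub>i V\<^sub>i \<xi>\<^sub>i\<close> is a \<open>\<complex>[B]\<close>-module. Semi-compatibility gives \<open>h\<^sub>i \<noteq> 0\<close> such that every multiple of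
  \<open>h\<^sub>i\<close> lies in \<open>V\<^sub>i\<close> after multiplication by some power of \<open>\<alpha>\<^sub>i\<close>, but this power cannot be bounded.
  Therefore \<open>\<theta> N \<subseteq> E\<close> is checked element by element and locally on \<open>B\<close>: over \<open>b\<close>, with
  \<open>I = {i. \<alpha>\<^sub>i b \<noteq> 0}\<close>, the hypothesis on localizations at a single point over \<open>b\<close> gives \<open>u\<^sub>I \<noteq> 0\<close>
  with \<open>u\<^sub>I N \<subseteq> \<Sum>\<^bsub>i \<in> I\<^esub> \<complex>[X] \<xi>\<^sub>i\<close>. With \<open>\<theta> = \<Prod>\<^sub>i h\<^sub>i \<cdot> \<Prod>\<^sub>I u\<^sub>I\<close>, the functions on \<open>B\<close> that carry a
  given element of \<open>\<theta> N\<close> into \<open>E\<close> form an ideal without zeros, so the ideal contains 1.\<close>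

subsection \<open>Derivations of an algebra of functions\<close>

text \<open>The order of choices matters: \<open>\<theta>\<close> is fixed first, then the element
  of \<open>N\<close>, and the exponents of the \<alpha>_i last of all, so that they may depend on
  the element and on b. This is harmless because the functions on B lie in Ker \<eta> and hence
  multiply every V_i. Only finitely many sets I exist although b runs over all of B, so
  \<open>\<theta>\<close> is a finite product. The condition \<alpha>_i in Ker \<xi>_i is what
  allows kernel elements on the open set X_i to be cleared of denominators within the kernel.

  Regular functions are extended by 0, so the constant 1 is in general not in the ring. Its place is
  taken by \<open>one_on X\<close>; powers occur with exponent \<open>Suc m\<close> or next to a
  factor from the ring, and products carry an additional factor from the ring.

  Since \<open>ext_deriv\<close> is Koszul's formula on lists, the calculus of d, the Lie derivative
  and the interior product is built by removing the first entry of the list. The volume form enters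
  through the vanishing of (n+1)-forms, which rests on smoothness: tangent spaces have dimension n,
  so n+1 fields are linearly dependent.\<close>

locale function_algebra =
  fixes A :: "('n::finite) rfun set"
  assumes A_zero [simp]: "0 \<in> A"
    and A_add [simp]: "f \<in> A \<Longrightarrow> g \<in> A \<Longrightarrow> f + g \<in> A"
    and A_mult [simp]: "f \<in> A \<Longrightarrow> g \<in> A \<Longrightarrow> f * g \<in> A"
    and A_scale [simp]: "f \<in> A \<Longrightarrow> (\<lambda>x. c * f x) \<in> A"
begin

lemma A_uminus [simp]: "f \<in> A \<Longrightarrow> - f \<in> A"
proof -
  assume "f \<in> A"
  moreover have "- f = (\<lambda>x. (-1) * f x)" by (auto simp: fun_eq_iff)
  ultimately show ?thesis using A_scale by metis
qed

lemma A_diff [simp]: "f \<in> A \<Longrightarrow> g \<in> A \<Longrightarrow> f - g \<in> A"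
  using A_add[of f "- g"] by simp

lemma A_sum: "(\<And>i. i \<in> I \<Longrightarrow> f i \<in> A) \<Longrightarrow> sum f I \<in> A"
  by (induction I rule: infinite_finite_induct) auto

lemma A_sign [simp]: "f \<in> A \<Longrightarrow> (-1) ^ i * f \<in> A"
  by (cases "even i") auto

text \<open>The exponent starts at 1 because \<open>f ^ 0\<close> is the constant 1, which
  \<open>A\<close> need not contain.\<close>

lemma A_power_Suc [simp]: "f \<in> A \<Longrightarrow> f ^ Suc m \<in> A"
  by (induction m) auto

lemma A_power_mult [simp]: "f \<in> A \<Longrightarrow> g \<in> A \<Longrightarrow> f ^ m * g \<in> A"
  by (induction m) (auto simp: mult.assoc)

abbreviation "D \<equiv> vfields A"

lemma D_closed: "\<xi> \<in> D \<Longrightarrow> \<xi> f \<in> A"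
  unfolding vfields_def mem_Collect_eq by (metis A_zero)

lemma D_out: "\<xi> \<in> D \<Longrightarrow> f \<notin> A \<Longrightarrow> \<xi> f = 0"
  unfolding vfields_def by blast

lemma D_add: "\<xi> \<in> D \<Longrightarrow> f \<in> A \<Longrightarrow> g \<in> A \<Longrightarrow> \<xi> (f + g) = \<xi> f + \<xi> g"
  unfolding vfields_def by blast

lemma D_scale: "\<xi> \<in> D \<Longrightarrow> f \<in> A \<Longrightarrow> \<xi> (\<lambda>x. c * f x) = (\<lambda>x. c * \<xi> f x)"
  unfolding vfields_def by blast

lemma D_mult: "\<xi> \<in> D \<Longrightarrow> f \<in> A \<Longrightarrow> g \<in> A \<Longrightarrow> \<xi> (f * g) = f * \<xi> g + g * \<xi> f"
  unfolding vfields_def by blast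

lemma D_zero: "\<xi> \<in> D \<Longrightarrow> \<xi> 0 = 0"
  using D_add[of \<xi> 0 0] by simp

lemma D_uminus: "\<xi> \<in> D \<Longrightarrow> f \<in> A \<Longrightarrow> \<xi> (- f) = - \<xi> f"
  using D_add[of \<xi> f "- f"] D_zero[of \<xi>] A_uminus[of f]
  by (metis add.right_inverse minus_unique)

lemma vfieldsI:
  assumes "\<And>f. f \<notin> A \<Longrightarrow> \<xi> f = 0" "\<And>f. f \<in> A \<Longrightarrow> \<xi> f \<in> A"
    and "\<And>f g. f \<in> A \<Longrightarrow> g \<in> A \<Longrightarrow> \<xi> (f + g) = \<xi> f + \<xi> g"
    and "\<And>c f. f \<in> A \<Longrightarrow> \<xi> (\<lambda>x. c * f x) = (\<lambda>x. c * \<xi> f x)"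
    and "\<And>f g. f \<in> A \<Longrightarrow> g \<in> A \<Longrightarrow> \<xi> (f * g) = f * \<xi> g + g * \<xi> f"
  shows "\<xi> \<in> D"
  unfolding vfields_def using assms by blast

lemma zero_in_D [simp]: "0 \<in> D"
  by (rule vfieldsI) (auto simp: fun_eq_iff)

lemma add_in_D [simp]:
  assumes "\<xi> \<in> D" "\<eta> \<in> D"
  shows "\<xi> + \<eta> \<in> D"
  by (rule vfieldsI)
    (simp_all add: D_out[OF assms(1)] D_out[OF assms(2)] D_closed[OF assms(1)] D_closed[OF assms(2)]
      D_add[OF assms(1)] D_add[OF assms(2)] D_scale[OF assms(1)] D_scale[OF assms(2)]
      D_mult[OF assms(1)] D_mult[OF assms(2)] fun_eq_iff algebra_simps)

lemma scale_in_D [simp]: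
  assumes "h \<in> A" "\<xi> \<in> D"
  shows "vf_scale h \<xi> \<in> D"
  by (rule vfieldsI)
    (simp_all add: D_out[OF assms(2)] D_closed[OF assms(2)] assms(1) vf_scale_def
      D_add[OF assms(2)] D_scale[OF assms(2)] D_mult[OF assms(2)] fun_eq_iff algebra_simps)

text \<open>Not an instance of \<open>scale_in_D\<close>, since constants need not lie in
  \<open>A\<close>; this is the scaling that occurs in \<open>lie_generated\<close>.\<close>

lemma const_scale_in_D [simp]:
  assumes "\<xi> \<in> D"
  shows "vf_scale (\<lambda>_. c) \<xi> \<in> D"
proof -
  have "(\<lambda>_. c) * \<xi> f \<in> A" for f
    using A_scale[OF D_closed[OF assms], of c f] by (simp add: times_fun_def)
  then show ?thesis
    by (intro vfieldsI)
      (simp_all add: D_out[OF assms] vf_scale_def D_add[OF assms] D_scale[OF assms]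
        D_mult[OF assms] fun_eq_iff algebra_simps)
qed

lemma uminus_in_D [simp]:
  assumes "\<xi> \<in> D"
  shows "- \<xi> \<in> D"
proof -
  have "- \<xi> = vf_scale (\<lambda>_. -1) \<xi>" by (simp add: vf_scale_def fun_eq_iff)
  then show ?thesis using const_scale_in_D[OF assms] by metis
qed

lemma sum_in_D: "(\<And>i. i \<in> I \<Longrightarrow> \<xi> i \<in> D) \<Longrightarrow> sum \<xi> I \<in> D"
  by (induction I rule: infinite_finite_induct) auto

lemma bracket_in_D [simp]:
  assumes "\<xi> \<in> D" "\<eta> \<in> D"
  shows "bracket \<xi> \<eta> \<in> D"
proof -
  note r = D_out[OF assms(1)] D_out[OF assms(2)] D_closed[OF assms(1)] D_closed[OF assms(2)]
    D_add[OF assms(1)] D_add[OF assms(2)] D_scale[OF assms(1)] D_scale[OF assms(2)]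
    D_mult[OF assms(1)] D_mult[OF assms(2)] D_zero[OF assms(1)] D_zero[OF assms(2)]
  show ?thesis
    by (rule vfieldsI) (simp_all add: bracket_def r fun_eq_iff algebra_simps)
qed

lemma bracket_scale_left:
  assumes "\<xi> \<in> D" "\<eta> \<in> D" "h \<in> A"
  shows "bracket (vf_scale h \<xi>) \<eta> = vf_scale h (bracket \<xi> \<eta>) + vf_scale (- \<eta> h) \<xi>"
  by (rule ext)
    (simp add: bracket_def vf_scale_def D_mult[OF assms(2,3)] D_closed[OF assms(1)] algebra_simps)

lemma bracket_add_left:
  assumes "\<xi> \<in> D" "\<eta> \<in> D" "\<zeta> \<in> D"
  shows "bracket (\<xi> + \<eta>) \<zeta> = bracket \<xi> \<zeta> + bracket \<eta> \<zeta>"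
  by (rule ext)
    (simp add: bracket_def D_add[OF assms(3)] D_closed[OF assms(1)] D_closed[OF assms(2)])

lemma bracket_swap: "bracket \<eta> \<xi> = - bracket \<xi> \<eta>"
  by (auto simp: bracket_def fun_eq_iff)

lemma ker_mult [simp]: "\<xi> \<in> D \<Longrightarrow> f \<in> ker A \<xi> \<Longrightarrow> g \<in> ker A \<xi> \<Longrightarrow> f * g \<in> ker A \<xi>"
  using D_mult[of \<xi> f g] by (simp add: ker_def)

subsection \<open>Alternating forms\<close>

lemma form_out: "\<sigma> \<in> forms A k \<Longrightarrow> \<not> (length vs = k \<and> set vs \<subseteq> D) \<Longrightarrow> \<sigma> vs = 0"
  unfolding forms_def by blast

lemma form_closed: "\<sigma> \<in> forms A k \<Longrightarrow> \<sigma> vs \<in> A"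
  unfolding forms_def mem_Collect_eq by (metis A_zero)

lemma form_not_distinct: "\<sigma> \<in> forms A k \<Longrightarrow> \<not> distinct vs \<Longrightarrow> \<sigma> vs = 0"
  unfolding forms_def mem_Collect_eq by (metis A_zero)

text \<open>Length and remaining entries are unrestricted: on an inadmissible list all three values
  are 0.\<close>

lemma form_add:
  assumes "\<sigma> \<in> forms A k" "a \<in> D" "b \<in> D"
  shows "\<sigma> (us @ (a + b) # ws) = \<sigma> (us @ a # ws) + \<sigma> (us @ b # ws)"
proof (cases "length (us @ a # ws) = k \<and> set (us @ a # ws) \<subseteq> D")
  case True
  then have "\<sigma> ((us @ a # ws)[length us := (us @ a # ws) ! length us + b])
    = \<sigma> (us @ a # ws) + \<sigma> ((us @ a # ws)[length us := b])"
    using assms unfolding forms_def mem_Collect_eq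
    by (metis (no_types, lifting) length_append length_Cons less_add_Suc1 add_Suc_right)
  then show ?thesis by simp
next
  case False
  then show ?thesis using assms by (subst (1 2 3) form_out[OF assms(1)]) auto
qed

lemma form_scale:
  assumes "\<sigma> \<in> forms A k" "a \<in> D" "h \<in> A"
  shows "\<sigma> (us @ vf_scale h a # ws) = h * \<sigma> (us @ a # ws)"
proof (cases "length (us @ a # ws) = k \<and> set (us @ a # ws) \<subseteq> D")
  case True
  then have "\<sigma> ((us @ a # ws)[length us := vf_scale h ((us @ a # ws) ! length us)])
    = h * \<sigma> (us @ a # ws)"
    using assms unfolding forms_def mem_Collect_eq
    by (metis (no_types, lifting) length_append length_Cons less_add_Suc1 add_Suc_right)
  then show ?thesis by simp
next
  case False
  then show ?thesis using assms by (subst (1 2) form_out[OF assms(1)]) auto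
qed

lemmas form_add_hd = form_add[where us = "[]", simplified]
lemmas form_scale_hd = form_scale[where us = "[]", simplified]

lemma form_zero_entry: "\<sigma> \<in> forms A k \<Longrightarrow> \<sigma> (us @ 0 # ws) = 0"
  using form_add[of \<sigma> k 0 0 us ws] by simp

lemma form_uminus:
  assumes "\<sigma> \<in> forms A k" "a \<in> D"
  shows "\<sigma> (us @ (- a) # ws) = - \<sigma> (us @ a # ws)"
  using form_add[OF assms(1), of a "- a" us ws] assms(2)
  by (simp add: form_zero_entry[OF assms(1)] eq_neg_iff_add_eq_0 add.commute)

lemma form_sum:
  assumes "\<sigma> \<in> forms A k" "finite I" "\<And>i. i \<in> I \<Longrightarrow> a i \<in> D"
  shows "\<sigma> (us @ sum a I # ws) = (\<Sum>i\<in>I. \<sigma> (us @ a i # ws))"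
  using assms(2,3)
  by (induction I rule: finite_induct)
    (auto simp: form_zero_entry[OF assms(1)] form_add[OF assms(1)] sum_in_D)

text \<open>Adjacent swaps generate all permutations. In this form the sign rule passes to interior
  products and, entry by entry, to the exterior differential.\<close>

definition alternating :: "'n dform \<Rightarrow> bool" where
  "alternating \<sigma> \<longleftrightarrow> (\<forall>us a b ws. \<sigma> (us @ a # b # ws) = - \<sigma> (us @ b # a # ws))"

lemma alternatingD: "alternating \<sigma> \<Longrightarrow> \<sigma> (us @ a # b # ws) = - \<sigma> (us @ b # a # ws)"
  unfolding alternating_def by blast

text \<open>Polarization: expand the value 0 at the repeated entry a + b. If an entry is not a
  vector field, both sides are 0.\<close>

lemma form_alternating:
  assumes "\<sigma> \<in> forms A k"
  shows "alternating \<sigma>"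
  unfolding alternating_def
proof (intro allI)
  fix us a b ws
  show "\<sigma> (us @ a # b # ws) = - \<sigma> (us @ b # a # ws)"
  proof (cases "a \<in> D \<and> b \<in> D")
    case True
    have add: "\<sigma> (us @ a # (a + b) # ws) = \<sigma> (us @ a # a # ws) + \<sigma> (us @ a # b # ws)"
      "\<sigma> (us @ b # (a + b) # ws) = \<sigma> (us @ b # a # ws) + \<sigma> (us @ b # b # ws)"
      using form_add[OF assms, of a b "us @ [a]" ws] form_add[OF assms, of a b "us @ [b]" ws]
        True by auto
    have rep: "\<sigma> (us @ c # c # ws) = 0" for c
      by (rule form_not_distinct[OF assms]) simp
    have "0 = \<sigma> (us @ (a + b) # (a + b) # ws)"
      by (rule sym, rule form_not_distinct[OF assms]) simp
    also have "\<dots> = \<sigma> (us @ a # b # ws) + \<sigma> (us @ b # a # ws)"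
      using True form_add[OF assms, of a b us "(a + b) # ws"]
      by (simp only: add rep) simp
    finally show ?thesis unfolding eq_neg_iff_add_eq_0 by (rule sym)
  next
    case False
    then show ?thesis by (subst (1 2) form_out[OF assms]) auto
  qed
qed

lemma alternating_move:
  assumes "alternating \<sigma>"
  shows "\<sigma> (us @ w # ws) = (-1) ^ length us * \<sigma> (w # us @ ws)"
proof (induction us arbitrary: ws rule: rev_induct)
  case (snoc u us)
  then show ?case using alternatingD[OF assms, of us u w ws] by simp
qed simp

text \<open>Two equal entries are moved to the front, where swapping them shows that the value
  equals its negative.\<close>

lemma alternating_not_distinct:
  assumes "alternating \<sigma>" "\<not> distinct vs"
  shows "\<sigma> vs = 0"
proof -
  obtain us a vs' ws where vs: "vs = us @ a # vs' @ a # ws"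
    using assms(2) not_distinct_decomp by fastforce
  have *: "(2::'n rfun) * f = 0 \<Longrightarrow> f = 0" for f
    by (auto simp: fun_eq_iff)
  have "\<sigma> (a # a # us') = 0" for us'
    by (rule *) (use alternatingD[OF assms(1), of "[]" a a us'] in \<open>simp only: mult_2 append_Nil flip: eq_neg_iff_add_eq_0\<close>)
  moreover have "\<sigma> vs = (-1) ^ length us * ((-1) ^ length (a # us @ vs') * \<sigma> (a # (a # us @ vs') @ ws))"
    unfolding vs using alternating_move[OF assms(1), of us a "vs' @ a # ws"]
      alternating_move[OF assms(1), of "a # us @ vs'" a ws] by simp
  ultimately show ?thesis by simp
qed

lemma form_list_update:
  assumes "\<sigma> \<in> forms A k" "i < length vs"
  shows "\<sigma> (vs[i := w]) = (-1) ^ i * \<sigma> (w # delete_nth i vs)"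
proof -
  have "vs[i := w] = take i vs @ w # drop (Suc i) vs" "length (take i vs) = i"
    using assms(2) by (simp_all add: upd_conv_take_nth_drop)
  then show ?thesis
    using alternating_move[OF form_alternating[OF assms(1)], of "take i vs" w "drop (Suc i) vs"]
    by (simp only: delete_nth_def)
qed

text \<open>Alternation moves any slot to the front up to sign, so linearity has to be checked only
  in the first entry.\<close>

lemma formI:
  assumes "\<And>vs. \<not> (length vs = k \<and> set vs \<subseteq> D) \<Longrightarrow> \<sigma> vs = 0"
    and "\<And>vs. length vs = k \<Longrightarrow> set vs \<subseteq> D \<Longrightarrow> \<sigma> vs \<in> A"
    and "alternating \<sigma>"
    and "\<And>a b vs. a \<in> D \<Longrightarrow> b \<in> D \<Longrightarrow> set vs \<subseteq> D \<Longrightarrow> \<sigma> ((a + b) # vs) = \<sigma> (a # vs) + \<sigma> (b # vs)"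
    and "\<And>h a vs. h \<in> A \<Longrightarrow> a \<in> D \<Longrightarrow> set vs \<subseteq> D \<Longrightarrow> \<sigma> (vf_scale h a # vs) = h * \<sigma> (a # vs)"
  shows "\<sigma> \<in> forms A k"
proof -
  have "\<sigma> (vs[i := vs ! i + \<xi>]) = \<sigma> vs + \<sigma> (vs[i := \<xi>]) \<and>
    (\<forall>h\<in>A. \<sigma> (vs[i := vf_scale h (vs ! i)]) = h * \<sigma> vs)"
    if "length vs = k" "set vs \<subseteq> D" "i < k" "\<xi> \<in> D" for vs i \<xi>
  proof -
    define us ws where uw: "us = take i vs" "ws = drop (Suc i) vs"
    have mv: "\<sigma> (vs[i := w]) = (-1) ^ length us * \<sigma> (w # us @ ws)" for w
      using alternating_move[OF assms(3), of us w ws] that uw by (simp add: upd_conv_take_nth_drop)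
    have "set (us @ ws) \<subseteq> D" using that(2) uw set_take_subset set_drop_subset by fastforce
    moreover have "vs ! i \<in> D" using that by (meson nth_mem subsetD)
    moreover have "\<sigma> vs = (-1) ^ length us * \<sigma> (vs ! i # us @ ws)"
      using mv[of "vs ! i"] by simp
    ultimately show ?thesis using that(4) unfolding mv
      by (auto simp: assms(4,5) algebra_simps)
  qed
  note upd = this
  have "\<sigma> (vs[i := vf_scale h (vs ! i)]) = h * \<sigma> vs"
    if "length vs = k" "set vs \<subseteq> D" "i < k" "h \<in> A" for vs i h
    using upd[OF that(1-3) zero_in_D] that(4) by blast
  then show ?thesis
    unfolding forms_def mem_Collect_eq
    using assms(1,2) alternating_not_distinct[OF assms(3)] upd by blast
qed

lemma zero_form [simp]: "0 \<in> forms A k"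
  by (rule formI) (simp_all only: alternating_def zero_fun_apply A_zero minus_zero add_0 mult_zero_right simp_thms)

lemma mult_form [simp]:
  assumes "h \<in> A" "\<sigma> \<in> forms A k"
  shows "(\<lambda>vs. h * \<sigma> vs) \<in> forms A k"
proof (rule formI)
  show "alternating (\<lambda>vs. h * \<sigma> vs)"
    unfolding alternating_def mult_minus_right[symmetric]
    by (intro allI arg_cong2[where f = "(*)"] refl alternatingD form_alternating[OF assms(2)])
qed (simp_all add: form_out[OF assms(2)] form_closed[OF assms(2)] form_add_hd[OF assms(2)]
    form_scale_hd[OF assms(2)] assms(1) algebra_simps)

text \<open>The truncated \<open>k - 1\<close> is correct for k = 0 as well: the contraction of a
  0-form is 0.\<close>

lemma interior_product_form [simp]:
  assumes "\<xi> \<in> D" "\<sigma> \<in> forms A k"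
  shows "interior_product \<xi> \<sigma> \<in> forms A (k - 1)"
proof (rule formI)
  fix vs assume "\<not> (length vs = k - 1 \<and> set vs \<subseteq> D)"
  then show "interior_product \<xi> \<sigma> vs = 0"
    unfolding interior_product_def by (intro form_out[OF assms(2)]) auto
next
  show "alternating (interior_product \<xi> \<sigma>)"
    unfolding alternating_def interior_product_def append_Cons[symmetric]
    by (intro allI alternatingD form_alternating[OF assms(2)])
next
  fix a b vs assume "a \<in> D" "b \<in> D"
  then show "interior_product \<xi> \<sigma> ((a + b) # vs) = interior_product \<xi> \<sigma> (a # vs) + interior_product \<xi> \<sigma> (b # vs)"
    unfolding interior_product_def using form_add[OF assms(2), of a b "[\<xi>]" vs] by simp
next
  fix h a vs assume "h \<in> A" "a \<in> D"
  then show "interior_product \<xi> \<sigma> (vf_scale h a # vs) = h * interior_product \<xi> \<sigma> (a # vs)"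
    unfolding interior_product_def using form_scale[OF assms(2), of a h "[\<xi>]" vs] by simp
qed (simp add: interior_product_def form_closed[OF assms(2)])

end

context function_algebra begin

subsection \<open>Lie derivative and exterior differential\<close>

text \<open>The commutation rule of the Lie derivative with an interior product. The term with index
  0 of the sum is the one with the bracket; the conditional is there because \<open>\<sigma>\<close>
  need not be a form and so may be nonzero on inadmissible lists.\<close>

lemma lie_Cons:
  assumes "a \<in> D"
  shows "lie_derivative A \<xi> \<sigma> (a # vs)
    = lie_derivative A \<xi> (interior_product a \<sigma>) vs
      - (if set vs \<subseteq> D then interior_product (bracket \<xi> a) \<sigma> vs else 0)"
  unfolding lie_derivative_def interior_product_def length_Cons sum.lessThan_Suc_shift
  using assms by (simp add: algebra_simps)

lemma ext_deriv_out: "\<not> set vs \<subseteq> D \<Longrightarrow> ext_deriv A \<sigma> vs = 0"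
  unfolding ext_deriv_def by (rule if_not_P)

lemma lie_out: "\<not> set vs \<subseteq> D \<Longrightarrow> lie_derivative A \<xi> \<sigma> vs = 0"
  unfolding lie_derivative_def by (rule if_not_P)

lemma length_delete_nth: "i < length vs \<Longrightarrow> length (delete_nth i vs) = length vs - 1"
  unfolding delete_nth_def by simp

text \<open>Cartan's formula serves as a recursion for the exterior differential.\<close>
lemma cartan:
  assumes \<sigma>: "\<sigma> \<in> forms A k" and \<xi>: "\<xi> \<in> D" and vs: "set vs \<subseteq> D"
  shows "ext_deriv A \<sigma> (\<xi> # vs)
    = lie_derivative A \<xi> \<sigma> vs - ext_deriv A (interior_product \<xi> \<sigma>) vs"
proof -
  let ?n = "length vs"
  have del0: "delete_nth 0 (\<xi> # ws) = ws" and delS: "delete_nth (Suc i) (\<xi> # ws) = \<xi> # delete_nth i ws" for i ws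
    by (simp_all add: delete_nth_def)
  have swap: "\<sigma> (a # \<xi> # ws) = - \<sigma> (\<xi> # a # ws)" for a ws
    using alternatingD[OF form_alternating[OF \<sigma>], of "[]" a \<xi> ws] by (simp only: append_Nil)
  have D_sign: "a ((-1) ^ i * f) = (-1) ^ i * a f" if "a \<in> D" "f \<in> A" for a f i
    using D_uminus[OF that] by (cases "even i") auto
  have first: "(\<Sum>i<length (\<xi> # vs). (-1) ^ i * ((\<xi> # vs) ! i) (\<sigma> (delete_nth i (\<xi> # vs))))
    = \<xi> (\<sigma> vs) - (\<Sum>i<?n. (-1) ^ i * (vs ! i) (\<sigma> (\<xi> # delete_nth i vs)))"
    unfolding length_Cons sum.lessThan_Suc_shift del0 delS by (simp add: sum_negf)
  \<comment> \<open>The pairs with first index 0 give the brackets with \<open>\<xi>\<close>, which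
    belong to the Lie derivative. In all other pairs both indices are shifted by one, which keeps
    the sign, and moving \<open>\<xi>\<close> back to the front produces the minus.\<close>
  have inner: "(\<Sum>i<Suc j. (-1) ^ (i + Suc j) *
        \<sigma> (bracket ((\<xi> # vs) ! i) ((\<xi> # vs) ! Suc j) # delete_nth i (delete_nth (Suc j) (\<xi> # vs))))
    = - ((-1) ^ j * \<sigma> (bracket \<xi> (vs ! j) # delete_nth j vs))
      - (\<Sum>i<j. (-1) ^ (i + j) * \<sigma> (\<xi> # bracket (vs ! i) (vs ! j) # delete_nth i (delete_nth j vs)))"
    for j
    unfolding sum.lessThan_Suc_shift delS del0 nth_Cons_Suc nth_Cons_0 swap
    by (simp add: sum_negf)
  have second: "(\<Sum>j<length (\<xi> # vs). \<Sum>i<j. (-1) ^ (i + j) *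
        \<sigma> (bracket ((\<xi> # vs) ! i) ((\<xi> # vs) ! j) # delete_nth i (delete_nth j (\<xi> # vs))))
    = - (\<Sum>j<?n. (-1) ^ j * \<sigma> (bracket \<xi> (vs ! j) # delete_nth j vs))
      - (\<Sum>j<?n. \<Sum>i<j. (-1) ^ (i + j) *
        \<sigma> (\<xi> # bracket (vs ! i) (vs ! j) # delete_nth i (delete_nth j vs)))"
    unfolding length_Cons sum.lessThan_Suc_shift[of _ ?n] inner
    by (simp add: sum_subtractf sum_negf)
  have lie: "lie_derivative A \<xi> \<sigma> vs
    = \<xi> (\<sigma> vs) - (\<Sum>j<?n. (-1) ^ j * \<sigma> (bracket \<xi> (vs ! j) # delete_nth j vs))"
    unfolding lie_derivative_def if_P[OF vs]
    by (intro arg_cong2[where f = "(-)"] refl sum.cong form_list_update[OF \<sigma>]) simp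
  have set: "set (\<xi> # vs) \<subseteq> D" using \<xi> vs by simp
  show ?thesis
    unfolding ext_deriv_def if_P[OF set] if_P[OF vs] first second lie interior_product_def
    by (simp add: algebra_simps)
qed

lemma d_add:
  assumes "\<sigma> \<in> forms A k" "\<tau> \<in> forms A l"
  shows "ext_deriv A (\<sigma> + \<tau>) = ext_deriv A \<sigma> + ext_deriv A \<tau>"
proof (rule ext)
  fix vs
  have "(\<Sum>i<length vs. (-1) ^ i * (vs ! i) ((\<sigma> + \<tau>) (delete_nth i vs)))
    = (\<Sum>i<length vs. (-1) ^ i * (vs ! i) (\<sigma> (delete_nth i vs)) + (-1) ^ i * (vs ! i) (\<tau> (delete_nth i vs)))"
    if "set vs \<subseteq> D"
  proof (intro sum.cong refl)
    fix i assume "i \<in> {..<length vs}"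
    then have v: "vs ! i \<in> D" using that by auto
    show "(-1) ^ i * (vs ! i) ((\<sigma> + \<tau>) (delete_nth i vs))
      = (-1) ^ i * (vs ! i) (\<sigma> (delete_nth i vs)) + (-1) ^ i * (vs ! i) (\<tau> (delete_nth i vs))"
      by (simp add: D_add[OF v] form_closed[OF assms(1)] form_closed[OF assms(2)] distrib_left)
  qed
  then show "ext_deriv A (\<sigma> + \<tau>) vs = (ext_deriv A \<sigma> + ext_deriv A \<tau>) vs"
    unfolding ext_deriv_def by (simp add: sum.distrib distrib_left)
qed

lemma d_closed:
  assumes "\<sigma> \<in> forms A k"
  shows "ext_deriv A \<sigma> vs \<in> A"
proof (cases "set vs \<subseteq> D")
  case True
  then have "vs ! i \<in> D" if "i < length vs" for i
    using that nth_mem by blast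
  then show ?thesis
    unfolding ext_deriv_def if_P[OF True]
    by (intro A_add A_sum A_sign form_closed[OF assms] D_closed) simp
qed (simp add: ext_deriv_out)

text \<open>The wedge product of dh with \<open>\<sigma>\<close>, normalized as in
  \<open>ext_deriv\<close>.\<close>

definition dwedge :: "'n rfun \<Rightarrow> 'n dform \<Rightarrow> 'n dform" where
  "dwedge h \<sigma> vs = (\<Sum>i<length vs. (-1) ^ i * ((vs ! i) h * \<sigma> (delete_nth i vs)))"

lemma d_mult:
  assumes "\<sigma> \<in> forms A k" "h \<in> A" "set vs \<subseteq> D"
  shows "ext_deriv A (\<lambda>vs. h * \<sigma> vs) vs = h * ext_deriv A \<sigma> vs + dwedge h \<sigma> vs"
proof -
  have "(\<Sum>i<length vs. (-1) ^ i * (vs ! i) (h * \<sigma> (delete_nth i vs)))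
    = (\<Sum>i<length vs. h * ((-1) ^ i * (vs ! i) (\<sigma> (delete_nth i vs)))
        + (-1) ^ i * ((vs ! i) h * \<sigma> (delete_nth i vs)))"
  proof (intro sum.cong refl)
    fix i assume "i \<in> {..<length vs}"
    then have v: "vs ! i \<in> D" using assms(3) by auto
    show "(-1) ^ i * (vs ! i) (h * \<sigma> (delete_nth i vs))
      = h * ((-1) ^ i * (vs ! i) (\<sigma> (delete_nth i vs))) + (-1) ^ i * ((vs ! i) h * \<sigma> (delete_nth i vs))"
      by (simp add: D_mult[OF v assms(2)] form_closed[OF assms(1)] algebra_simps)
  qed
  then show ?thesis
    unfolding ext_deriv_def if_P[OF assms(3)] dwedge_def
    by (simp add: sum.distrib sum_distrib_left algebra_simps)
qed

lemma dwedge_interior: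
  assumes "\<sigma> \<in> forms A k"
  shows "dwedge h (interior_product \<xi> \<sigma>) vs = (\<Sum>i<length vs. (vs ! i) h * \<sigma> (vs[i := \<xi>]))"
  unfolding dwedge_def interior_product_def
  by (intro sum.cong refl) (simp add: form_list_update[OF assms] algebra_simps)

text \<open>The Leibniz term -v(h) \<xi> of the bracket of h \<xi> with v accumulates over all
  entries v to the wedge product of dh with the contraction by \<open>\<xi>\<close>.\<close>

lemma lie_scale:
  assumes "\<sigma> \<in> forms A k" "h \<in> A" "\<xi> \<in> D" "set vs \<subseteq> D"
  shows "lie_derivative A (vf_scale h \<xi>) \<sigma> vs
    = h * lie_derivative A \<xi> \<sigma> vs + dwedge h (interior_product \<xi> \<sigma>) vs"
proof -
  have "(\<Sum>i<length vs. \<sigma> (vs[i := bracket (vf_scale h \<xi>) (vs ! i)]))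
    = (\<Sum>i<length vs. h * \<sigma> (vs[i := bracket \<xi> (vs ! i)]) - (vs ! i) h * \<sigma> (vs[i := \<xi>]))"
  proof (intro sum.cong refl)
    fix i assume i: "i \<in> {..<length vs}"
    then have v: "vs ! i \<in> D" using assms(4) by auto
    then have 1: "- (vs ! i) h \<in> A" using D_closed[of "vs ! i" h] by simp
    have "vs[i := w] = take i vs @ w # drop (Suc i) vs" for w
      using i by (simp add: upd_conv_take_nth_drop)
    then show "\<sigma> (vs[i := bracket (vf_scale h \<xi>) (vs ! i)])
      = h * \<sigma> (vs[i := bracket \<xi> (vs ! i)]) - (vs ! i) h * \<sigma> (vs[i := \<xi>])"
      using v 1 assms(2,3)
      by (simp add: bracket_scale_left form_add[OF assms(1)] form_scale[OF assms(1)])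
  qed
  then show ?thesis
    unfolding dwedge_interior[OF assms(1)]
    unfolding lie_derivative_def if_P[OF assms(4)]
    by (simp add: vf_scale_def sum_subtractf sum_distrib_left algebra_simps)
qed

lemma lie_interior:
  assumes "\<sigma> \<in> forms A k" "\<xi> \<in> D" "\<eta> \<in> D" "set vs \<subseteq> D"
  shows "lie_derivative A \<xi> (interior_product \<eta> \<sigma>) vs
    = interior_product (bracket \<xi> \<eta>) \<sigma> vs + lie_derivative A \<xi> \<sigma> (\<eta> # vs)"
  using assms(4) by (simp add: lie_Cons[OF assms(3)])

lemma uminus_form:
  assumes "\<sigma> \<in> forms A k"
  shows "- \<sigma> \<in> forms A k"
proof (rule formI)
  show "alternating (- \<sigma>)"
    unfolding alternating_def
  proof (intro allI)
    fix us a b ws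
    show "(- \<sigma>) (us @ a # b # ws) = - (- \<sigma>) (us @ b # a # ws)"
      by (simp only: uminus_apply[of \<sigma>] alternatingD[OF form_alternating[OF assms], of us a b ws])
  qed
qed (simp_all add: form_out[OF assms] form_closed[OF assms] form_add_hd[OF assms] form_scale_hd[OF assms])

lemma d_zero: "ext_deriv A 0 = 0"
  using d_add[OF zero_form zero_form] by (simp only: add_0 add_cancel_right_right)

lemma d_uminus: "\<sigma> \<in> forms A k \<Longrightarrow> ext_deriv A (- \<sigma>) = - ext_deriv A \<sigma>"
  using d_add[of \<sigma> k "- \<sigma>" k] uminus_form[of \<sigma> k] d_zero
  by (metis add.right_inverse minus_unique)

lemma lie_uminus: "\<sigma> \<in> forms A k \<Longrightarrow> \<xi> \<in> D \<Longrightarrow> lie_derivative A \<xi> (- \<sigma>) vs = - lie_derivative A \<xi> \<sigma> vs"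
  unfolding lie_derivative_def
  by (simp add: D_uminus[of \<xi>] form_closed[of \<sigma> k] sum_negf)

lemma interior_swap:
  assumes "\<sigma> \<in> forms A k"
  shows "interior_product a (interior_product b \<sigma>) = - interior_product b (interior_product a \<sigma>)"
proof (rule ext)
  fix vs
  show "interior_product a (interior_product b \<sigma>) vs = (- interior_product b (interior_product a \<sigma>)) vs"
    using alternatingD[OF form_alternating[OF assms], of "[]" b a vs]
    by (simp only: append_Nil interior_product_def uminus_apply)
qed

text \<open>Removing entries by \<open>lie_Cons\<close> reduces to an empty prefix; there the two
  swapped entries are split off as well, and the resulting terms change sign together.\<close>

lemma lie_alternating:
  assumes "\<sigma> \<in> forms A k" "\<xi> \<in> D"
  shows "lie_derivative A \<xi> \<sigma> (us @ a # b # ws) = - lie_derivative A \<xi> \<sigma> (us @ b # a # ws)"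
proof (cases "set (us @ a # b # ws) \<subseteq> D")
  case True
  then show ?thesis using assms(1)
  proof (induction us arbitrary: \<sigma> k)
    case Nil
    then have in_D: "a \<in> D" "b \<in> D" "set ws \<subseteq> D" by auto
    have ab: "bracket \<xi> a \<in> D" "bracket \<xi> b \<in> D" using in_D assms(2) by auto
    note f = interior_product_form[OF in_D(2) interior_product_form[OF in_D(1) Nil(2)]]
    have 1: "lie_derivative A \<xi> \<sigma> (x # y # ws) = lie_derivative A \<xi> (interior_product y (interior_product x \<sigma>)) ws
       - \<sigma> (x # bracket \<xi> y # ws) - \<sigma> (bracket \<xi> x # y # ws)" if "x \<in> D" "y \<in> D" for x y
      using in_D(3) that by (simp add: lie_Cons interior_product_def)
    have sw: "\<sigma> (x # y # ws) = - \<sigma> (y # x # ws)" for x y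
      using alternatingD[OF form_alternating[OF Nil(2)], of "[]" x y ws] by (simp only: append_Nil)
    show ?case
      unfolding append_Nil 1[OF in_D(1,2)] 1[OF in_D(2,1)] interior_swap[OF Nil(2), of a b]
        lie_uminus[OF f assms(2)] sw[of b "bracket \<xi> a"] sw[of "bracket \<xi> b" a]
      by (simp add: fun_eq_iff algebra_simps)
  next
    case (Cons u us)
    then have in_D: "u \<in> D" "set (us @ a # b # ws) \<subseteq> D" "set (us @ b # a # ws) \<subseteq> D" by auto
    have sw: "\<sigma> (bracket \<xi> u # us @ a # b # ws) = - \<sigma> (bracket \<xi> u # us @ b # a # ws)"
      using alternatingD[OF form_alternating[OF Cons(3)], of "bracket \<xi> u # us" a b ws] by simp
    show ?case
      unfolding append_Cons lie_Cons[OF in_D(1)] if_P[OF in_D(2)] if_P[OF in_D(3)]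
        Cons.IH[OF in_D(2) interior_product_form[OF in_D(1) Cons(3)]]
      unfolding interior_product_def sw by simp
  qed
next
  case False
  then have "\<not> set (us @ b # a # ws) \<subseteq> D" by auto
  then show ?thesis unfolding lie_out[OF False] by (subst lie_out) auto
qed

text \<open>As for the Lie derivative, now by Cartan's formula. Using it twice writes the value at
  x, y as two Lie derivatives, a bracket term and the differential of a double contraction;
  exchanging x and y reverses the sign of the whole.\<close>

lemma d_alternating:
  assumes "\<sigma> \<in> forms A k"
  shows "alternating (ext_deriv A \<sigma>)"
  unfolding alternating_def
proof (intro allI)
  fix us a b ws
  show "ext_deriv A \<sigma> (us @ a # b # ws) = - ext_deriv A \<sigma> (us @ b # a # ws)"
  proof (cases "set (us @ a # b # ws) \<subseteq> D")
    case True
    then show ?thesis using assms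
    proof (induction us arbitrary: \<sigma> k)
      case Nil
      then have in_D: "a \<in> D" "b \<in> D" "set ws \<subseteq> D" by auto
      note f = interior_product_form[OF in_D(2) interior_product_form[OF in_D(1) Nil(2)]]
      have 1: "ext_deriv A \<sigma> (x # y # ws) = lie_derivative A x \<sigma> (y # ws) - lie_derivative A y \<sigma> (x # ws)
          - \<sigma> (bracket y x # ws) + ext_deriv A (interior_product y (interior_product x \<sigma>)) ws"
        if "x \<in> D" "y \<in> D" for x y
        using that in_D(3)
        by (simp add: cartan[OF Nil(2)] cartan[OF interior_product_form[OF that(1) Nil(2)]]
          lie_interior[OF Nil(2)] interior_product_def[of "bracket _ _"])
      have br: "\<sigma> (bracket b a # ws) = - \<sigma> (bracket a b # ws)"
        using form_uminus[OF Nil(2) bracket_in_D[OF in_D(1,2)], of "[]" ws]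
        by (simp add: bracket_swap[of b a])
      show ?case
        unfolding append_Nil 1[OF in_D(1,2)] 1[OF in_D(2,1)] interior_swap[OF Nil(2), of a b]
          d_uminus[OF f] br by (simp add: fun_eq_iff algebra_simps)
    next
      case (Cons u us)
      then have in_D: "u \<in> D" "set (us @ a # b # ws) \<subseteq> D" "set (us @ b # a # ws) \<subseteq> D" by auto
      show ?case
        unfolding append_Cons cartan[OF Cons(3) in_D(1,2)] cartan[OF Cons(3) in_D(1,3)]
          Cons.IH[OF in_D(2) interior_product_form[OF in_D(1) Cons(3)]]
          lie_alternating[OF Cons(3) in_D(1), of us a b ws] by simp
    qed
  next
    case False
    then have "\<not> set (us @ b # a # ws) \<subseteq> D" by auto
    then show ?thesis unfolding ext_deriv_out[OF False] by (subst ext_deriv_out) auto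
  qed
qed

text \<open>Linearity in the first entry follows from Cartan's formula: the term with dh from
  \<open>lie_scale\<close> cancels against the one from \<open>d_mult\<close>.\<close>

lemma d_form:
  assumes "\<sigma> \<in> forms A k"
  shows "ext_deriv A \<sigma> \<in> forms A (Suc k)"
proof (rule formI)
  fix vs assume *: "\<not> (length vs = Suc k \<and> set vs \<subseteq> D)"
  show "ext_deriv A \<sigma> vs = 0"
  proof (cases "set vs \<subseteq> D")
    case True
    then have len: "length vs \<noteq> Suc k" using * by simp
    have "(vs ! i) (\<sigma> (delete_nth i vs)) = 0" if "i < length vs" for i
    proof -
      have "\<sigma> (delete_nth i vs) = 0"
        using len that by (intro form_out[OF assms]) (auto simp: length_delete_nth)
      moreover have "vs ! i \<in> D" using True that by auto
      ultimately show ?thesis by (simp only: D_zero)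
    qed
    moreover have "\<sigma> (x # delete_nth i (delete_nth j vs)) = 0" if "j < length vs" "i < j" for i j x
      using len that by (intro form_out[OF assms]) (auto simp: length_delete_nth)
    ultimately show ?thesis
      unfolding ext_deriv_def by simp
  qed (rule ext_deriv_out)
next
  fix a b vs assume ab: "a \<in> D" "b \<in> D" "set vs \<subseteq> D"
  have 1: "lie_derivative A (a + b) \<sigma> vs = lie_derivative A a \<sigma> vs + lie_derivative A b \<sigma> vs"
  proof -
    have "(\<Sum>i<length vs. \<sigma> (vs[i := bracket (a + b) (vs ! i)]))
      = (\<Sum>i<length vs. \<sigma> (vs[i := bracket a (vs ! i)]) + \<sigma> (vs[i := bracket b (vs ! i)]))"
    proof (intro sum.cong refl)
      fix i assume i: "i \<in> {..<length vs}"
      then have v: "vs ! i \<in> D" using ab(3) by auto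
      have "vs[i := w] = take i vs @ w # drop (Suc i) vs" for w
        using i by (simp add: upd_conv_take_nth_drop)
      then show "\<sigma> (vs[i := bracket (a + b) (vs ! i)])
        = \<sigma> (vs[i := bracket a (vs ! i)]) + \<sigma> (vs[i := bracket b (vs ! i)])"
        using v ab by (simp add: bracket_add_left form_add[OF assms])
    qed
    then show ?thesis
      unfolding lie_derivative_def if_P[OF ab(3)] by (simp add: sum.distrib)
  qed
  have "interior_product (a + b) \<sigma> = interior_product a \<sigma> + interior_product b \<sigma>"
    using form_add_hd[OF assms ab(1,2)] by (simp add: interior_product_def fun_eq_iff)
  then have 2: "ext_deriv A (interior_product (a + b) \<sigma>) vs
      = ext_deriv A (interior_product a \<sigma>) vs + ext_deriv A (interior_product b \<sigma>) vs"
    using d_add[OF interior_product_form[OF ab(1) assms] interior_product_form[OF ab(2) assms]]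
    by (simp only: plus_fun_apply[of "ext_deriv A _"])
  show "ext_deriv A \<sigma> ((a + b) # vs) = ext_deriv A \<sigma> (a # vs) + ext_deriv A \<sigma> (b # vs)"
    unfolding cartan[OF assms add_in_D[OF ab(1,2)] ab(3)] cartan[OF assms ab(1,3)]
      cartan[OF assms ab(2,3)] 1 2 by simp
next
  fix h a vs assume ha: "h \<in> A" "a \<in> D" "set vs \<subseteq> D"
  have "interior_product (vf_scale h a) \<sigma> = (\<lambda>vs. h * interior_product a \<sigma> vs)"
    unfolding interior_product_def by (rule ext) (rule form_scale_hd[OF assms ha(2,1)])
  then show "ext_deriv A \<sigma> (vf_scale h a # vs) = h * ext_deriv A \<sigma> (a # vs)"
    unfolding cartan[OF assms scale_in_D[OF ha(1,2)] ha(3)] cartan[OF assms ha(2,3)]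
      lie_scale[OF assms ha] d_mult[OF interior_product_form[OF ha(2) assms] ha(1,3), symmetric]
    using d_mult[OF interior_product_form[OF ha(2) assms] ha(1,3)]
    by (simp add: algebra_simps)
qed (simp_all only: d_closed[OF assms] d_alternating[OF assms])

end

subsection \<open>Volume forms\<close>

text \<open>Within this locale the dimension is represented by \<open>top_degree\<close>
  alone.\<close>

locale top_form = function_algebra +
  fixes \<omega> :: "'a dform" and n :: nat
  assumes volume: "\<omega> \<in> forms A n"
    and top_degree: "\<sigma> \<in> forms A (Suc n) \<Longrightarrow> \<sigma> = 0"
begin

lemma d_volume: "ext_deriv A \<omega> = 0"
  by (rule top_degree[OF d_form[OF volume]])

text \<open>Both \<omega> and h \<omega> are closed by degree, so the wedge product of dh with
  \<omega> vanishes. Contracting it with \<open>\<xi>\<close> identifies the extra term of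
  \<open>lie_scale\<close> as \<xi>(h) \<omega>.\<close>

lemma divergence_scale:
  assumes "h \<in> A" "\<xi> \<in> D" "set vs \<subseteq> D"
  shows "lie_derivative A (vf_scale h \<xi>) \<omega> vs = h * lie_derivative A \<xi> \<omega> vs + \<xi> h * \<omega> vs"
proof -
  have set: "set (\<xi> # vs) \<subseteq> D" using assms by simp
  have "ext_deriv A (\<lambda>vs. h * \<omega> vs) = 0"
    by (rule top_degree[OF d_form[OF mult_form[OF assms(1) volume]]])
  then have "dwedge h \<omega> (\<xi> # vs) = 0"
    using d_mult[OF volume assms(1) set] by (simp add: d_volume)
  then have "\<xi> h * \<omega> vs - dwedge h (interior_product \<xi> \<omega>) vs = 0"
    unfolding dwedge_def length_Cons sum.lessThan_Suc_shift
    by (simp add: delete_nth_def interior_product_def sum_negf)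
  then show ?thesis
    unfolding lie_scale[OF volume assms] by simp
qed

text \<open>The contraction of \<omega> by \<open>\<eta>\<close> is closed, by Cartan's formula and
  the vanishing divergence of \<open>\<eta>\<close>. A second use of the formula leaves a Lie
  derivative along \<open>\<xi>\<close>, which \<open>lie_interior\<close> evaluates.\<close>

lemma d_interior_interior:
  assumes "\<xi> \<in> D" "\<eta> \<in> D" "lie_derivative A \<xi> \<omega> = 0" "lie_derivative A \<eta> \<omega> = 0"
  shows "ext_deriv A (interior_product \<xi> (interior_product \<eta> \<omega>)) = interior_product (bracket \<xi> \<eta>) \<omega>"
proof (rule ext)
  fix vs
  show "ext_deriv A (interior_product \<xi> (interior_product \<eta> \<omega>)) vs = interior_product (bracket \<xi> \<eta>) \<omega> vs"
  proof (cases "set vs \<subseteq> D")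
    case True
    have "ext_deriv A (interior_product \<eta> \<omega>) (\<xi> # vs) = 0"
      using cartan[OF volume assms(2), of "\<xi> # vs"] assms True by (simp add: d_volume)
    then have "ext_deriv A (interior_product \<xi> (interior_product \<eta> \<omega>)) vs
      = lie_derivative A \<xi> (interior_product \<eta> \<omega>) vs"
      using cartan[OF interior_product_form[OF assms(2) volume] assms(1) True] by simp
    then show ?thesis
      using lie_interior[OF volume assms(1,2) True] assms(3) by simp
  next
    case False
    then show ?thesis by (simp add: ext_deriv_out interior_product_def form_out[OF volume, of "_ # vs"])
  qed
qed

end

lemma sum_fun_apply: "sum f I x = (\<Sum>i\<in>I. f i x)"
  by (induction I rule: infinite_finite_induct) auto

subsection \<open>Generic linear independence\<close>

text \<open>The unit is an element of \<open>A\<close>, for coordinate rings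
  \<open>one_on X\<close>, and not the constant function 1.\<close>

locale function_domain = function_algebra +
  assumes no_zero_divisors: "f \<in> A \<Longrightarrow> g \<in> A \<Longrightarrow> f * g = 0 \<Longrightarrow> f = 0 \<or> g = 0"
    and unit: "\<exists>e\<in>A. e \<noteq> 0 \<and> (\<forall>f\<in>A. e * f = f)"
begin

text \<open>Induction on the index set by fraction-free elimination of one coordinate.\<close>
lemma generic_independence:
  fixes w :: "'i \<Rightarrow> 'j \<Rightarrow> 'a rfun"
  assumes "finite I" "\<And>i j. i \<in> I \<Longrightarrow> w i j \<in> A"
    and "\<And>h. \<forall>i\<in>I. h i \<in> A \<Longrightarrow> \<forall>j. (\<Sum>i\<in>I. h i * w i j) = 0 \<Longrightarrow> \<forall>i\<in>I. h i = 0"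
  shows "\<exists>d\<in>A. d \<noteq> 0 \<and>
    (\<forall>x c. d x \<noteq> 0 \<longrightarrow> (\<forall>j. (\<Sum>i\<in>I. c i * w i j x) = 0) \<longrightarrow> (\<forall>i\<in>I. c i = 0))"
  using assms
proof (induction I arbitrary: w rule: finite_induct)
  case empty
  obtain e where "e \<in> A" "e \<noteq> 0" using unit by blast
  then show ?case by blast
next
  case (insert a I)
  obtain e where e: "e \<in> A" "e \<noteq> 0" "\<And>f. f \<in> A \<Longrightarrow> e * f = f"
    using unit by blast
  \<comment> \<open>If row \<open>a\<close> were zero, the coefficient \<open>e\<close> at
    \<open>a\<close> alone would be a nontrivial relation.\<close>
  have "\<exists>j0. w a j0 \<noteq> 0"
  proof (rule ccontr)
    assume "\<not> ?thesis"
    then have "(\<Sum>i\<in>insert a I. (if i = a then e else 0) * w i j) = 0"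
      for j by (intro sum.neutral) simp
    moreover have "\<forall>i\<in>insert a I. (if i = a then e else 0) \<in> A"
      using e(1) by simp
    ultimately have "\<forall>i\<in>insert a I. (if i = a then e else 0) = 0"
      using insert.prems(2)[of "\<lambda>i. if i = a then e else 0"] by blast
    then show False using e(2) by simp
  qed
  then obtain j0 where j0: "w a j0 \<noteq> 0" by blast
  define p where "p = w a j0"
  have p: "p \<in> A" "p \<noteq> 0" unfolding p_def using insert.prems(1) j0 by blast+
  \<comment> \<open>Elimination with pivot \<open>p\<close> without division: the new rows have
    entry 0 in column \<open>j0\<close>.\<close>
  define w' where "w' i j = p * w i j - w i j0 * w a j" for i j
  have "\<exists>d\<in>A. d \<noteq> 0 \<and>
    (\<forall>x c. d x \<noteq> 0 \<longrightarrow> (\<forall>j. (\<Sum>i\<in>I. c i * w' i j x) = 0) \<longrightarrow> (\<forall>i\<in>I. c i = 0))"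
  proof (rule insert.IH)
    show "w' i j \<in> A" if "i \<in> I" for i j
      using that p insert.prems(1) by (simp add: w'_def)
    fix h assume h: "\<forall>i\<in>I. h i \<in> A" "\<forall>j. (\<Sum>i\<in>I. h i * w' i j) = 0"
    \<comment> \<open>A relation between the reduced rows is lifted to the original rows; the
      coefficient at \<open>a\<close> collects what the elimination subtracted.\<close>
    define H where "H i = (if i = a then - (\<Sum>i\<in>I. h i * w i j0) else p * h i)" for i
    have "(\<Sum>i\<in>insert a I. H i * w i j) = 0" for j
    proof -
      have "(\<Sum>i\<in>I. H i * w i j) = (\<Sum>i\<in>I. p * h i * w i j)"
        using insert.hyps(2) by (intro sum.cong) (auto simp: H_def)
      then have "(\<Sum>i\<in>insert a I. H i * w i j)
        = - (\<Sum>i\<in>I. h i * w i j0) * w a j + (\<Sum>i\<in>I. p * h i * w i j)"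
        using insert.hyps by (simp add: H_def)
      moreover have "(\<Sum>i\<in>I. p * h i * w i j) = (\<Sum>i\<in>I. h i * w' i j) + (\<Sum>i\<in>I. h i * w i j0) * w a j"
        unfolding w'_def sum_distrib_right sum.distrib[symmetric]
        by (intro sum.cong refl) (simp add: algebra_simps)
      ultimately show ?thesis using h(2) by (simp only: add_0 mult_minus_left left_minus)
    qed
    moreover have "\<forall>i\<in>insert a I. H i \<in> A"
    proof
      fix i assume i: "i \<in> insert a I"
      have "(\<Sum>i\<in>I. h i * w i j0) \<in> A"
        by (intro A_sum A_mult) (use h(1) insert.prems(1) in blast)+
      then show "H i \<in> A"
        unfolding H_def using p(1) h(1) i by (cases "i = a") simp_all
    qed
    ultimately have "\<forall>i\<in>insert a I. H i = 0"
      using insert.prems(2)[of H] by blast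
    then have "p * h i = 0" if "i \<in> I" for i
      using that insert.hyps(2) by (auto simp: H_def split: if_splits)
    then show "\<forall>i\<in>I. h i = 0" using no_zero_divisors[OF p(1)] p(2) h(1) by blast
  qed
  then obtain d where d: "d \<in> A" "d \<noteq> 0"
    and indep: "\<And>x c. d x \<noteq> 0 \<Longrightarrow> \<forall>j. (\<Sum>i\<in>I. c i * w' i j x) = 0 \<Longrightarrow> \<forall>i\<in>I. c i = 0"
    by blast
  \<comment> \<open>Where \<open>p\<close> and \<open>d\<close> are both nonzero, the elimination is
    valid for the values at the point, so \<open>p * d\<close> is the witness.\<close>
  have "p * d \<noteq> 0" using no_zero_divisors p d by blast
  moreover have "\<forall>i\<in>insert a I. c i = 0"
    if x: "(p * d) x \<noteq> 0" and rel: "\<forall>j. (\<Sum>i\<in>insert a I. c i * w i j x) = 0" for x c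
  proof -
    have rel': "c a * w a j x = - (\<Sum>i\<in>I. c i * w i j x)" for j
      using rel[rule_format, of j] insert.hyps by (simp add: add_eq_0_iff)
    have "(\<Sum>i\<in>I. c i * w' i j x) = p x * (\<Sum>i\<in>I. c i * w i j x) - (\<Sum>i\<in>I. c i * w i j0 x) * w a j x" for j
      unfolding w'_def sum_distrib_left sum_distrib_right sum_subtractf[symmetric]
      by (intro sum.cong refl) (simp add: algebra_simps)
    moreover have "(\<Sum>i\<in>I. c i * w i j0 x) = - c a * p x"
      using rel'[of j0] by (simp add: p_def)
    moreover have "(\<Sum>i\<in>I. c i * w i j x) = - c a * w a j x" for j
      using rel'[of j] by simp
    ultimately have "\<forall>j. (\<Sum>i\<in>I. c i * w' i j x) = 0"
      by simp
    moreover have dx: "d x \<noteq> 0" "p x \<noteq> 0" using x by simp_all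
    ultimately have "\<forall>i\<in>I. c i = 0" using indep by blast
    moreover from this have "c a * p x = 0" using rel'[of j0] by (simp add: p_def)
    ultimately show ?thesis using dx by auto
  qed
  ultimately show ?case using A_mult[OF p(1) d(1)] by blast
qed

text \<open>The factor \<open>f\<close> keeps the product in \<open>A\<close> even when the index
  set is empty.\<close>

lemma prod_nonzero:
  assumes "finite I" "f \<in> A" "f \<noteq> 0" "\<And>i. i \<in> I \<Longrightarrow> g i \<in> A \<and> g i \<noteq> 0"
  shows "f * prod g I \<in> A \<and> f * prod g I \<noteq> 0"
  using assms(1,4)
proof (induction I rule: finite_induct)
  case (insert i I)
  then have "g i * (f * prod g I) \<in> A \<and> g i * (f * prod g I) \<noteq> 0"
    using no_zero_divisors[of "g i" "f * prod g I"] A_mult[of "g i" "f * prod g I"] by blast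
  moreover have "f * prod g (insert i I) = g i * (f * prod g I)"
    using insert.hyps by (simp add: mult.left_commute)
  ultimately show ?case by metis
qed (use assms in simp)

end

text \<open>Insert the relation into slot \<open>p\<close> and expand: every term with i different
  from p has a repeated entry.\<close>

lemma (in function_algebra) dependent_form_zero:
  assumes "\<sigma> \<in> forms A k" "length vs = k" "set vs \<subseteq> D" "p < k"
    and "\<And>i. i < k \<Longrightarrow> h i \<in> A" "(\<Sum>i<k. vf_scale (h i) (vs ! i)) = 0"
  shows "h p * \<sigma> vs = 0"
proof -
  have in_D: "vs ! i \<in> D" if "i < k" for i using that assms(2,3) by auto
  define us ws where "us = take p vs" and "ws = drop (Suc p) vs"
  have vs: "vs = us @ vs ! p # ws" and upd: "us @ w # ws = vs[p := w]" for w
    using assms(2,4) by (simp_all add: us_def ws_def id_take_nth_drop upd_conv_take_nth_drop)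
  have "0 = \<sigma> (us @ (\<Sum>i<k. vf_scale (h i) (vs ! i)) # ws)"
    unfolding assms(6) form_zero_entry[OF assms(1)] ..
  also have "\<dots> = (\<Sum>i<k. \<sigma> (us @ vf_scale (h i) (vs ! i) # ws))"
    by (rule form_sum[OF assms(1)]) (use assms(5) in_D in auto)
  also have "\<dots> = (\<Sum>i<k. h i * \<sigma> (us @ vs ! i # ws))"
    by (intro sum.cong refl form_scale[OF assms(1)]) (use assms(5) in_D in auto)
  also have "\<dots> = (\<Sum>i<k. if i = p then h p * \<sigma> vs else 0)"
  proof (intro sum.cong refl)
    fix i assume i: "i \<in> {..<k}"
    show "h i * \<sigma> (us @ vs ! i # ws) = (if i = p then h p * \<sigma> vs else 0)"
    proof (cases "i = p")
      case False
      then have "vs[p := vs ! i] ! i = vs[p := vs ! i] ! p" using i assms(2,4) by simp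
      then have "\<not> distinct (vs[p := vs ! i])"
        using False i assms(2,4) by (metis distinct_conv_nth length_list_update lessThan_iff)
      then show ?thesis using False form_not_distinct[OF assms(1)] upd by simp
    qed (use vs in simp)
  qed
  also have "\<dots> = h p * \<sigma> vs" using assms(4) by simp
  finally show ?thesis by simp
qed

subsection \<open>Coordinate rings\<close>

lemma zero_outside_simps:
  "zero_outside X p + zero_outside X q = zero_outside X (\<lambda>x. p x + q x)"
  "zero_outside X p * zero_outside X q = zero_outside X (\<lambda>x. p x * q x)"
  "(\<lambda>x. c * zero_outside X p x) = zero_outside X (\<lambda>x. c * p x)"
  by (auto simp: zero_outside_def fun_eq_iff)

lemma coord_ringE:
  assumes "f \<in> coord_ring X"
  obtains p where "p \<in> poly_funs" "f = zero_outside X p"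
  using assms by (auto simp: coord_ring_def)

lemma coord_ringI: "p \<in> poly_funs \<Longrightarrow> zero_outside X p \<in> coord_ring X"
  by (simp add: coord_ring_def)

lemma coord_ring_outside: "f \<in> coord_ring X \<Longrightarrow> x \<notin> X \<Longrightarrow> f x = 0"
  by (auto simp: coord_ring_def zero_outside_def)

lemma function_algebra_coord_ring: "function_algebra (coord_ring X)"
proof
  have "zero_outside X (\<lambda>_. 0) = 0" by (auto simp: zero_outside_def fun_eq_iff)
  then show "0 \<in> coord_ring X" using coord_ringI[OF poly_funs.const[of 0], of X] by simp
next
  fix f g :: "'a rfun" assume "f \<in> coord_ring X" "g \<in> coord_ring X"
  then obtain p q where "p \<in> poly_funs" "q \<in> poly_funs" "f = zero_outside X p" "g = zero_outside X q"
    by (auto simp: coord_ring_def)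
  then show "f + g \<in> coord_ring X" "f * g \<in> coord_ring X"
    by (simp_all add: zero_outside_simps coord_ringI poly_funs.add poly_funs.mult)
next
  fix f :: "'a rfun" and c assume "f \<in> coord_ring X"
  then obtain p where "p \<in> poly_funs" "f = zero_outside X p" by (auto simp: coord_ring_def)
  then show "(\<lambda>x. c * f x) \<in> coord_ring X"
    using coord_ringI[OF poly_funs.mult[OF poly_funs.const[of c]], of p X]
    by (simp add: zero_outside_simps)
qed

lemma zclosed_Int_zero:
  assumes "zclosed X" "p \<in> poly_funs"
  shows "zclosed (X \<inter> {x. p x = 0})"
proof -
  obtain P where "P \<subseteq> poly_funs" "X = {x. \<forall>p\<in>P. p x = 0}" using assms(1) unfolding zclosed_def by blast
  then show ?thesis unfolding zclosed_def using assms(2) by (intro exI[of _ "insert p P"]) auto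
qed

abbreviation one_on :: "(complex^'n) set \<Rightarrow> 'n rfun" where
  "one_on X \<equiv> zero_outside X (\<lambda>_. 1)"

lemma one_on_coord_ring: "one_on X \<in> coord_ring X"
  by (intro coord_ringI poly_funs.const)

lemma one_on_mult: "f \<in> coord_ring X \<Longrightarrow> one_on X * f = f"
  by (auto simp: coord_ring_def zero_outside_def fun_eq_iff)

text \<open>Irreducibility excludes zero divisors: if f g = 0, then X is the union of the closed
  zero sets of f and g.\<close>

lemma function_domain_coord_ring:
  assumes X: "affine_variety X"
  shows "function_domain (coord_ring X)"
proof -
  interpret function_algebra "coord_ring X" by (rule function_algebra_coord_ring)
  show ?thesis
  proof
    fix f g assume "f \<in> coord_ring X" "g \<in> coord_ring X" and fg: "f * g = 0"
    then obtain p q where p: "p \<in> poly_funs" "f = zero_outside X p"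
      and q: "q \<in> poly_funs" "g = zero_outside X q" by (auto simp: coord_ring_def)
    have "p x * q x = 0" if "x \<in> X" for x
      using fun_cong[OF fg, of x] that by (simp add: p q zero_outside_def)
    then have "X = (X \<inter> {x. p x = 0}) \<union> (X \<inter> {x. q x = 0})" by auto
    moreover have "zclosed (X \<inter> {x. p x = 0})" "zclosed (X \<inter> {x. q x = 0})"
      using X p q by (auto simp: affine_variety_def intro: zclosed_Int_zero)
    ultimately have "X = X \<inter> {x. p x = 0} \<or> X = X \<inter> {x. q x = 0}"
      using X unfolding affine_variety_def by blast
    then show "f = 0 \<or> g = 0" unfolding p q by (auto simp: zero_outside_def fun_eq_iff)
  next
    obtain x where "x \<in> X" using X by (auto simp: affine_variety_def)
    then have "one_on X \<noteq> 0" by (auto simp: zero_outside_def fun_eq_iff)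
    then show "\<exists>e\<in>coord_ring X. e \<noteq> 0 \<and> (\<forall>f\<in>coord_ring X. e * f = f)"
      using one_on_coord_ring one_on_mult by blast
  qed
qed

text \<open>The ambient vector along which the derivation differentiates at \<open>x\<close>; its
  entries are the values on the coordinate functions.\<close>

definition tangent_vector :: "(complex^'n::finite) set \<Rightarrow> 'n vfield \<Rightarrow> complex^'n \<Rightarrow> complex^'n" where
  "tangent_vector X \<xi> x = (\<chi> j. \<xi> (zero_outside X (\<lambda>y. y $ j)) x)"

text \<open>The chain rule, by induction on the polynomial. Homogeneity over the complex numbers is
  recorded separately because \<open>has_derivative\<close> gives only real linearity.\<close>

lemma poly_derivative:
  assumes "p \<in> poly_funs" "x \<in> X"
  obtains p' where "(p has_derivative p') (at x)" "\<And>c v. p' (c *s v) = c * p' v"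
    "\<And>\<xi>. \<xi> \<in> vfields (coord_ring X) \<Longrightarrow> \<xi> (zero_outside X p) x = p' (tangent_vector X \<xi> x)"
proof -
  interpret function_algebra "coord_ring X" by (rule function_algebra_coord_ring)
  from assms(1) have "\<exists>p'. (p has_derivative p') (at x) \<and> (\<forall>c v. p' (c *s v) = c * p' v) \<and>
    (\<forall>\<xi>\<in>D. \<xi> (zero_outside X p) x = p' (tangent_vector X \<xi> x))"
  proof induction
    case (const c)
    have "\<xi> (zero_outside X (\<lambda>_. c)) = 0" if \<xi>: "\<xi> \<in> D" for \<xi>
    proof -
      \<comment> \<open>The unit is idempotent, so a derivation kills it and with it all
        constants.\<close>
      have "\<xi> (one_on X) = \<xi> (one_on X) + \<xi> (one_on X)"
        using D_mult[OF \<xi> one_on_coord_ring one_on_coord_ring]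
        by (simp only: one_on_mult[OF one_on_coord_ring] one_on_mult[OF D_closed[OF \<xi>]])
      then have "\<xi> (one_on X) = 0" by (metis add_cancel_right_right)
      then show ?thesis using D_scale[OF \<xi> one_on_coord_ring[of X], of c]
        by (simp add: zero_outside_simps(3) fun_eq_iff)
    qed
    then show ?case by (intro exI[of _ "\<lambda>_. 0"]) auto
  next
    case (coord i)
    then show ?case
      by (intro exI[of _ "\<lambda>v. v $ i"])
        (simp add: tangent_vector_def bounded_linear_imp_has_derivative[OF bounded_linear_vec_nth])
  next
    case (add p q)
    then obtain p' q' where *: "(p has_derivative p') (at x)" "\<forall>c v. p' (c *s v) = c * p' v"
      "\<forall>\<xi>\<in>D. \<xi> (zero_outside X p) x = p' (tangent_vector X \<xi> x)"
      "(q has_derivative q') (at x)" "\<forall>c v. q' (c *s v) = c * q' v"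
      "\<forall>\<xi>\<in>D. \<xi> (zero_outside X q) x = q' (tangent_vector X \<xi> x)" by blast
    have "\<xi> (zero_outside X (\<lambda>x. p x + q x)) x = p' (tangent_vector X \<xi> x) + q' (tangent_vector X \<xi> x)"
      if "\<xi> \<in> D" for \<xi>
      using D_add[OF that coord_ringI coord_ringI] add.hyps *(3,6) that
      by (simp add: zero_outside_simps(1)[symmetric])
    then show ?case
      using * by (intro exI[of _ "\<lambda>v. p' v + q' v"])
        (simp add: has_derivative_add distrib_left)
  next
    case (mult p q)
    then obtain p' q' where *: "(p has_derivative p') (at x)" "\<forall>c v. p' (c *s v) = c * p' v"
      "\<forall>\<xi>\<in>D. \<xi> (zero_outside X p) x = p' (tangent_vector X \<xi> x)"
      "(q has_derivative q') (at x)" "\<forall>c v. q' (c *s v) = c * q' v"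
      "\<forall>\<xi>\<in>D. \<xi> (zero_outside X q) x = q' (tangent_vector X \<xi> x)" by blast
    have "\<xi> (zero_outside X (\<lambda>x. p x * q x)) x
      = p x * q' (tangent_vector X \<xi> x) + p' (tangent_vector X \<xi> x) * q x"
      if "\<xi> \<in> D" for \<xi>
      using D_mult[OF that coord_ringI[OF mult.hyps(1)] coord_ringI[OF mult.hyps(2)]] *(3,6) that assms(2)
      by (simp add: zero_outside_simps(2)[symmetric]) (simp add: zero_outside_def)
    then show ?case
      using * by (intro exI[of _ "\<lambda>v. p x * q' v + p' v * q x"] conjI has_derivative_mult)
        (simp_all add: algebra_simps)
  qed
  then show ?thesis using that by blast
qed

lemma tangent_vector_in_tangent_space:
  assumes "\<xi> \<in> vfields (coord_ring X)" "x \<in> X"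
  shows "tangent_vector X \<xi> x \<in> zariski_tangent X x"
  unfolding zariski_tangent_def
proof (intro CollectI ballI impI)
  interpret function_algebra "coord_ring X" by (rule function_algebra_coord_ring)
  fix p :: "'a rfun" assume p: "p \<in> poly_funs" "\<forall>y\<in>X. p y = 0"
  obtain p' where p': "(p has_derivative p') (at x)" "\<xi> (zero_outside X p) x = p' (tangent_vector X \<xi> x)"
    using poly_derivative[OF p(1) assms(2)] assms(1) by metis
  have "zero_outside X p = 0" using p(2) by (auto simp: zero_outside_def fun_eq_iff)
  then show "frechet_derivative p (at x) (tangent_vector X \<xi> x) = 0"
    using p' frechet_derivative_at[OF p'(1)] D_zero[OF assms(1)] by simp
qed

text \<open>Otherwise \<open>generic_independence\<close>, applied to the components of the fields,
  gives a point of X with n+1 independent tangent vectors, while smoothness bounds the dimension of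
  the tangent space by n.\<close>

lemma vfields_dependent:
  assumes X: "smooth_affine_variety X"
    and v: "\<And>i. i < Suc (variety_dim X) \<Longrightarrow> v i \<in> vfields (coord_ring X)"
  shows "\<exists>h. (\<forall>i<Suc (variety_dim X). h i \<in> coord_ring X) \<and> (\<exists>p<Suc (variety_dim X). h p \<noteq> 0) \<and>
    (\<Sum>i<Suc (variety_dim X). vf_scale (h i) (v i)) = 0"
proof (rule ccontr)
  assume contra: "\<not> ?thesis"
  let ?n = "Suc (variety_dim X)"
  have "affine_variety X" using X by (simp add: smooth_affine_variety_def)
  then interpret function_domain "coord_ring X" by (rule function_domain_coord_ring)
  let ?w = "\<lambda>i j. v i (zero_outside X (\<lambda>y. y $ j))"
  have "\<exists>d\<in>coord_ring X. d \<noteq> 0 \<and>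
    (\<forall>x c. d x \<noteq> 0 \<longrightarrow> (\<forall>j. (\<Sum>i<?n. c i * ?w i j x) = 0) \<longrightarrow> (\<forall>i\<in>{..<?n}. c i = 0))"
  proof (rule generic_independence)
    show "?w i j \<in> coord_ring X" if "i \<in> {..<?n}" for i j
      using D_closed v that by simp
    fix h assume h: "\<forall>i\<in>{..<?n}. h i \<in> coord_ring X" and rel: "\<forall>j. (\<Sum>i<?n. h i * ?w i j) = 0"
    \<comment> \<open>By \<open>poly_derivative\<close> a field is determined by its components, so
      a relation between the components is one between the fields.\<close>
    have "(\<Sum>i<?n. vf_scale (h i) (v i)) f x = 0" for f x
    proof (cases "f \<in> coord_ring X \<and> x \<in> X")
      case True
      then obtain p where p: "p \<in> poly_funs" "f = zero_outside X p" by (auto simp: coord_ring_def)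
      obtain p' where p': "(p has_derivative p') (at x)" "\<And>c v. p' (c *s v) = c * p' v"
        "\<And>\<xi>. \<xi> \<in> D \<Longrightarrow> \<xi> f x = p' (tangent_vector X \<xi> x)"
        using poly_derivative[OF p(1)] True p(2) by metis
      have relx: "(\<Sum>i<?n. h i x * ?w i j x) = 0" for j
        using fun_cong[OF rel[rule_format, of j], of x] by (simp add: sum_fun_apply)
      have "(\<Sum>i<?n. h i x * v i f x) = (\<Sum>i<?n. p' (h i x *s tangent_vector X (v i) x))"
        using p'(2,3) v by (intro sum.cong) auto
      also have "\<dots> = p' (\<Sum>i<?n. h i x *s tangent_vector X (v i) x)"
        using has_derivative_linear[OF p'(1)] by (simp only: linear_sum)
      also have "(\<Sum>i<?n. h i x *s tangent_vector X (v i) x) = 0"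
        using relx by (simp add: vec_eq_iff tangent_vector_def)
      also have "p' 0 = 0" using p'(2)[of 0 0] by simp
      finally show ?thesis by (simp add: vf_scale_def sum_fun_apply)
    next
      case False
      then have "v i f x = 0" if "i < ?n" for i
        using D_out[OF v[OF that], of f] coord_ring_outside[OF D_closed[OF v[OF that], of f], of x]
        by fastforce
      then show ?thesis by (simp add: vf_scale_def sum_fun_apply)
    qed
    then have "(\<Sum>i<?n. vf_scale (h i) (v i)) = 0" by (simp add: fun_eq_iff)
    moreover have "\<forall>i<?n. h i \<in> coord_ring X" using h by blast
    ultimately show "\<forall>i\<in>{..<?n}. h i = 0" using contra by blast
  qed simp
  then obtain d where d: "d \<in> coord_ring X" "d \<noteq> 0"
    and indep: "\<And>x c. d x \<noteq> 0 \<Longrightarrow> \<forall>j. (\<Sum>i<?n. c i * ?w i j x) = 0 \<Longrightarrow> \<forall>i<?n. c i = 0"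
    by auto
  obtain x where x: "d x \<noteq> 0" using d(2) by (auto simp: fun_eq_iff)
  then have "x \<in> X" using coord_ring_outside[OF d(1)] by blast
  let ?t = "\<lambda>i. tangent_vector X (v i) x"
  have indep': "\<forall>i<?n. c i = 0" if "(\<Sum>i<?n. c i *s ?t i) = 0" for c
  proof (rule indep[OF x], rule allI)
    fix j
    have "(\<Sum>i<?n. c i *s ?t i) $ j = 0" unfolding that by simp
    then show "(\<Sum>i<?n. c i * ?w i j x) = 0"
      unfolding sum_component vector_smult_component tangent_vector_def by (simp only: vec_lambda_beta)
  qed
  \<comment> \<open>Independence in the library concerns sets of vectors, so the family must first
    be shown to have no repetitions.\<close>
  have inj: "inj_on ?t {..<?n}"
  proof (rule inj_onI, rule ccontr)
    fix i j assume ij: "i \<in> {..<?n}" "j \<in> {..<?n}" "?t i = ?t j" "i \<noteq> j"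
    let ?c = "\<lambda>l. if l = i then 1 else if l = j then -1 else (0::complex)"
    have "(\<Sum>l<?n. ?c l *s ?t l) = (\<Sum>l\<in>{i, j}. ?c l *s ?t l)"
      by (rule sum.mono_neutral_right) (use ij in auto)
    also have "\<dots> = 0" using ij(3,4) by (simp add: vector_smult_lneg)
    finally have "\<forall>l<?n. ?c l = 0" by (rule indep')
    then show False using ij(1) by (metis lessThan_iff zero_neq_one)
  qed
  have "vec.independent (?t ` {..<?n})"
  proof (subst vec.dependent_finite, simp, safe)
    fix u i assume u: "(\<Sum>v\<in>?t ` {..<?n}. u v *s v) = 0" "i < ?n" "u (?t i) \<noteq> 0"
    then have "(\<Sum>l<?n. u (?t l) *s ?t l) = 0"
      by (simp add: sum.reindex[OF inj])
    then show False using indep'[of "\<lambda>l. u (?t l)"] u by blast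
  qed
  then have "card (?t ` {..<?n}) \<le> vec.dim (zariski_tangent X x)"
    using tangent_vector_in_tangent_space[OF v \<open>x \<in> X\<close>]
    by (intro vec.independent_card_le_dim) auto
  also have "\<dots> = variety_dim X" using X \<open>x \<in> X\<close> by (simp add: smooth_affine_variety_def)
  finally show False by (simp add: card_image[OF inj])
qed

text \<open>On n+1 fields, a dependence with nonzero coefficient h_p gives h_p \<sigma> = 0, and h_p
  cancels because the ring is a domain.\<close>

lemma top_form_coord_ring:
  assumes X: "smooth_affine_variety X" and "\<omega> \<in> forms (coord_ring X) (variety_dim X)"
  shows "top_form (coord_ring X) \<omega> (variety_dim X)"
proof -
  have "affine_variety X" using X by (simp add: smooth_affine_variety_def)
  then interpret function_domain "coord_ring X" by (rule function_domain_coord_ring)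
  show ?thesis
  proof
    fix \<sigma> assume \<sigma>: "\<sigma> \<in> forms (coord_ring X) (Suc (variety_dim X))"
    show "\<sigma> = 0"
    proof (rule ext)
      fix vs
      show "\<sigma> vs = 0 vs"
      proof (cases "length vs = Suc (variety_dim X) \<and> set vs \<subseteq> D")
        case True
        then have "vs ! i \<in> D" if "i < Suc (variety_dim X)" for i using that by auto
        then obtain h p where h: "\<forall>i<Suc (variety_dim X). h i \<in> coord_ring X"
            "p < Suc (variety_dim X)" "h p \<noteq> 0" "(\<Sum>i<Suc (variety_dim X). vf_scale (h i) (vs ! i)) = 0"
          using vfields_dependent[OF X, of "\<lambda>i. vs ! i"] by blast
        then have "h p * \<sigma> vs = 0"
          using True by (intro dependent_form_zero[OF \<sigma>, of vs p h]) auto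
        then show ?thesis
          using no_zero_divisors[of "h p" "\<sigma> vs"] h form_closed[OF \<sigma>] by simp
      qed (simp add: form_out[OF \<sigma>])
    qed
  qed (rule assms(2))
qed

subsection \<open>Hilbert's Nullstellensatz\<close>

text \<open>Gives the name \<open>cfun.span\<close> to the complex linear span that occurs in
  \<open>semi_compatible\<close>.\<close>

interpretation cfun: vector_space "\<lambda>c (f :: 'a \<Rightarrow> complex) x. c * f x"
  by unfold_locales (auto simp: fun_eq_iff algebra_simps)

text \<open>Lists of coordinates with repetitions form a countable type, which supplies the
  enumeration of monomials used below.\<close>

definition monomial :: "'n::finite list \<Rightarrow> 'n rfun" where
  "monomial l = (\<lambda>x. \<Prod>i\<leftarrow>l. x $ i)"

lemma monomial_append: "monomial (k @ l) = (\<lambda>x. monomial k x * monomial l x)"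
  by (simp add: monomial_def)

lemma span_monomials_mult:
  assumes p: "p \<in> cfun.span (range monomial)" and q: "q \<in> cfun.span (range monomial)"
  shows "(\<lambda>x. p x * q x) \<in> cfun.span (range monomial)"
  using p
proof (induction p rule: cfun.span_induct)
  case base
  show ?case
  proof (rule cfun.subspaceI)
    show "0 \<in> {p. (\<lambda>x. p x * q x) \<in> cfun.span (range monomial)}"
      using cfun.span_zero by (simp add: zero_fun_def)
  next
    fix f g assume "f \<in> {p. (\<lambda>x. p x * q x) \<in> cfun.span (range monomial)}"
      "g \<in> {p. (\<lambda>x. p x * q x) \<in> cfun.span (range monomial)}"
    then show "f + g \<in> {p. (\<lambda>x. p x * q x) \<in> cfun.span (range monomial)}"
      using cfun.span_add[of "\<lambda>x. f x * q x" _ "\<lambda>x. g x * q x"]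
      by (simp add: plus_fun_def distrib_right)
  next
    fix c f assume "f \<in> {p. (\<lambda>x. p x * q x) \<in> cfun.span (range monomial)}"
    then show "(\<lambda>x. c * f x) \<in> {p. (\<lambda>x. p x * q x) \<in> cfun.span (range monomial)}"
      using cfun.span_scale[of "\<lambda>x. f x * q x" _ c] by (simp add: mult.assoc)
  qed
next
  case (step p)
  then obtain k where k: "p = monomial k" by blast
  show ?case using q
  proof (induction q rule: cfun.span_induct)
    case base
    show ?case
    proof (rule cfun.subspaceI)
      show "0 \<in> {q. (\<lambda>x. p x * q x) \<in> cfun.span (range monomial)}"
        using cfun.span_zero by (simp add: zero_fun_def)
    next
      fix f g assume "f \<in> {q. (\<lambda>x. p x * q x) \<in> cfun.span (range monomial)}"
        "g \<in> {q. (\<lambda>x. p x * q x) \<in> cfun.span (range monomial)}"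
      then show "f + g \<in> {q. (\<lambda>x. p x * q x) \<in> cfun.span (range monomial)}"
        using cfun.span_add[of "\<lambda>x. p x * f x" _ "\<lambda>x. p x * g x"]
        by (simp add: plus_fun_def distrib_left)
    next
      fix c f assume "f \<in> {q. (\<lambda>x. p x * q x) \<in> cfun.span (range monomial)}"
      then show "(\<lambda>x. c * f x) \<in> {q. (\<lambda>x. p x * q x) \<in> cfun.span (range monomial)}"
        using cfun.span_scale[of "\<lambda>x. p x * f x" _ c] by (simp add: mult.left_commute)
    qed
  next
    case (step q)
    then show ?case unfolding k by (auto simp: monomial_append[symmetric] intro: cfun.span_base)
  qed
qed

lemma poly_funs_span_monomials: "p \<in> poly_funs \<Longrightarrow> p \<in> cfun.span (range monomial)"
proof (induction rule: poly_funs.induct)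
  case (const c)
  have "(\<lambda>x. c * monomial [] x) \<in> cfun.span (range monomial)"
    by (intro cfun.span_scale cfun.span_base) simp
  then show ?case by (simp add: monomial_def)
next
  case (coord i)
  have "monomial [i] \<in> cfun.span (range monomial)" by (intro cfun.span_base) simp
  then show ?case by (simp add: monomial_def)
next
  case (add p q)
  then show ?case using cfun.span_add[of p _ q] by (simp add: plus_fun_def)
qed (rule span_monomials_mult)

text \<open>Stated with finite initial segments so that infinitely many members of an uncountable
  family can be placed in one finite-dimensional span.\<close>

lemma coord_ring_countable_dimension:
  fixes B :: "(complex^'n::finite) set"
  obtains t :: "nat \<Rightarrow> 'n rfun" where "\<And>f. f \<in> coord_ring B \<Longrightarrow> \<exists>k. f \<in> cfun.span (t ` {..<k})"
proof
  let ?t = "\<lambda>k. zero_outside B (monomial (from_nat k))"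
  fix f :: "'n rfun" assume "f \<in> coord_ring B"
  then obtain p where p: "p \<in> poly_funs" "f = zero_outside B p" by (rule coord_ringE)
  obtain T r where T: "finite T" "T \<subseteq> range monomial" "p = (\<Sum>a\<in>T. (\<lambda>x. r a * a x))"
    using poly_funs_span_monomials[OF p(1)] unfolding cfun.span_explicit by blast
  obtain L where L: "finite L" "T = monomial ` L"
    using T(1,2) finite_subset_image by metis
  define k where "k = Suc (Max (insert 0 (to_nat ` L)))"
  have lt: "to_nat l < k" if "l \<in> L" for l
    unfolding k_def using that L(1) by (simp add: less_Suc_eq_le)
  have "f = (\<Sum>a\<in>T. (\<lambda>x. r a * zero_outside B a x))"
    by (rule ext) (simp add: p(2) T(3) zero_outside_def sum_fun_apply)
  also have "\<dots> \<in> cfun.span (?t ` {..<k})"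
  proof (intro cfun.span_sum cfun.span_scale cfun.span_base)
    fix a assume "a \<in> T"
    then obtain l where l: "l \<in> L" "a = monomial l" using L by blast
    then have "zero_outside B a = ?t (to_nat l)" by simp
    then show "zero_outside B a \<in> ?t ` {..<k}" using lt[OF l(1)] by blast
  qed
  finally show "\<exists>k. f \<in> cfun.span (?t ` {..<k})" by blast
qed

locale coord_maximal_ideal =
  fixes B :: "(complex^'n::finite) set" and m
  assumes ideal: "is_ideal (coord_ring B) m"
    and proper: "one_on B \<notin> m"
    and maximal: "\<And>J. is_ideal (coord_ring B) J \<Longrightarrow> one_on B \<notin> J \<Longrightarrow> m \<subseteq> J \<Longrightarrow> J = m"
begin

sublocale function_algebra "coord_ring B" by (rule function_algebra_coord_ring)

lemma m_A: "f \<in> m \<Longrightarrow> f \<in> coord_ring B"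
  and m_zero: "0 \<in> m"
  and m_add: "f \<in> m \<Longrightarrow> g \<in> m \<Longrightarrow> f + g \<in> m"
  and m_mult: "f \<in> coord_ring B \<Longrightarrow> g \<in> m \<Longrightarrow> f * g \<in> m"
  using ideal unfolding is_ideal_def by blast+

lemma m_scale: "f \<in> m \<Longrightarrow> (\<lambda>x. c * f x) \<in> m"
proof -
  assume f: "f \<in> m"
  have "zero_outside B (\<lambda>_. c) * f = (\<lambda>x. c * f x)"
    using coord_ring_outside[OF m_A[OF f]] by (fastforce simp: zero_outside_def fun_eq_iff)
  then show ?thesis using m_mult[OF coord_ringI[OF poly_funs.const] f, of c] by metis
qed

lemma m_diff: "f \<in> m \<Longrightarrow> g \<in> m \<Longrightarrow> f - g \<in> m"
  using m_add[OF _ m_scale[of g "-1"], of f] by (simp add: fun_diff_def plus_fun_def)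

lemma m_sum: "(\<And>i. i \<in> I \<Longrightarrow> f i \<in> m) \<Longrightarrow> sum f I \<in> m"
  by (induction I rule: infinite_finite_induct) (auto intro: m_zero m_add)

lemma const_notin_m: "c \<noteq> 0 \<Longrightarrow> zero_outside B (\<lambda>_. c) \<notin> m"
  using m_scale[of "zero_outside B (\<lambda>_. c)" "inverse c"] proper by (auto simp: zero_outside_simps)

text \<open>The ideal m + f A is strictly larger than \<open>m\<close>, hence contains the
  unit.\<close>

lemma invertible_mod:
  assumes "f \<in> coord_ring B" "f \<notin> m"
  shows "\<exists>g\<in>coord_ring B. f * g - one_on B \<in> m"
proof -
  let ?J = "{a + f * g | a g. a \<in> m \<and> g \<in> coord_ring B}"
  have J: "is_ideal (coord_ring B) ?J"
    unfolding is_ideal_def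
  proof (intro conjI ballI)
    show "?J \<subseteq> coord_ring B" using assms(1) m_A by auto
    have "0 = 0 + f * 0" by simp
    then show "0 \<in> ?J" using m_zero A_zero by blast
  next
    fix x y assume "x \<in> ?J" "y \<in> ?J"
    then obtain a g b h where "a \<in> m" "g \<in> coord_ring B" "b \<in> m" "h \<in> coord_ring B"
      "x = a + f * g" "y = b + f * h" by blast
    moreover from this have "x + y = (a + b) + f * (g + h)" by (simp only: algebra_simps)
    ultimately show "x + y \<in> ?J" using m_add A_add by blast
  next
    fix r x assume r: "r \<in> coord_ring B" and "x \<in> ?J"
    then obtain a g where "a \<in> m" "g \<in> coord_ring B" "x = a + f * g" by blast
    moreover from this have "r * x = r * a + f * (r * g)" by (simp only: algebra_simps)
    ultimately show "r * x \<in> ?J" using m_mult A_mult r by blast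
  qed
  have "m \<subseteq> ?J"
  proof
    fix a assume "a \<in> m"
    moreover have "a = a + f * 0" by simp
    ultimately show "a \<in> ?J" using A_zero by blast
  qed
  moreover have "f \<in> ?J"
  proof -
    have "f = 0 + f * one_on B" using one_on_mult[OF assms(1)] by (simp add: mult.commute)
    then show ?thesis using m_zero one_on_coord_ring by blast
  qed
  ultimately have "one_on B \<in> ?J" using maximal[OF J] assms(2) by blast
  then obtain a g where ag: "a \<in> m" "g \<in> coord_ring B" "one_on B = a + f * g" by blast
  then have "f * g - one_on B = 0 - a" by simp
  then show ?thesis using ag m_diff[OF m_zero] by metis
qed

lemma prime:
  assumes "f \<in> coord_ring B" "g \<in> coord_ring B" "f * g \<in> m" "f \<notin> m"
  shows "g \<in> m"
proof -
  obtain h where h: "h \<in> coord_ring B" "f * h - one_on B \<in> m"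
    using invertible_mod assms by blast
  have "h * (f * g) - g * (f * h - one_on B) = g"
    using one_on_mult[OF assms(2)] by (simp add: algebra_simps)
  then show ?thesis using m_diff[OF m_mult[OF h(1) assms(3)] m_mult[OF assms(2) h(2)]] by metis
qed

text \<open>The ring homomorphism from polynomials in one variable that sends the variable to the
  j-th coordinate; it makes factorization over the complex numbers available.\<close>

definition coord_poly :: "'n \<Rightarrow> complex poly \<Rightarrow> 'n rfun" where
  "coord_poly j r = zero_outside B (\<lambda>x. poly r (x $ j))"

lemma coord_poly_simps:
  "coord_poly j (r + s) = coord_poly j r + coord_poly j s"
  "coord_poly j (r * s) = coord_poly j r * coord_poly j s"
  "coord_poly j (smult c r) = (\<lambda>x. c * coord_poly j r x)"
  "coord_poly j 1 = one_on B"
  "coord_poly j 0 = 0"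
  "coord_poly j [:c:] = zero_outside B (\<lambda>_. c)"
  by (auto simp: coord_poly_def zero_outside_def fun_eq_iff)

lemma coord_poly_sum: "coord_poly j (sum r I) = (\<Sum>i\<in>I. coord_poly j (r i))"
  by (induction I rule: infinite_finite_induct) (auto simp: coord_poly_simps)

lemma coord_poly_in_A: "coord_poly j r \<in> coord_ring B"
proof (induction r)
  case 0
  show ?case unfolding coord_poly_simps by (rule A_zero)
next
  case (pCons a r)
  have "zero_outside B (\<lambda>_. a) + zero_outside B (\<lambda>x. x $ j) * coord_poly j r \<in> coord_ring B"
    by (intro A_add A_mult pCons.IH coord_ringI poly_funs.const poly_funs.coord)
  moreover have "zero_outside B (\<lambda>_. a) + zero_outside B (\<lambda>x. x $ j) * coord_poly j r = coord_poly j (pCons a r)"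
    by (auto simp: coord_poly_def zero_outside_def fun_eq_iff)
  ultimately show ?case by metis
qed

text \<open>Over the complex numbers \<open>r\<close> splits into linear factors, and
  \<open>m\<close> is prime and contains no nonzero constant.\<close>

lemma coord_poly_notin_m:
  assumes "\<And>c. coord_poly j [:- c, 1:] \<notin> m" "r \<noteq> 0"
  shows "coord_poly j r \<notin> m"
  using assms(2)
proof (induction "degree r" arbitrary: r)
  case 0
  then obtain c where c: "r = [:c:]" by (metis degree_eq_zeroE)
  then show ?case using 0 const_notin_m[of c] by (simp add: coord_poly_simps)
next
  case (Suc d)
  then have "\<not> constant (poly r)" by (metis constant_degree nat.distinct(1))
  then obtain a where "poly r a = 0" using fundamental_theorem_of_algebra by blast
  then obtain s where s: "r = [:- a, 1:] * s" by (metis poly_eq_0_iff_dvd dvdE)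
  then have "s \<noteq> 0" using Suc.prems by auto
  moreover from this have "degree r = 1 + degree s" unfolding s by (subst degree_mult_eq) auto
  ultimately have "coord_poly j s \<notin> m" using Suc by simp
  then show ?case
    using prime[OF coord_poly_in_A coord_poly_in_A, of j "[:- a, 1:]" j s] assms(1)
    unfolding s coord_poly_simps(2) by blast
qed

text \<open>If \<open>x $ j - c\<close> were invertible modulo \<open>m\<close> for every \<open>c\<close>, then uncountably many inverses would
  lie in a space of countable dimension; clearing denominators in a linear relation between them
  gives a nonzero polynomial in \<open>x $ j\<close> that lies in \<open>m\<close>.\<close>
lemma coord_value: "\<exists>c. coord_poly j [:- c, 1:] \<in> m"
proof (rule ccontr)
  assume "\<not> ?thesis"
  then have nm: "coord_poly j [:- c, 1:] \<notin> m" for c by blast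
  let ?T = "\<lambda>c. coord_poly j [:- c, 1:]"
  obtain q where q: "\<And>c. q c \<in> coord_ring B" "\<And>c. ?T c * q c - one_on B \<in> m"
    using invertible_mod[OF coord_poly_in_A nm] by metis
  \<comment> \<open>If two inverses agreed, subtracting their defining congruences would put a
    nonzero multiple of \<open>q c\<close>, and hence \<open>q c\<close> itself, into
    \<open>m\<close>.\<close>
  have inj: "inj q"
  proof (rule injI, rule ccontr)
    fix c c' assume "q c = q c'" "c \<noteq> c'"
    have eq: "?T c' * q c - one_on B - (?T c * q c - one_on B) = (\<lambda>x. (c - c') * q c x)"
      using coord_ring_outside[OF q(1)[of c]]
      by (auto simp: fun_eq_iff coord_poly_def zero_outside_def algebra_simps)
    have "(\<lambda>x. (c - c') * q c x) \<in> m"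
      using m_diff[OF q(2)[of c'] q(2)[of c]] unfolding \<open>q c = q c'\<close>[symmetric] eq .
    then have "(\<lambda>x. inverse (c - c') * ((c - c') * q c x)) \<in> m" by (rule m_scale)
    then have "q c \<in> m" using \<open>c \<noteq> c'\<close> by simp
    then have "?T c * q c \<in> m" using m_mult coord_poly_in_A by blast
    from m_diff[OF this q(2)[of c]] show False using proper by simp
  qed
  obtain t where t: "\<And>f. f \<in> coord_ring B \<Longrightarrow> \<exists>k. f \<in> cfun.span (t ` {..<k::nat})"
    using coord_ring_countable_dimension by blast
  obtain k where k: "\<And>c. q c \<in> cfun.span (t ` {..<k c})" using t[OF q(1)] by metis
  \<comment> \<open>Uncountably many c are distributed over countably many values of
    \<open>k\<close>.\<close>
  have "\<exists>K. infinite {c. k c = K}"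
  proof (rule ccontr)
    assume "\<not> ?thesis"
    then have "countable (\<Union>K. {c. k c = K})" by (intro countable_UN) (auto intro: countable_finite)
    moreover have "(\<Union>K. {c. k c = K}) = (UNIV :: complex set)" by auto
    ultimately show False using uncountable_UNIV_complex by simp
  qed
  then obtain K where K: "infinite {c. k c = K}" by blast
  have "infinite (q ` {c. k c = K})" using K inj finite_imageD inj_on_subset by blast
  moreover have "q ` {c. k c = K} \<subseteq> cfun.span (t ` {..<K})" using k by blast
  ultimately have "cfun.dependent (q ` {c. k c = K})"
    using cfun.independent_span_bound[of "t ` {..<K}" "q ` {c. k c = K}"] by blast
  then obtain S r where S: "finite S" "S \<subseteq> q ` {c. k c = K}" "(\<Sum>v\<in>S. (\<lambda>x. r v * v x)) = 0" "\<exists>v\<in>S. r v \<noteq> 0"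
    unfolding cfun.dependent_explicit by blast
  obtain C where C: "finite C" "S = q ` C" using S(1,2) finite_subset_image by metis
  define l where "l c = r (q c)" for c
  have rel: "(\<Sum>c\<in>C. (\<lambda>x. l c * q c x)) = 0"
    using S(3) unfolding C(2) sum.reindex[OF inj_on_subset[OF inj subset_UNIV]] l_def by simp
  obtain c0 where c0: "c0 \<in> C" "l c0 \<noteq> 0" using S(4) unfolding C(2) l_def by blast
  \<comment> \<open>\<open>P\<close> is the numerator of the sum of the fractions l_c / (t - c) over
    the common denominator \<open>W\<close>. At c0 only the summand of c0 survives, so
    \<open>P\<close> is nonzero.\<close>
  define R where "R c = (\<Prod>c'\<in>C - {c}. [:- c', 1:])" for c
  define P where "P = (\<Sum>c\<in>C. smult (l c) (R c))"
  have "poly P c0 = (\<Sum>c\<in>C. if c = c0 then l c0 * poly (R c0) c0 else 0)"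
    unfolding P_def poly_sum poly_smult
  proof (intro sum.cong refl)
    fix c assume "c \<in> C"
    have "poly (R c) c0 = 0" if "c \<noteq> c0"
      using that c0(1) C(1) by (auto simp: R_def poly_prod)
    then show "l c * poly (R c) c0 = (if c = c0 then l c0 * poly (R c0) c0 else 0)" by simp
  qed
  also have "\<dots> = l c0 * poly (R c0) c0" using C(1) c0(1) by simp
  also have "\<dots> \<noteq> 0" using c0 C(1) by (simp add: R_def poly_prod)
  finally have "P \<noteq> 0" by auto
  then have notin: "coord_poly j P \<notin> m" by (rule coord_poly_notin_m[OF nm])
  define W where "W = (\<Prod>c\<in>C. [:- c, 1:])"
  have W: "coord_poly j (R c) * ?T c = coord_poly j W" if "c \<in> C" for c
    unfolding coord_poly_simps(2)[symmetric] R_def W_def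
    using that C(1) by (simp add: prod.remove[of C c] mult.commute)
  \<comment> \<open>Each summand equals l_c (W q_c - R_c). The parts with \<open>W\<close> cancel by
    the linear relation, which leaves -P in \<open>m\<close>.\<close>
  have "(\<Sum>c\<in>C. (\<lambda>x. l c * (coord_poly j (R c) * (?T c * q c - one_on B)) x)) \<in> m"
    by (intro m_sum m_scale m_mult coord_poly_in_A q(2))
  also have "(\<Sum>c\<in>C. (\<lambda>x. l c * (coord_poly j (R c) * (?T c * q c - one_on B)) x)) = - coord_poly j P"
  proof (rule ext)
    fix x
    have one: "one_on B x * coord_poly j r x = coord_poly j r x" for r
      by (simp add: zero_outside_def coord_poly_def)
    have "(\<Sum>c\<in>C. l c * q c x) = 0"
      using fun_cong[OF rel, of x] by (simp add: sum_fun_apply)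
    then have "(\<Sum>c\<in>C. l c * (coord_poly j W x * q c x)) = 0"
      by (simp add: sum_distrib_left[symmetric] mult.left_commute[of _ "coord_poly j W x"])
    moreover have "l c * (coord_poly j (R c) * (?T c * q c - one_on B)) x
      = l c * (coord_poly j W x * q c x) - l c * coord_poly j (R c) x" if "c \<in> C" for c
      using fun_cong[OF W[OF that], of x] one[of "R c"] by (simp add: algebra_simps)
    ultimately show "(\<Sum>c\<in>C. (\<lambda>x. l c * (coord_poly j (R c) * (?T c * q c - one_on B)) x)) x = (- coord_poly j P) x"
      by (simp add: sum_fun_apply P_def coord_poly_sum coord_poly_simps sum_subtractf sum_negf)
  qed
  finally have "- coord_poly j P \<in> m" .
  from m_scale[OF this, of "-1"] show False using notin by simp
qed

text \<open>Every coordinate is congruent to a constant b_j modulo \<open>m\<close>, so every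
  polynomial is congruent to its value at b. Since \<open>m\<close> contains no nonzero constant,
  members of \<open>m\<close> vanish at b, and so do the equations of \<open>B\<close>, which
  represent 0.\<close>

lemma common_zero:
  assumes "zclosed B"
  shows "\<exists>b\<in>B. \<forall>f\<in>m. f b = 0"
proof -
  obtain b where b: "\<And>j. coord_poly j [:- b j, 1:] \<in> m" using coord_value by metis
  let ?b = "\<chi> j. b j"
  have val: "zero_outside B (\<lambda>x. p x - p ?b) \<in> m" if "p \<in> poly_funs" for p
    using that
  proof induction
    case (const c)
    then show ?case using m_zero by (simp add: zero_outside_def zero_fun_def)
  next
    case (coord i)
    then show ?case using b[of i] by (simp add: coord_poly_def)
  next
    case (add p q)
    have "zero_outside B (\<lambda>x. p x - p ?b) + zero_outside B (\<lambda>x. q x - q ?b)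
      = zero_outside B (\<lambda>x. p x + q x - (p ?b + q ?b))"
      by (auto simp: zero_outside_def fun_eq_iff)
    then show ?case using m_add[OF add.IH] by simp
  next
    case (mult p q)
    have "zero_outside B p * zero_outside B (\<lambda>x. q x - q ?b) + (\<lambda>x. q ?b * zero_outside B (\<lambda>x. p x - p ?b) x)
      = zero_outside B (\<lambda>x. p x * q x - (p ?b * q ?b))"
      by (auto simp: zero_outside_def fun_eq_iff algebra_simps)
    then show ?case
      using m_add[OF m_mult[OF coord_ringI[OF mult.hyps(1)] mult.IH(2)] m_scale[OF mult.IH(1)], of "q ?b"]
      by simp
  qed
  have van: "p ?b = 0" if "p \<in> poly_funs" "zero_outside B p \<in> m" for p
  proof (rule ccontr)
    assume "p ?b \<noteq> 0"
    moreover have "zero_outside B p - zero_outside B (\<lambda>x. p x - p ?b) = zero_outside B (\<lambda>_. p ?b)"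
      by (auto simp: zero_outside_def fun_eq_iff)
    ultimately show False using m_diff[OF that(2) val[OF that(1)]] const_notin_m by simp
  qed
  obtain P where P: "P \<subseteq> poly_funs" "B = {x. \<forall>p\<in>P. p x = 0}"
    using assms unfolding zclosed_def by blast
  have "p ?b = 0" if "p \<in> P" for p
  proof (rule van)
    have "zero_outside B p = 0" using that P(2) by (auto simp: zero_outside_def fun_eq_iff)
    then show "zero_outside B p \<in> m" using m_zero by simp
  qed (use that P in blast)
  then have "?b \<in> B" using P(2) by blast
  moreover have "f ?b = 0" if f: "f \<in> m" for f
  proof -
    obtain p where p: "p \<in> poly_funs" "f = zero_outside B p" using m_A[OF f] by (rule coord_ringE)
    then show ?thesis using van[OF p(1)] f by (simp add: zero_outside_def)
  qed
  ultimately show ?thesis by blast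
qed

end

text \<open>By Zorn's lemma an ideal without the unit lies in a maximal one, and that one has a
  common zero in \<open>B\<close>.\<close>

theorem nullstellensatz:
  assumes B: "zclosed B" and Q: "is_ideal (coord_ring B) Q"
    and no_zero: "\<And>b. b \<in> B \<Longrightarrow> \<exists>f\<in>Q. f b \<noteq> 0"
  shows "one_on B \<in> Q"
proof (rule ccontr)
  assume notin: "one_on B \<notin> Q"
  let ?S = "{J. is_ideal (coord_ring B) J \<and> Q \<subseteq> J \<and> one_on B \<notin> J}"
  have "\<exists>M\<in>?S. \<forall>J\<in>?S. M \<subseteq> J \<longrightarrow> J = M"
  proof (rule subset_Zorn_nonempty)
    show "?S \<noteq> {}" using Q notin by blast
  next
    fix \<C> assume ne: "\<C> \<noteq> {}" and ch: "subset.chain ?S \<C>"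
    then have mem: "is_ideal (coord_ring B) J" "Q \<subseteq> J" "one_on B \<notin> J" if "J \<in> \<C>" for J
      using that unfolding subset.chain_def by blast+
    have "f + g \<in> \<Union>\<C>" if fg: "f \<in> \<Union>\<C>" "g \<in> \<Union>\<C>" for f g
    proof -
      obtain J K where JK: "J \<in> \<C>" "K \<in> \<C>" "f \<in> J" "g \<in> K" using fg by blast
      then have "J \<subseteq> K \<or> K \<subseteq> J" using ch unfolding subset.chain_def by blast
      then obtain L where "L \<in> \<C>" "f \<in> L" "g \<in> L" using JK by blast
      then show ?thesis using mem(1) unfolding is_ideal_def by blast
    qed
    then have "is_ideal (coord_ring B) (\<Union>\<C>)"
      using ne mem(1) unfolding is_ideal_def by blast
    then show "\<Union>\<C> \<in> ?S" using ne mem by blast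
  qed
  then obtain M where "M \<in> ?S" and max: "\<forall>J\<in>?S. M \<subseteq> J \<longrightarrow> J = M"
    by (elim bexE)
  then have M: "is_ideal (coord_ring B) M" "Q \<subseteq> M" "one_on B \<notin> M" by simp_all
  interpret coord_maximal_ideal B M
  proof
    fix J assume J: "is_ideal (coord_ring B) J" "one_on B \<notin> J" "M \<subseteq> J"
    then have "J \<in> ?S" using M(2) by simp
    then show "J = M" using max J(3) by simp
  qed (rule M(1), rule M(3))
  show False using common_zero[OF B] no_zero M(2) by blast
qed

subsection \<open>Complete vector fields\<close>

text \<open>The function \<open>f\<close> is constant along the orbits of \<open>\<xi>\<close>, so
  the flow of f \<xi> is that of \<open>\<xi>\<close> with time multiplied by f(x).\<close>

lemma complete_vf_scale:
  assumes \<xi>: "\<xi> \<in> vfields (coord_ring X)" "complete_vf X (coord_ring X) \<xi>"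
    and f: "f \<in> ker (coord_ring X) \<xi>"
  shows "complete_vf X (coord_ring X) (vf_scale f \<xi>)"
proof -
  have fA: "f \<in> coord_ring X" and f0: "\<xi> f = 0" using f by (auto simp: ker_def)
  obtain p where p: "p \<in> poly_funs" "f = zero_outside X p" using fA by (rule coord_ringE)
  have fp: "f x = p x" if "x \<in> X" for x using that p(2) by (simp add: zero_outside_def)
  obtain \<Phi> where flow: "holomorphic_flow X \<Phi>"
    and \<Phi>: "\<And>t x. x \<in> X \<Longrightarrow> \<Phi> (t, x) \<in> X" "\<And>x. x \<in> X \<Longrightarrow> \<Phi> (0, x) = x"
      "\<And>s t x. x \<in> X \<Longrightarrow> \<Phi> (s + t, x) = \<Phi> (s, \<Phi> (t, x))"
    and deriv: "\<And>h x. h \<in> coord_ring X \<Longrightarrow> x \<in> X \<Longrightarrow>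
      ((\<lambda>t. h (\<Phi> (t, x))) has_field_derivative \<xi> h x) (at 0)"
    using \<xi>(2) unfolding complete_vf_def holomorphic_action_def by blast
  have const: "f (\<Phi> (s, x)) = f x" if x: "x \<in> X" for s x
  proof -
    \<comment> \<open>The group law carries the derivative at time 0 to every time
      \<open>s0\<close>.\<close>
    have "((\<lambda>t. f (\<Phi> (t, x))) has_field_derivative 0) (at s0)" for s0
    proof -
      have "((\<lambda>t. f (\<Phi> (t, \<Phi> (s0, x)))) has_field_derivative 0) (at 0)"
        using deriv[OF fA \<Phi>(1)[OF x], of s0] by (simp add: f0)
      then have "((\<lambda>t. f (\<Phi> (t + s0, x))) has_field_derivative 0) (at 0)"
        by (simp add: \<Phi>(3)[OF x])
      then show ?thesis
        using DERIV_shift[of "\<lambda>t. f (\<Phi> (t, x))" 0 0 s0] by simp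
    qed
    then obtain c where "\<forall>s\<in>UNIV. f (\<Phi> (s, x)) = c"
      using has_field_derivative_zero_constant[of UNIV "\<lambda>t. f (\<Phi> (t, x))"] by auto
    then have "f (\<Phi> (s, x)) = f (\<Phi> (0, x))" by simp
    then show ?thesis using \<Phi>(2)[OF x] by simp
  qed
  \<comment> \<open>The polynomial \<open>p\<close> replaces \<open>f\<close>, whose extension by 0
    is in general not holomorphic near X.\<close>
  let ?g = "\<lambda>w. (fst w * p (snd w), snd w)"
  let ?\<Psi> = "\<lambda>w. \<Phi> (?g w)"
  have g': "\<exists>g'. (?g has_derivative g') (at w) \<and> (\<forall>z w. g' (z + w) = g' z + g' w) \<and>
    (\<forall>c u v. g' (c * u, c *s v) = (c * fst (g' (u, v)), c *s snd (g' (u, v))))" for w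
  proof -
    obtain p' where p': "(p has_derivative p') (at (snd w))" "\<And>c v. p' (c *s v) = c * p' v"
      using poly_derivative[OF p(1) UNIV_I[of "snd w"]] by metis
    have psnd: "((\<lambda>w. p (snd w)) has_derivative (\<lambda>h. p' (snd h))) (at w)"
      by (rule has_derivative_compose[OF has_derivative_snd[OF has_derivative_ident] p'(1)])
    let ?g' = "\<lambda>h. (fst w * p' (snd h) + fst h * p (snd w), snd h)"
    have g': "(?g has_derivative ?g') (at w)"
      by (intro has_derivative_Pair has_derivative_mult psnd
          has_derivative_fst[OF has_derivative_ident] has_derivative_snd[OF has_derivative_ident])
    have add: "?g' (z + w') = ?g' z + ?g' w'" for z w'
      using linear_add[OF has_derivative_linear[OF g']] by metis
    show ?thesis
    proof (intro exI[of _ ?g'] conjI g' allI)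
      show "?g' (z + w') = ?g' z + ?g' w'" for z w' by (rule add)
    qed (simp add: p'(2) algebra_simps)
  qed
  have "holomorphic_flow X ?\<Psi>"
    unfolding holomorphic_flow_def
  proof
    fix z :: "complex \<times> (complex ^ 'a)" assume z: "z \<in> UNIV \<times> X"
    then have "?g z \<in> UNIV \<times> X" by auto
    then obtain U F where U: "open U" "?g z \<in> U"
      and F: "\<forall>w\<in>U. \<exists>L. complex_linear L \<and> (F has_derivative L) (at w)"
        "\<forall>w\<in>U \<inter> UNIV \<times> X. F w = \<Phi> w"
      using flow unfolding holomorphic_flow_def by blast
    have "continuous (at w) ?g" for w
      using g'[of w] has_derivative_continuous by blast
    then have "open (?g -` U)"
      using U(1) by (simp add: continuous_on_eq_continuous_at continuous_open_vimage)
    moreover have "\<exists>L. complex_linear L \<and> ((\<lambda>w. F (?g w)) has_derivative L) (at w)" if w: "w \<in> ?g -` U" for w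
    proof -
      obtain L where L: "complex_linear L" "(F has_derivative L) (at (?g w))" using F(1) w by auto
      obtain g1 where g1: "(?g has_derivative g1) (at w)" "\<forall>z w. g1 (z + w) = g1 z + g1 w"
        "\<forall>c u v. g1 (c * u, c *s v) = (c * fst (g1 (u, v)), c *s snd (g1 (u, v)))"
        using g' by blast
      have "((\<lambda>w. F (?g w)) has_derivative (\<lambda>h. L (g1 h))) (at w)"
        using has_derivative_compose[OF g1(1) L(2)] .
      moreover have "complex_linear (\<lambda>h. L (g1 h))"
      proof -
        have 1: "L (z + w) = L z + L w" and 2: "L (c * u, c *s v) = c *s L (u, v)" for z w c u v
          using L(1) unfolding complex_linear_def by blast+
        have "L (c * fst h, c *s snd h) = c *s L h" for c h
          using 2[of c "fst h" "snd h"] by simp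
        then show ?thesis
          unfolding complex_linear_def g1(2)[rule_format] g1(3)[rule_format] 1 by blast
      qed
      ultimately show ?thesis by blast
    qed
    moreover have "F (?g w) = ?\<Psi> w" if "w \<in> ?g -` U \<inter> UNIV \<times> X" for w
      using F(2) that by auto
    ultimately show "\<exists>U F. open U \<and> z \<in> U \<and> (\<forall>w\<in>U. \<exists>L. complex_linear L \<and> (F has_derivative L) (at w)) \<and>
      (\<forall>w\<in>U \<inter> UNIV \<times> X. F w = ?\<Psi> w)"
      using U(2) by (intro exI[of _ "?g -` U"] exI[of _ "\<lambda>w. F (?g w)"]) auto
  qed
  moreover have "?\<Psi> (s + t, x) = ?\<Psi> (s, ?\<Psi> (t, x))" if x: "x \<in> X" for s t x
  proof -
    \<comment> \<open>The second flow uses the time factor at the moved point, which is still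
      \<open>p x\<close>; hence the times add up.\<close>
    have "p (\<Phi> (t * p x, x)) = p x"
      using const[OF x] fp[OF x] fp[OF \<Phi>(1)[OF x]] by simp
    then show ?thesis by (simp add: distrib_right \<Phi>(3)[OF x])
  qed
  ultimately have action: "holomorphic_action X ?\<Psi>"
    unfolding holomorphic_action_def using \<Phi>(1,2) by simp
  have "((\<lambda>t. h (?\<Psi> (t, x))) has_field_derivative vf_scale f \<xi> h x) (at 0)"
    if h: "h \<in> coord_ring X" and x: "x \<in> X" for h x
  proof -
    have "((\<lambda>t. t * p x) has_field_derivative p x) (at 0)"
      by (auto intro!: derivative_eq_intros)
    moreover have "((\<lambda>t. h (\<Phi> (t, x))) has_field_derivative \<xi> h x) (at (0 * p x))"
      using deriv[OF h x] by simp
    ultimately have "((\<lambda>t. h (\<Phi> (t * p x, x))) has_field_derivative \<xi> h x * p x) (at 0)"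
      by (intro DERIV_chain2[of "\<lambda>t. h (\<Phi> (t, x))"])
    then show ?thesis using fp[OF x] by (simp add: vf_scale_def mult.commute)
  qed
  then show ?thesis unfolding complete_vf_def using action by blast
qed

subsection \<open>Submodules of vector fields\<close>

lemma vf_scale_simps:
  "vf_scale h (\<xi> + \<eta>) = vf_scale h \<xi> + vf_scale h \<eta>"
  "vf_scale (h + g) \<xi> = vf_scale h \<xi> + vf_scale g \<xi>"
  "vf_scale h (vf_scale g \<xi>) = vf_scale (h * g) \<xi>"
  "vf_scale 0 \<xi> = 0"
  "vf_scale h 0 = 0"
  by (simp_all add: vf_scale_def fun_eq_iff algebra_simps)

lemma vf_scale_sum: "vf_scale h (\<Sum>i\<in>I. \<xi> i) = (\<Sum>i\<in>I. vf_scale h (\<xi> i))"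
  by (induction I rule: infinite_finite_induct) (simp_all only: sum.infinite sum.empty sum.insert vf_scale_simps not_False_eq_True)

context function_domain
begin

lemma unit_scale: "\<forall>f\<in>A. e * f = f \<Longrightarrow> \<xi> \<in> D \<Longrightarrow> vf_scale e \<xi> = \<xi>"
  unfolding vf_scale_def using D_closed by blast

lemma A_prod_mult: "finite I \<Longrightarrow> f \<in> A \<Longrightarrow> (\<And>i. i \<in> I \<Longrightarrow> g i \<in> A) \<Longrightarrow> f * prod g I \<in> A"
proof (induction I rule: finite_induct)
  case (insert i I)
  have "f * prod g I \<in> A" by (rule insert.IH[OF insert.prems(1)]) (rule insert.prems(2), simp)
  then have "g i * (f * prod g I) \<in> A" by (rule A_mult[OF insert.prems(2)[OF insertI1]])
  moreover have "f * prod g (insert i I) = g i * (f * prod g I)"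
    using insert.hyps by (simp add: mult.left_commute)
  ultimately show ?case by metis
qed simp

lemma generated_subset: "(\<And>i. i \<in> I \<Longrightarrow> \<xi> i \<in> D) \<Longrightarrow> \<nu> \<in> vf_module_generated A I \<xi> \<Longrightarrow> \<nu> \<in> D"
  unfolding vf_module_generated_def by (auto intro!: sum_in_D)

lemma generated_add:
  assumes "\<mu> \<in> vf_module_generated A I \<xi>" "\<nu> \<in> vf_module_generated A I \<xi>"
  shows "\<mu> + \<nu> \<in> vf_module_generated A I \<xi>"
proof -
  obtain g h where gh: "\<mu> = (\<Sum>i\<in>I. vf_scale (g i) (\<xi> i))" "\<forall>i\<in>I. g i \<in> A"
    "\<nu> = (\<Sum>i\<in>I. vf_scale (h i) (\<xi> i))" "\<forall>i\<in>I. h i \<in> A"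
    using assms unfolding vf_module_generated_def by blast
  have "\<mu> + \<nu> = (\<Sum>i\<in>I. vf_scale (g i + h i) (\<xi> i))"
    by (simp only: gh vf_scale_simps(2) sum.distrib)
  then show ?thesis unfolding vf_module_generated_def using gh(2,4) A_add by fast
qed

lemma generated_scale:
  assumes "f \<in> A" "\<nu> \<in> vf_module_generated A I \<xi>"
  shows "vf_scale f \<nu> \<in> vf_module_generated A I \<xi>"
proof -
  obtain h where h: "\<nu> = (\<Sum>i\<in>I. vf_scale (h i) (\<xi> i))" "\<forall>i\<in>I. h i \<in> A"
    using assms unfolding vf_module_generated_def by blast
  have "vf_scale f \<nu> = (\<Sum>i\<in>I. vf_scale (f * h i) (\<xi> i))"
    by (simp only: h vf_scale_simps(3) vf_scale_sum)
  then show ?thesis unfolding vf_module_generated_def using h(2) A_mult[OF assms(1)] by fast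
qed

lemma generated_zero: "0 \<in> vf_module_generated A I \<xi>"
proof -
  have "0 = (\<Sum>i\<in>I. vf_scale 0 (\<xi> i))" by (simp only: vf_scale_simps sum.neutral_const)
  then show ?thesis
    unfolding vf_module_generated_def by (intro CollectI exI[of _ "\<lambda>_. 0"] conjI ballI A_zero)
qed

lemma generated_sum:
  "(\<And>i. i \<in> L \<Longrightarrow> \<nu> i \<in> vf_module_generated A I \<xi>) \<Longrightarrow> sum \<nu> L \<in> vf_module_generated A I \<xi>"
  by (induction L rule: infinite_finite_induct) (simp_all add: generated_zero generated_add)

lemma generated_base:
  assumes "finite I" "i \<in> I" "\<xi> i \<in> D"
  shows "\<xi> i \<in> vf_module_generated A I \<xi>"
proof -
  obtain e where e: "e \<in> A" "\<forall>f\<in>A. e * f = f" using unit by blast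
  have "(\<Sum>j\<in>I. vf_scale (if j = i then e else 0) (\<xi> j)) = (\<Sum>j\<in>I. if j = i then \<xi> i else 0)"
  proof (intro sum.cong refl)
    fix j
    show "vf_scale (if j = i then e else 0) (\<xi> j) = (if j = i then \<xi> i else 0)"
      using unit_scale[OF e(2) assms(3)] vf_scale_simps(4)[of "\<xi> j"] by (cases "j = i") (simp_all only: if_True if_False refl)
  qed
  also have "\<dots> = \<xi> i" using assms by simp
  finally have "\<xi> i = (\<Sum>j\<in>I. vf_scale (if j = i then e else 0) (\<xi> j))" ..
  moreover have "\<forall>j\<in>I. (if j = i then e else 0) \<in> A" using e by simp
  ultimately show ?thesis
    unfolding vf_module_generated_def by (intro CollectI exI[of _ "\<lambda>j. if j = i then e else 0"] conjI)
qed

text \<open>Each generator has its own denominator; there are finitely many, and their product does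
  not vanish at x, hence is not the zero function.\<close>

lemma localization_denominator:
  assumes K: "finite K" "\<And>i. i \<in> K \<Longrightarrow> \<xi> i \<in> D" and unit_x: "e \<in> A" "e x \<noteq> 0"
    and loc: "vf_localization A x (vf_module_generated A K \<xi>) = vf_localization A x (vf_module_generated A I \<xi>)"
  shows "\<exists>u\<in>A. u \<noteq> 0 \<and> (\<forall>\<nu>\<in>vf_module_generated A K \<xi>. vf_scale u \<nu> \<in> vf_module_generated A I \<xi>)"
proof -
  have "\<exists>u\<in>A. u x \<noteq> 0 \<and> vf_scale u (\<xi> i) \<in> vf_module_generated A I \<xi>" if i: "i \<in> K" for i
  proof -
    have "vf_fraction A x (\<xi> i) e \<in> vf_localization A x (vf_module_generated A K \<xi>)"
      unfolding vf_localization_def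
      by (intro CollectI exI[of _ "\<xi> i"] exI[of _ e] conjI refl generated_base[of K i \<xi>, OF K(1) i K(2)[OF i]] unit_x)
    then obtain \<nu> s where \<nu>: "\<nu> \<in> vf_module_generated A I \<xi>" "s \<in> A" "s x \<noteq> 0"
      "vf_fraction A x (\<xi> i) e = vf_fraction A x \<nu> s"
      unfolding loc unfolding vf_localization_def by (elim CollectE exE conjE)
    \<comment> \<open>The pair represents its own class; transported along the equality of classes,
      its membership yields the cross-multiplied identity with \<nu> / s.\<close>
    have "(\<xi> i, e) \<in> vf_fraction A x (\<xi> i) e"
      unfolding vf_fraction_def
      by (intro CollectI case_prodI conjI bexI[of _ e] refl K(2)[OF i] unit_x)
    then obtain u where u: "u \<in> A" "u x \<noteq> 0" "vf_scale (u * e) \<nu> = vf_scale (u * s) (\<xi> i)"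
      unfolding \<nu>(4) unfolding vf_fraction_def mem_Collect_eq case_prod_conv by (elim bexE conjE)
    have "vf_scale (u * s) (\<xi> i) \<in> vf_module_generated A I \<xi>"
      unfolding u(3)[symmetric] by (rule generated_scale[OF A_mult[OF u(1) unit_x(1)] \<nu>(1)])
    moreover have "(u * s) x \<noteq> 0" using u(2) \<nu>(3) by simp
    ultimately show ?thesis using A_mult[OF u(1) \<nu>(2)] by blast
  qed
  then obtain u where u: "\<And>i. i \<in> K \<Longrightarrow> u i \<in> A" "\<And>i. i \<in> K \<Longrightarrow> u i x \<noteq> 0"
    "\<And>i. i \<in> K \<Longrightarrow> vf_scale (u i) (\<xi> i) \<in> vf_module_generated A I \<xi>" by metis
  define U where "U = e * prod u K"
  have "U \<in> A" unfolding U_def by (rule A_prod_mult[OF K(1) unit_x(1)]) (rule u(1))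
  moreover have "(f * prod u L) x \<noteq> 0" if "f x \<noteq> 0" "L \<subseteq> K" for f L
    using finite_subset[OF that(2) K(1)] that
    by (induction L rule: finite_induct) (use u(2) in auto)
  then have "U x \<noteq> 0" unfolding U_def using unit_x(2) by blast
  then have "U \<noteq> 0" by auto
  moreover have "vf_scale U \<nu> \<in> vf_module_generated A I \<xi>" if \<nu>: "\<nu> \<in> vf_module_generated A K \<xi>" for \<nu>
  proof -
    obtain h where h: "\<nu> = (\<Sum>i\<in>K. vf_scale (h i) (\<xi> i))" "\<forall>i\<in>K. h i \<in> A"
      using \<nu> unfolding vf_module_generated_def by blast
    have "vf_scale U (vf_scale (h i) (\<xi> i)) \<in> vf_module_generated A I \<xi>" if i: "i \<in> K" for i
    proof -
      let ?r = "h i * (e * prod u (K - {i}))"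
      have "U * h i = ?r * u i"
        unfolding U_def prod.remove[OF K(1) i] by (simp add: mult_ac)
      then have "vf_scale U (vf_scale (h i) (\<xi> i)) = vf_scale ?r (vf_scale (u i) (\<xi> i))"
        by (simp only: vf_scale_simps(3))
      moreover have "?r \<in> A"
        by (rule A_mult[OF bspec[OF h(2) i] A_prod_mult[OF finite_Diff[OF K(1)] unit_x(1)]])
          (use u(1) in blast)
      ultimately show ?thesis using generated_scale[OF _ u(3)[OF i]] by metis
    qed
    then show ?thesis unfolding h vf_scale_sum by (rule generated_sum)
  qed
  ultimately show ?thesis by blast
qed

end

subsection \<open>Semi-compatible pairs\<close>

text \<open>The span V_i of the overview as finite sums of products: for a vector field
  \<open>\<xi>\<close>, scalars are absorbed into the first factor.\<close>

inductive_set ker_products :: "('n::finite) rfun set \<Rightarrow> 'n vfield \<Rightarrow> 'n vfield \<Rightarrow> 'n rfun set"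
  for A \<xi> \<eta> where
  zero: "0 \<in> ker_products A \<xi> \<eta>"
| add: "f \<in> ker A \<xi> \<Longrightarrow> g \<in> ker A \<eta> \<Longrightarrow> v \<in> ker_products A \<xi> \<eta> \<Longrightarrow> f * g + v \<in> ker_products A \<xi> \<eta>"

context function_algebra
begin

lemma ker_products_add:
  "v \<in> ker_products A \<xi> \<eta> \<Longrightarrow> w \<in> ker_products A \<xi> \<eta> \<Longrightarrow> v + w \<in> ker_products A \<xi> \<eta>"
proof (induction v rule: ker_products.induct)
  case (add f g v)
  then show ?case using ker_products.add[OF add.hyps(1,2), of "v + w"] by (simp only: add.assoc)
qed simp

text \<open>Applied to \<alpha>_i, which lies in Ker \<xi>_i, this allows exponents to be raised to
  a common value.\<close>

lemma ker_products_mult_left: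
  assumes "\<xi> \<in> D" "c \<in> ker A \<xi>"
  shows "v \<in> ker_products A \<xi> \<eta> \<Longrightarrow> c * v \<in> ker_products A \<xi> \<eta>"
proof (induction v rule: ker_products.induct)
  case (add f g v)
  have "c * (f * g + v) = (c * f) * g + c * v" by (simp only: algebra_simps)
  then show ?case using ker_products.add[OF ker_mult[OF assms add.hyps(1)] add.hyps(2) add.IH] by metis
qed (simp only: mult_zero_right ker_products.zero)

text \<open>The span is a module over Ker \<eta>; this is how functions on B act on it.\<close>

lemma ker_products_mult_right:
  assumes "\<eta> \<in> D" "c \<in> ker A \<eta>"
  shows "v \<in> ker_products A \<xi> \<eta> \<Longrightarrow> c * v \<in> ker_products A \<xi> \<eta>"
proof (induction v rule: ker_products.induct)
  case (add f g v)
  have "c * (f * g + v) = f * (c * g) + c * v" by (simp only: algebra_simps)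
  then show ?case using ker_products.add[OF add.hyps(1) ker_mult[OF assms add.hyps(2)] add.IH] by metis
qed (simp only: mult_zero_right ker_products.zero)

lemma ker_scale:
  assumes "\<xi> \<in> D" "f \<in> ker A \<xi>"
  shows "(\<lambda>x. c * f x) \<in> ker A \<xi>"
proof -
  have f: "f \<in> A" "\<xi> f = 0" using assms(2) by (simp_all add: ker_def)
  then have "\<xi> (\<lambda>x. c * f x) = 0" using D_scale[OF assms(1) f(1), of c] by (simp add: fun_eq_iff)
  then show ?thesis using f(1) by (simp add: ker_def)
qed

lemma ker_products_scale:
  assumes "\<xi> \<in> D"
  shows "v \<in> ker_products A \<xi> \<eta> \<Longrightarrow> (\<lambda>x. c * v x) \<in> ker_products A \<xi> \<eta>"
proof (induction v rule: ker_products.induct)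
  case zero
  have "(\<lambda>x. c * (0 :: 'n rfun) x) = 0" by (simp add: fun_eq_iff)
  then show ?case using ker_products.zero by metis
next
  case (add f g v)
  have "(\<lambda>x. c * (f * g + v) x) = (\<lambda>x. c * f x) * g + (\<lambda>x. c * v x)"
    by (simp add: fun_eq_iff algebra_simps)
  then show ?case using ker_products.add[OF ker_scale[OF assms add.hyps(1)] add.hyps(2) add.IH] by metis
qed

end

text \<open>As \<open>a\<close> is killed, the numerator f0 of f is killed on the open set. Then a
  \<xi>(f0) = 0 on X, and \<open>a\<close> cancels in the domain.\<close>

lemma ker_of_restriction:
  fixes X :: "(complex^'n::finite) set"
  assumes X: "affine_variety X" and \<xi>: "\<xi> \<in> vfields (coord_ring X)" and a: "a \<in> ker (coord_ring X) \<xi>" "a \<noteq> 0"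
    and restr: "restricts_to_open X a \<xi> \<xi>'" and f: "f \<in> ker (coord_ring_open X a) \<xi>'"
  shows "\<exists>f0\<in>ker (coord_ring X) \<xi>. \<exists>m. \<forall>x\<in>principal_open X a. f x * a x ^ m = f0 x"
proof -
  interpret function_domain "coord_ring X" by (rule function_domain_coord_ring[OF X])
  let ?S = "principal_open X a" and ?A' = "coord_ring_open X a"
  have nz: "a x \<noteq> 0" if "x \<in> ?S" for x using that by (auto simp: principal_open_def)
  have aA: "a \<in> coord_ring X" "\<xi> a = 0" using a by (simp_all add: ker_def)
  have \<xi>': "\<xi>' \<in> vfields ?A'"
    and res: "\<And>g. g \<in> coord_ring X \<Longrightarrow> \<xi>' (zero_outside ?S g) = zero_outside ?S (\<xi> g)"
    using restr by (auto simp: restricts_to_open_def)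
  obtain f0 m where f0: "f0 \<in> coord_ring X" "f = zero_outside ?S (\<lambda>x. f0 x / a x ^ m)"
    using f by (auto simp: ker_def coord_ring_open_def)
  let ?F = "\<lambda>q. zero_outside ?S (\<lambda>x. f0 x / a x ^ q)" and ?a = "zero_outside ?S a"
  have F: "?F q \<in> ?A'" for q using f0(1) by (auto simp: coord_ring_open_def)
  have a': "?a \<in> ?A'"
    unfolding coord_ring_open_def using aA(1) by (intro CollectI exI[of _ a] exI[of _ 0]) simp
  have \<xi>'a: "\<xi>' ?a = 0" using res[OF aA(1)] aA(2) by (simp add: zero_outside_def fun_eq_iff)
  \<comment> \<open>Multiplication by \<open>a\<close> lowers the exponent by one, so the product
    rule suffices and no quotient rule for \<open>\<xi>'\<close> is required.\<close>
  have step: "\<xi>' (?F q) = 0" if "\<xi>' (?F (Suc q)) = 0" for q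
  proof -
    have "?F q = ?a * ?F (Suc q)" using nz by (auto simp: zero_outside_def fun_eq_iff)
    moreover have "\<xi>' (?a * ?F (Suc q)) = ?a * \<xi>' (?F (Suc q)) + ?F (Suc q) * \<xi>' ?a"
      using \<xi>' a' F unfolding vfields_def by blast
    ultimately show ?thesis by (simp only: that \<xi>'a mult_zero_right add_0)
  qed
  have "\<xi>' (?F m) = 0" using f f0(2) by (simp add: ker_def)
  then have "\<xi>' (?F 0) = 0" by (induction m) (use step in blast)+
  then have "zero_outside ?S (\<xi> f0) = 0" using res[OF f0(1)] by simp
  then have "(a * \<xi> f0) x = 0" for x
    using fun_cong[of _ _ x] coord_ring_outside[OF aA(1), of x]
    by (cases "x \<in> ?S") (fastforce simp: zero_outside_def principal_open_def)+
  then have "a * \<xi> f0 = 0" by (simp add: fun_eq_iff)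
  then have "\<xi> f0 = 0" using no_zero_divisors[OF aA(1) D_closed[OF \<xi>]] a(2) by blast
  then have "f0 \<in> ker (coord_ring X) \<xi>" using f0(1) by (simp add: ker_def)
  moreover have "\<forall>x\<in>?S. f x * a x ^ m = f0 x" using nz by (simp add: f0(2) zero_outside_def)
  ultimately show ?thesis by blast
qed

text \<open>The exponent depends on the function \<open>g\<close>: in general no power of \<open>a\<close> clears the denominators
  uniformly.\<close>
lemma semi_compatible_on_open_denominators:
  fixes X :: "(complex^'n::finite) set"
  assumes X: "affine_variety X" and \<xi>: "\<xi> \<in> vfields (coord_ring X)" "a \<in> ker (coord_ring X) \<xi>"
    and \<eta>: "\<eta> \<in> vfields (coord_ring X)" "a \<in> ker (coord_ring X) \<eta>"
    and sc: "semi_compatible_on_open X a \<xi> \<eta>"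
  shows "\<exists>h\<in>coord_ring X. h \<noteq> 0 \<and>
    (\<forall>g\<in>coord_ring X. \<exists>m. a ^ Suc m * (g * h) \<in> ker_products (coord_ring X) \<xi> \<eta>)"
proof -
  interpret function_domain "coord_ring X" by (rule function_domain_coord_ring[OF X])
  let ?S = "principal_open X a" and ?A' = "coord_ring_open X a" and ?V = "ker_products (coord_ring X) \<xi> \<eta>"
  have nz: "a x \<noteq> 0" if "x \<in> ?S" for x using that by (auto simp: principal_open_def)
  have aA: "a \<in> coord_ring X" using \<xi>(2) by (simp add: ker_def)
  obtain \<xi>' \<eta>' J where r: "restricts_to_open X a \<xi> \<xi>'" "restricts_to_open X a \<eta> \<eta>'"
    and J: "is_ideal ?A' J" "J \<noteq> {0}"
    and span: "J \<subseteq> cfun.span {f * g | f g. f \<in> ker ?A' \<xi>' \<and> g \<in> ker ?A' \<eta>'}"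
    using sc unfolding semi_compatible_on_open_def semi_compatible_def by blast
  have "0 \<in> J" using J(1) by (simp add: is_ideal_def)
  \<comment> \<open>The numerator \<open>h\<close> of this element of the ideal is the witness; its
    denominator a^s is absorbed into the multiplier below.\<close>
  then obtain h' where h': "h' \<in> J" "h' \<noteq> 0" using J(2) by blast
  then have "h' \<in> ?A'" using J(1) by (auto simp: is_ideal_def)
  then obtain h s where h: "h \<in> coord_ring X" "h' = zero_outside ?S (\<lambda>x. h x / a x ^ s)"
    by (auto simp: coord_ring_open_def)
  obtain x where "h' x \<noteq> 0" using h'(2) by (auto simp: fun_eq_iff)
  then have "x \<in> ?S" "h x \<noteq> 0" unfolding h(2) by (auto simp: zero_outside_def split: if_splits)
  then have "h \<noteq> 0" "a \<noteq> 0" using nz[of x] by auto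
  have power_V: "a ^ m * w \<in> ?V" if "w \<in> ?V" for m w
    using that
  proof (induction m)
    case (Suc m)
    then show ?case using ker_products_mult_left[OF \<xi>, of "a ^ m * w"] by (simp only: power_Suc mult.assoc)
  qed simp
  \<comment> \<open>Products are lifted factor by factor with \<open>ker_of_restriction\<close>;
    sums are brought to the exponent m + m', which \<open>power_V\<close> permits.\<close>
  have clear: "\<exists>m. \<exists>w\<in>?V. \<forall>x\<in>?S. v x * a x ^ m = w x"
    if "v \<in> cfun.span {f * g | f g. f \<in> ker ?A' \<xi>' \<and> g \<in> ker ?A' \<eta>'}" for v
    using that
  proof (induction v rule: cfun.span_induct)
    case base
    show ?case
    proof (rule cfun.subspaceI)
      show "0 \<in> {v. \<exists>m. \<exists>w\<in>?V. \<forall>x\<in>?S. v x * a x ^ m = w x}"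
      proof (intro CollectI exI[of _ 0] bexI[of _ 0] ballI)
        show "(0 :: 'n rfun) x * a x ^ 0 = (0 :: 'n rfun) x" for x by simp
      qed (rule ker_products.zero)
    next
      fix v v' assume "v \<in> {v. \<exists>m. \<exists>w\<in>?V. \<forall>x\<in>?S. v x * a x ^ m = w x}"
        "v' \<in> {v. \<exists>m. \<exists>w\<in>?V. \<forall>x\<in>?S. v x * a x ^ m = w x}"
      then obtain m w m' w' where w: "w \<in> ?V" "\<forall>x\<in>?S. v x * a x ^ m = w x"
        "w' \<in> ?V" "\<forall>x\<in>?S. v' x * a x ^ m' = w' x" by blast
      have pw: "(a ^ l * g) x = a x ^ l * g x" for l g x
        by (induction l) (simp_all add: mult.assoc)
      have "\<forall>x\<in>?S. (v + v') x * a x ^ (m + m') = (a ^ m' * w + a ^ m * w') x"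
      proof
        fix x assume x: "x \<in> ?S"
        have "w x = v x * a x ^ m" "w' x = v' x * a x ^ m'" using w(2,4) x by simp_all
        moreover have "(p + q) * (c * d) = d * (p * c) + c * (q * d)" for p q c d :: complex
          by (simp add: algebra_simps)
        ultimately show "(v + v') x * a x ^ (m + m') = (a ^ m' * w + a ^ m * w') x"
          by (simp only: plus_fun_apply pw power_add)
      qed
      moreover have "a ^ m' * w + a ^ m * w' \<in> ?V" by (intro ker_products_add power_V w(1,3))
      ultimately show "v + v' \<in> {v. \<exists>m. \<exists>w\<in>?V. \<forall>x\<in>?S. v x * a x ^ m = w x}"
        by (intro CollectI exI[of _ "m + m'"] bexI[of _ "a ^ m' * w + a ^ m * w'"])
    next
      fix c v assume "v \<in> {v. \<exists>m. \<exists>w\<in>?V. \<forall>x\<in>?S. v x * a x ^ m = w x}"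
      then obtain m w where w: "w \<in> ?V" "\<forall>x\<in>?S. v x * a x ^ m = w x" by blast
      have "\<forall>x\<in>?S. c * v x * a x ^ m = c * w x" using w(2) by simp
      then show "(\<lambda>x. c * v x) \<in> {v. \<exists>m. \<exists>w\<in>?V. \<forall>x\<in>?S. v x * a x ^ m = w x}"
        using ker_products_scale[OF \<xi>(1) w(1), of c]
        by (intro CollectI exI[of _ m] bexI[of _ "\<lambda>x. c * w x"])
    qed
  next
    case (step v)
    then obtain f g where fg: "v = f * g" "f \<in> ker ?A' \<xi>'" "g \<in> ker ?A' \<eta>'" by blast
    obtain f0 m where f0: "f0 \<in> ker (coord_ring X) \<xi>" "\<forall>x\<in>?S. f x * a x ^ m = f0 x"
      using ker_of_restriction[OF X \<xi> \<open>a \<noteq> 0\<close> r(1) fg(2)] by blast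
    obtain g0 l where g0: "g0 \<in> ker (coord_ring X) \<eta>" "\<forall>x\<in>?S. g x * a x ^ l = g0 x"
      using ker_of_restriction[OF X \<eta> \<open>a \<noteq> 0\<close> r(2) fg(3)] by blast
    have "\<forall>x\<in>?S. v x * a x ^ (m + l) = (f0 * g0) x"
    proof
      fix x assume x: "x \<in> ?S"
      have "f0 x = f x * a x ^ m" "g0 x = g x * a x ^ l" using f0(2) g0(2) x by simp_all
      moreover have "p * q * (c * d) = p * c * (q * d)" for p q c d :: complex
        by (simp add: algebra_simps)
      ultimately show "v x * a x ^ (m + l) = (f0 * g0) x"
        by (simp only: fg(1) times_fun_apply power_add)
    qed
    moreover have "f0 * g0 \<in> ?V" using ker_products.add[OF f0(1) g0(1) ker_products.zero] by simp
    ultimately show ?case by blast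
  qed
  have "\<exists>m. a ^ Suc m * (g * h) \<in> ?V" if g: "g \<in> coord_ring X" for g
  proof -
    \<comment> \<open>The factor a^s cancels the denominator of \<open>h'\<close>, so that the
      product with \<open>h'\<close> is g h on the open set.\<close>
    let ?g' = "zero_outside ?S (\<lambda>x. g x * a x ^ s)"
    have pw: "(a ^ l * f) x = a x ^ l * f x" for l f x
      by (induction l) (simp_all add: mult.assoc)
    have "a ^ s * g \<in> coord_ring X" using aA g by simp
    moreover have "?g' = zero_outside ?S (\<lambda>x. (a ^ s * g) x / a x ^ 0)"
      unfolding pw by (simp add: mult.commute)
    ultimately have "?g' \<in> ?A'" unfolding coord_ring_open_def by blast
    then have "?g' * h' \<in> J" using h'(1) J(1) unfolding is_ideal_def by blast
    then obtain m w where w: "w \<in> ?V" "\<And>x. x \<in> ?S \<Longrightarrow> (?g' * h') x * a x ^ m = w x"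
      using clear span by blast
    \<comment> \<open>Agreement with \<open>w\<close> is known only where \<open>a\<close> is
      nonzero. One more factor \<open>a\<close> makes both sides vanish elsewhere, whence
      \<open>Suc m\<close>.\<close>
    have "a ^ Suc m * (g * h) = a * w"
    proof (rule ext)
      fix x
      show "(a ^ Suc m * (g * h)) x = (a * w) x"
      proof (cases "x \<in> ?S")
        case True
        then have "g x * h x * a x ^ m = w x"
          using w(2)[OF True] nz[OF True] by (simp add: h(2) zero_outside_def)
        then show ?thesis unfolding pw by (simp add: mult_ac)
      next
        case False
        then have "a x = 0" using coord_ring_outside[OF aA] by (auto simp: principal_open_def)
        then show ?thesis unfolding pw by simp
      qed
    qed
    then show ?thesis using ker_products_mult_left[OF \<xi> w(1)] by metis
  qed
  then show ?thesis using h(1) \<open>h \<noteq> 0\<close> by blast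
qed

subsection \<open>Divergence-free fields on an affine variety with a volume form\<close>

locale affine_volume =
  fixes X :: "(complex^'n::finite) set" and \<omega> :: "'n dform"
  assumes smooth: "smooth_affine_variety X"
    and volume_form_degree: "\<omega> \<in> forms (coord_ring X) (variety_dim X)"
begin

lemma affine: "affine_variety X"
  using smooth by (simp add: smooth_affine_variety_def)

sublocale function_domain "coord_ring X"
  by (rule function_domain_coord_ring[OF affine])

sublocale top_form "coord_ring X" \<omega> "variety_dim X"
  by (rule top_form_coord_ring[OF smooth volume_form_degree])

lemma IVF_D: "\<xi> \<in> IVF X \<omega> \<Longrightarrow> \<xi> \<in> D"
  and IVF_lie: "\<xi> \<in> IVF X \<omega> \<Longrightarrow> lie_derivative (coord_ring X) \<xi> \<omega> = 0"
  by (simp_all add: IVF_def AVF_def)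

text \<open>The divergence of f \<xi> is f times that of \<xi> plus \<xi>(f), and both terms
  vanish.\<close>

lemma IVF_scale:
  assumes \<xi>: "\<xi> \<in> IVF X \<omega>" and f: "f \<in> ker (coord_ring X) \<xi>"
  shows "vf_scale f \<xi> \<in> IVF X \<omega>"
proof -
  have fA: "f \<in> coord_ring X" "\<xi> f = 0" using f by (simp_all add: ker_def)
  have "lie_derivative (coord_ring X) (vf_scale f \<xi>) \<omega> = 0"
  proof (rule ext)
    fix vs
    show "lie_derivative (coord_ring X) (vf_scale f \<xi>) \<omega> vs = 0 vs"
    proof (cases "set vs \<subseteq> D")
      case True
      then show ?thesis
        using divergence_scale[OF fA(1) IVF_D[OF \<xi>] True]
        by (simp only: IVF_lie[OF \<xi>] fA(2) zero_fun_apply mult_zero_left mult_zero_right add_0)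
    qed (simp add: lie_out)
  qed
  moreover have "complete_vf X (coord_ring X) (vf_scale f \<xi>)"
    using complete_vf_scale[OF IVF_D[OF \<xi>] _ f] \<xi> by (simp add: IVF_def)
  ultimately show ?thesis
    using scale_in_D[OF fA(1) IVF_D[OF \<xi>]] by (simp add: IVF_def AVF_def)
qed

lemma Lie_alg_D: "\<zeta> \<in> Lie_alg X \<omega> \<Longrightarrow> \<zeta> \<in> D"
  unfolding Lie_alg_def
  by (induction rule: lie_generated.induct)
    (erule IVF_D, rule zero_in_D, erule (1) add_in_D, erule const_scale_in_D, erule (1) bracket_in_D)

lemma interior_add:
  assumes "\<sigma> \<in> forms (coord_ring X) k" "\<xi> \<in> D" "\<eta> \<in> D"
  shows "interior_product (\<xi> + \<eta>) \<sigma> = interior_product \<xi> \<sigma> + interior_product \<eta> \<sigma>"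
proof (rule ext)
  fix vs
  show "interior_product (\<xi> + \<eta>) \<sigma> vs = (interior_product \<xi> \<sigma> + interior_product \<eta> \<sigma>) vs"
    unfolding plus_fun_apply[of "interior_product \<xi> \<sigma>" "interior_product \<eta> \<sigma>" vs]
    unfolding interior_product_def by (rule form_add_hd[OF assms])
qed

lemma interior_zero:
  assumes "\<sigma> \<in> forms (coord_ring X) k"
  shows "interior_product 0 \<sigma> = 0"
proof (rule ext)
  fix vs
  show "interior_product 0 \<sigma> vs = 0 vs"
    unfolding interior_product_def using form_zero_entry[OF assms, of "[]" vs]
    by (simp only: append_Nil zero_fun_apply)
qed

lemma interior_scale:
  assumes "\<sigma> \<in> forms (coord_ring X) k" "\<xi> \<in> D" "h \<in> coord_ring X"
  shows "interior_product (vf_scale h \<xi>) \<sigma> = (\<lambda>vs. h * interior_product \<xi> \<sigma> vs)"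
  unfolding interior_product_def by (rule ext) (rule form_scale_hd[OF assms])

text \<open>Moves the condition on a form to the field that produces it, so that it can be checked
  on sums of multiples of the \<xi>_i.\<close>

definition Lie_potential :: "'n vfield \<Rightarrow> 'n vfield set" where
  "Lie_potential \<eta> = {\<zeta> \<in> D. ext_deriv (coord_ring X) (interior_product \<zeta> (interior_product \<eta> \<omega>))
     \<in> Theta \<omega> ` Lie_alg X \<omega>}"

lemma Lie_potential_zero:
  assumes "\<eta> \<in> D"
  shows "0 \<in> Lie_potential \<eta>"
proof -
  have "ext_deriv (coord_ring X) (interior_product 0 (interior_product \<eta> \<omega>)) = Theta \<omega> 0"
    unfolding Theta_def interior_zero[OF interior_product_form[OF assms volume]]
      interior_zero[OF volume] d_zero ..
  moreover have "0 \<in> Lie_alg X \<omega>" unfolding Lie_alg_def by (rule lie_generated.zero)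
  ultimately show ?thesis unfolding Lie_potential_def using zero_in_D by blast
qed

lemma Lie_potential_add:
  assumes \<eta>: "\<eta> \<in> D" and "\<zeta> \<in> Lie_potential \<eta>" "\<zeta>' \<in> Lie_potential \<eta>"
  shows "\<zeta> + \<zeta>' \<in> Lie_potential \<eta>"
proof -
  let ?d = "\<lambda>\<zeta>. ext_deriv (coord_ring X) (interior_product \<zeta> (interior_product \<eta> \<omega>))"
  obtain \<nu> \<nu>' where \<nu>: "\<zeta> \<in> D" "\<zeta>' \<in> D" "\<nu> \<in> Lie_alg X \<omega>" "\<nu>' \<in> Lie_alg X \<omega>"
    "?d \<zeta> = Theta \<omega> \<nu>" "?d \<zeta>' = Theta \<omega> \<nu>'"
    using assms(2,3) unfolding Lie_potential_def by blast
  note f = interior_product_form[OF \<eta> volume]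
  have "?d (\<zeta> + \<zeta>') = ?d \<zeta> + ?d \<zeta>'"
    unfolding interior_add[OF f \<nu>(1,2)]
    by (rule d_add[OF interior_product_form[OF \<nu>(1) f] interior_product_form[OF \<nu>(2) f]])
  also have "\<dots> = Theta \<omega> (\<nu> + \<nu>')"
    unfolding \<nu>(5,6) Theta_def
    by (rule interior_add[OF volume Lie_alg_D[OF \<nu>(3)] Lie_alg_D[OF \<nu>(4)], symmetric])
  finally have eq: "?d (\<zeta> + \<zeta>') = Theta \<omega> (\<nu> + \<nu>')" .
  have "\<nu> + \<nu>' \<in> Lie_alg X \<omega>"
    using \<nu>(3,4) unfolding Lie_alg_def by (rule lie_generated.add)
  then show ?thesis
    unfolding Lie_potential_def using eq add_in_D[OF \<nu>(1,2)] by blast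
qed

lemma Lie_potential_sum:
  "\<eta> \<in> D \<Longrightarrow> (\<And>i. i \<in> I \<Longrightarrow> \<zeta> i \<in> Lie_potential \<eta>) \<Longrightarrow> sum \<zeta> I \<in> Lie_potential \<eta>"
  by (induction I rule: infinite_finite_induct)
    (simp_all only: sum.infinite sum.empty sum.insert Lie_potential_zero Lie_potential_add
      not_False_eq_True insertI1 insertI2)

text \<open>For \<open>f \<in> Ker \<xi>\<close> and \<open>g \<in> Ker \<eta>\<close> the form \<open>f g \<iota>\<^sub>\<xi> \<iota>\<^sub>\<eta> \<omega>\<close> is a potential of the bracket of the
  complete fields \<open>f \<xi>\<close> and \<open>g \<eta>\<close>.\<close>
lemma Lie_potential_ker_products:
  assumes \<xi>: "\<xi> \<in> IVF X \<omega>" and \<eta>: "\<eta> \<in> IVF X \<omega>"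
  shows "v \<in> ker_products (coord_ring X) \<xi> \<eta> \<Longrightarrow> vf_scale v \<xi> \<in> Lie_potential \<eta>"
proof (induction v rule: ker_products.induct)
  case zero
  show ?case unfolding vf_scale_simps by (rule Lie_potential_zero[OF IVF_D[OF \<eta>]])
next
  case (add f g v)
  have fg: "f \<in> coord_ring X" "g \<in> coord_ring X" using add.hyps by (simp_all add: ker_def)
  note D = IVF_D[OF \<xi>] IVF_D[OF \<eta>]
  note f\<xi> = IVF_scale[OF \<xi> add.hyps(1)] and g\<eta> = IVF_scale[OF \<eta> add.hyps(2)]
  \<comment> \<open>Multilinearity distributes f g over the two slots, f to \<open>\<xi>\<close> and
    g to \<open>\<eta>\<close>, so that both scaled fields remain complete and
    divergence-free.\<close>
  have "interior_product (vf_scale (f * g) \<xi>) (interior_product \<eta> \<omega>)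
    = interior_product (vf_scale f \<xi>) (interior_product (vf_scale g \<eta>) \<omega>)"
  proof (rule ext)
    fix vs
    have "\<omega> (vf_scale g \<eta> # vf_scale f \<xi> # vs) = g * (f * \<omega> (\<eta> # \<xi> # vs))"
      using form_scale_hd[OF volume D(2) fg(2), of "vf_scale f \<xi> # vs"]
        form_scale[OF volume D(1) fg(1), of "[\<eta>]" vs] by simp
    moreover have "\<omega> (\<eta> # vf_scale (f * g) \<xi> # vs) = (f * g) * \<omega> (\<eta> # \<xi> # vs)"
      using form_scale[OF volume D(1) A_mult[OF fg], of "[\<eta>]" vs] by simp
    ultimately show "interior_product (vf_scale (f * g) \<xi>) (interior_product \<eta> \<omega>) vs
      = interior_product (vf_scale f \<xi>) (interior_product (vf_scale g \<eta>) \<omega>) vs"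
      unfolding interior_product_def by (simp only: mult_ac)
  qed
  then have "ext_deriv (coord_ring X) (interior_product (vf_scale (f * g) \<xi>) (interior_product \<eta> \<omega>))
    = Theta \<omega> (bracket (vf_scale f \<xi>) (vf_scale g \<eta>))"
    unfolding Theta_def
    using d_interior_interior[OF IVF_D[OF f\<xi>] IVF_D[OF g\<eta>] IVF_lie[OF f\<xi>] IVF_lie[OF g\<eta>]] by metis
  moreover have "bracket (vf_scale f \<xi>) (vf_scale g \<eta>) \<in> Lie_alg X \<omega>"
    unfolding Lie_alg_def by (intro lie_generated.bracket lie_generated.base f\<xi> g\<eta>)
  ultimately have "vf_scale (f * g) \<xi> \<in> Lie_potential \<eta>"
    unfolding Lie_potential_def using scale_in_D[OF A_mult[OF fg] D(1)] by blast
  then show ?case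
    unfolding vf_scale_simps(2) by (rule Lie_potential_add[OF D(2) _ add.IH])
qed

end

lemma pullback_add: "pullback X \<pi> (f + g) = pullback X \<pi> f + pullback X \<pi> g"
  and pullback_mult: "pullback X \<pi> (f * g) = pullback X \<pi> f * pullback X \<pi> g"
  and pullback_zero: "pullback X \<pi> 0 = 0"
  by (auto simp: pullback_def zero_outside_def fun_eq_iff)

lemma pullback_power_Suc: "pullback X \<pi> (f ^ Suc m) = pullback X \<pi> f ^ Suc m"
  by (induction m) (simp, metis pullback_mult power_Suc)

lemma pullback_one_on: "\<pi> ` X \<subseteq> B \<Longrightarrow> pullback X \<pi> (one_on B) = one_on X"
  by (auto simp: pullback_def zero_outside_def fun_eq_iff)

text \<open>In a finite sum the generator can be pulled out because \<open>N\<close> is a module;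
  the converse uses that the unit puts \<open>\<theta>\<close> into its own ideal.\<close>

lemma ideal_times_module_principal:
  assumes "function_domain A" "N = vf_module_generated A I \<xi>" "\<theta> \<in> A"
  shows "ideal_times_module {g * \<theta> | g. g \<in> A} N = vf_scale \<theta> ` N"
proof -
  interpret function_domain A by (rule assms(1))
  show ?thesis
  proof
    show "ideal_times_module {g * \<theta> | g. g \<in> A} N \<subseteq> vf_scale \<theta> ` N"
    proof
      fix \<zeta> assume "\<zeta> \<in> ideal_times_module {g * \<theta> | g. g \<in> A} N"
      then obtain m :: nat and h \<nu> where \<zeta>: "\<zeta> = (\<Sum>l<m. vf_scale (h l) (\<nu> l))"
        "\<forall>l<m. h l \<in> {g * \<theta> | g. g \<in> A} \<and> \<nu> l \<in> N"
        unfolding ideal_times_module_def by blast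
      then have "\<forall>l<m. \<exists>g. g \<in> A \<and> h l = g * \<theta>" by blast
      then obtain g where g: "\<forall>l<m. g l \<in> A \<and> h l = g l * \<theta>" by metis
      have "\<zeta> = (\<Sum>l<m. vf_scale \<theta> (vf_scale (g l) (\<nu> l)))"
        unfolding \<zeta>(1) vf_scale_simps(3) using g by (intro sum.cong refl) (simp add: mult.commute)
      also have "\<dots> = vf_scale \<theta> (\<Sum>l<m. vf_scale (g l) (\<nu> l))" by (rule vf_scale_sum[symmetric])
      also have "\<dots> \<in> vf_scale \<theta> ` N"
        unfolding assms(2)
        by (intro imageI generated_sum generated_scale) (use g \<zeta>(2) assms(2) in auto)
      finally show "\<zeta> \<in> vf_scale \<theta> ` N" .
    qed
    show "vf_scale \<theta> ` N \<subseteq> ideal_times_module {g * \<theta> | g. g \<in> A} N"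
    proof
      fix \<zeta> assume "\<zeta> \<in> vf_scale \<theta> ` N"
      then obtain \<nu> where \<nu>: "\<nu> \<in> N" "\<zeta> = vf_scale \<theta> \<nu>" by blast
      obtain e where e: "e \<in> A" "\<forall>f\<in>A. e * f = f" using unit by blast
      then have "\<theta> = e * \<theta>" using assms(3) by simp
      then have "\<theta> \<in> {g * \<theta> | g. g \<in> A}" using e(1) by blast
      moreover have "\<zeta> = (\<Sum>l<1::nat. vf_scale \<theta> \<nu>)" unfolding \<nu>(2) by simp
      ultimately show "\<zeta> \<in> ideal_times_module {g * \<theta> | g. g \<in> A} N"
        unfolding ideal_times_module_def using \<nu>(1)
        by (intro CollectI exI[of _ "1::nat"] exI[of _ "\<lambda>_. \<theta>"] exI[of _ "\<lambda>_. \<nu>"]) blast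
    qed
  qed
qed

theorem theorem9p2:
  fixes X :: "(complex^'n::finite) set" and B :: "(complex^'m::finite) set"
    and \<pi> :: "complex^'n \<Rightarrow> complex^'m"
    and \<omega> :: "'n dform" and \<eta> :: "'n vfield"
    and \<alpha> :: "nat \<Rightarrow> 'm rfun" and \<xi> :: "nat \<Rightarrow> 'n vfield"
    and n k :: nat and N :: "'n vfield set"
  assumes "smooth_affine_variety X" and "smooth_affine_variety B"
    and "is_morphism \<pi> X B" and "\<pi> ` X = B"
    and "n = variety_dim X"
    and "volume_form X \<omega>"
    and "\<eta> \<in> IVF X \<omega>"
    and "pullback X \<pi> ` coord_ring B \<subseteq> ker (coord_ring X) \<eta>"
    and "\<forall>i\<in>{1..k}. \<alpha> i \<in> coord_ring B"
    and "\<not> (\<exists>b\<in>B. \<forall>i\<in>{1..k}. \<alpha> i b = 0)"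
    and "\<forall>i\<in>{1..k}. \<xi> i \<in> IVF X \<omega>"
    and "\<forall>i\<in>{1..k}. pullback X \<pi> (\<alpha> i) \<in> ker (coord_ring X) (\<xi> i)"
    and "\<forall>i\<in>{1..k}. semi_compatible_on_open X (pullback X \<pi> (\<alpha> i)) (\<xi> i) \<eta>"
    and "N = vf_module_generated (coord_ring X) {1..k} \<xi>"
    and "\<forall>x\<in>X. vf_localization (coord_ring X) x N =
           vf_localization (coord_ring X) x
             (vf_module_generated (coord_ring X) {j\<in>{1..k}. pullback X \<pi> (\<alpha> j) x \<noteq> 0} \<xi>)"
  shows "\<exists>J. is_ideal (coord_ring X) J \<and> J \<noteq> {0} \<and>
    (let M = {interior_product \<zeta> (interior_product \<eta> \<omega>) | \<zeta>.
                \<zeta> \<in> ideal_times_module J N}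
     in is_form_submodule (coord_ring X) (n - 2) M \<and>
        M \<subseteq> d_preimage X (n - 2) (Theta \<omega> ` Lie_alg X \<omega>))"
proof -
  interpret affine_volume X \<omega>
    using assms(1,6) by unfold_locales (simp_all add: volume_form_def)
  let ?A = "coord_ring X" and ?K = "{1..k}"
  interpret B: function_domain "coord_ring B"
    using assms(2) by (intro function_domain_coord_ring) (simp add: smooth_affine_variety_def)
  define a where "a i = pullback X \<pi> (\<alpha> i)" for i
  define V where "V i = ker_products ?A (\<xi> i) \<eta>" for i
  define I where "I x = {j\<in>?K. a j x \<noteq> 0}" for x
  have \<eta>: "\<eta> \<in> D" using IVF_D[OF assms(7)] .
  have \<xi>: "\<xi> i \<in> D" if "i \<in> ?K" for i using IVF_D assms(11) that by blast
  have pb: "pullback X \<pi> \<beta> \<in> ker ?A \<eta>" if "\<beta> \<in> coord_ring B" for \<beta> using assms(8) that by blast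
  have oneX: "one_on X \<in> ?A" "one_on X \<noteq> 0"
    using one_on_coord_ring affine by (auto simp: affine_variety_def zero_outside_def fun_eq_iff)
  have N_D: "\<nu> \<in> D" if "\<nu> \<in> N" for \<nu>
    using generated_subset[of ?K \<xi> \<nu>] \<xi> that assms(14) by blast

  \<comment> \<open>Choice of the multiplier \<open>\<theta>\<close>\<close>
  have "\<exists>h\<in>?A. h \<noteq> 0 \<and> (\<forall>g\<in>?A. \<exists>m. a i ^ Suc m * (g * h) \<in> V i)" if i: "i \<in> ?K" for i
    unfolding a_def V_def
    using semi_compatible_on_open_denominators[OF affine \<xi>[OF i] _ \<eta> pb] assms(9,12,13) i by blast
  then obtain h where h: "\<And>i. i \<in> ?K \<Longrightarrow> h i \<in> ?A" "\<And>i. i \<in> ?K \<Longrightarrow> h i \<noteq> 0"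
    "\<And>i g. i \<in> ?K \<Longrightarrow> g \<in> ?A \<Longrightarrow> \<exists>m. a i ^ Suc m * (g * h i) \<in> V i" by metis

  \<comment> \<open>The denominator is attached to the index set and not to the point, so finitely
    many suffice. For a set that does not occur the unit serves as a default.\<close>
  have "\<exists>u\<in>?A. u \<noteq> 0 \<and> (\<forall>x\<in>X. I x = L \<longrightarrow> (\<forall>\<nu>\<in>N. vf_scale u \<nu> \<in> vf_module_generated ?A L \<xi>))" for L
  proof (cases "\<exists>x\<in>X. I x = L")
    case True
    then obtain x where x: "x \<in> X" "I x = L" by blast
    have "one_on X x \<noteq> 0" using x(1) by (simp add: zero_outside_def)
    moreover have "vf_localization ?A x (vf_module_generated ?A ?K \<xi>)
      = vf_localization ?A x (vf_module_generated ?A L \<xi>)"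
      using assms(15) x unfolding assms(14) I_def a_def by blast
    ultimately show ?thesis
      using localization_denominator[of ?K \<xi> "one_on X" x L] \<xi> oneX(1) unfolding assms(14) by blast
  qed (use oneX in blast)
  then obtain u where u: "\<And>L. u L \<in> ?A" "\<And>L. u L \<noteq> 0"
    "\<And>x \<nu>. x \<in> X \<Longrightarrow> \<nu> \<in> N \<Longrightarrow> vf_scale (u (I x)) \<nu> \<in> vf_module_generated ?A (I x) \<xi>" by metis

  define \<theta>1 where "\<theta>1 = one_on X * prod h ?K"
  have \<theta>1: "\<theta>1 \<in> ?A" "\<theta>1 \<noteq> 0" unfolding \<theta>1_def
    using prod_nonzero[of ?K "one_on X" h] oneX h(1,2) by blast+
  define \<theta> where "\<theta> = \<theta>1 * prod u (Pow ?K)"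
  have \<theta>: "\<theta> \<in> ?A" "\<theta> \<noteq> 0" unfolding \<theta>_def
    using prod_nonzero[of "Pow ?K" \<theta>1 u] \<theta>1 u(1,2) by blast+

  \<comment> \<open>Admissible fields and the ideal in \<complex>[B]\<close>
  define E where "E = {\<Sum>i\<in>?K. vf_scale (v i) (\<xi> i) | v. \<forall>i\<in>?K. v i \<in> V i}"
  have E_potential: "E \<subseteq> Lie_potential \<eta>"
  proof
    fix \<zeta> assume "\<zeta> \<in> E"
    then obtain v where v: "\<zeta> = (\<Sum>i\<in>?K. vf_scale (v i) (\<xi> i))" "\<forall>i\<in>?K. v i \<in> V i"
      unfolding E_def by blast
    show "\<zeta> \<in> Lie_potential \<eta>"
      unfolding v(1)
    proof (rule Lie_potential_sum[OF \<eta>])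
      fix i assume i: "i \<in> ?K"
      show "vf_scale (v i) (\<xi> i) \<in> Lie_potential \<eta>"
        using bspec[OF v(2) i] unfolding V_def
        by (rule Lie_potential_ker_products[OF bspec[OF assms(11) i] assms(7)])
    qed
  qed

  have in_E: "vf_scale \<theta> \<nu> \<in> E" if \<nu>: "\<nu> \<in> N" for \<nu>
  proof -
    \<comment> \<open>The ideal depends on \<open>\<nu>\<close>, as the exponents chosen below
      depend on the coefficients of \<open>\<nu>\<close>.\<close>
    define Q where "Q = {\<beta> \<in> coord_ring B. vf_scale (pullback X \<pi> \<beta>) (vf_scale \<theta> \<nu>) \<in> E}"
    have ideal: "is_ideal (coord_ring B) Q"
      unfolding is_ideal_def
    proof (intro conjI ballI)
      show "Q \<subseteq> coord_ring B" unfolding Q_def by blast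
      have "0 = (\<Sum>i\<in>?K. vf_scale 0 (\<xi> i))" by (simp only: vf_scale_simps sum.neutral_const)
      moreover have "\<forall>i\<in>?K. 0 \<in> V i" unfolding V_def by (intro ballI ker_products.zero)
      ultimately have "0 \<in> E" unfolding E_def by (intro CollectI exI[of _ "\<lambda>_. 0"] conjI)
      then show "0 \<in> Q" unfolding Q_def by (simp only: mem_Collect_eq pullback_zero vf_scale_simps mult_zero_left B.A_zero simp_thms)
    next
      fix f g assume fg: "f \<in> Q" "g \<in> Q"
      then obtain v w where v: "\<forall>i\<in>?K. v i \<in> V i" "\<forall>i\<in>?K. w i \<in> V i"
        "vf_scale (pullback X \<pi> f) (vf_scale \<theta> \<nu>) = (\<Sum>i\<in>?K. vf_scale (v i) (\<xi> i))"
        "vf_scale (pullback X \<pi> g) (vf_scale \<theta> \<nu>) = (\<Sum>i\<in>?K. vf_scale (w i) (\<xi> i))"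
        unfolding Q_def E_def by blast
      have "vf_scale (pullback X \<pi> (f + g)) (vf_scale \<theta> \<nu>) = (\<Sum>i\<in>?K. vf_scale (v i + w i) (\<xi> i))"
        unfolding pullback_add vf_scale_simps(2) v(3,4) sum.distrib ..
      moreover have "\<forall>i\<in>?K. v i + w i \<in> V i" using v(1,2) ker_products_add unfolding V_def by blast
      ultimately have "vf_scale (pullback X \<pi> (f + g)) (vf_scale \<theta> \<nu>) \<in> E"
        unfolding E_def by (intro CollectI exI[of _ "\<lambda>i. v i + w i"] conjI)
      then show "f + g \<in> Q" using fg B.A_add unfolding Q_def by blast
    next
      fix f g assume f: "f \<in> coord_ring B" and g: "g \<in> Q"
      then obtain v where v: "\<forall>i\<in>?K. v i \<in> V i"
        "vf_scale (pullback X \<pi> g) (vf_scale \<theta> \<nu>) = (\<Sum>i\<in>?K. vf_scale (v i) (\<xi> i))"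
        unfolding Q_def E_def by blast
      have "vf_scale (pullback X \<pi> (f * g)) (vf_scale \<theta> \<nu>)
        = vf_scale (pullback X \<pi> f) (vf_scale (pullback X \<pi> g) (vf_scale \<theta> \<nu>))"
        by (simp only: pullback_mult vf_scale_simps(3) mult.assoc)
      also have "\<dots> = (\<Sum>i\<in>?K. vf_scale (pullback X \<pi> f * v i) (\<xi> i))"
        unfolding v(2) unfolding vf_scale_sum vf_scale_simps(3) ..
      finally have "vf_scale (pullback X \<pi> (f * g)) (vf_scale \<theta> \<nu>)
        = (\<Sum>i\<in>?K. vf_scale (pullback X \<pi> f * v i) (\<xi> i))" .
      moreover have "\<forall>i\<in>?K. pullback X \<pi> f * v i \<in> V i"
        using v(1) ker_products_mult_right[OF \<eta> pb[OF f]] unfolding V_def by blast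
      ultimately have "vf_scale (pullback X \<pi> (f * g)) (vf_scale \<theta> \<nu>) \<in> E"
        unfolding E_def by (intro CollectI exI[of _ "\<lambda>i. pullback X \<pi> f * v i"] conjI)
      then show "f * g \<in> Q" using f g B.A_mult unfolding Q_def by blast
    qed
    have "\<exists>\<beta>\<in>Q. \<beta> b \<noteq> 0" if b: "b \<in> B" for b
    proof -
      \<comment> \<open>Any point of the fibre serves, since \<open>I x\<close> depends only on
        b.\<close>
      obtain x where x: "x \<in> X" "\<pi> x = b" using assms(4) b by blast
      have Ix: "I x \<subseteq> ?K" "finite (I x)" by (auto simp: I_def)
      obtain g where g: "\<forall>i\<in>I x. g i \<in> ?A" "vf_scale (u (I x)) \<nu> = (\<Sum>i\<in>I x. vf_scale (g i) (\<xi> i))"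
        using u(3)[OF x(1) \<nu>] unfolding vf_module_generated_def by blast
      define r where "r = prod u (Pow ?K - {I x})"
      \<comment> \<open>The factor \<open>u (I x)\<close> turns \<open>\<nu>\<close> into a
        combination of the fields indexed by \<open>I x\<close>; the rest of \<open>\<theta>\<close>
        still contains every h_i.\<close>
      have \<theta>_split: "\<theta> = \<theta>1 * r * u (I x)"
        unfolding \<theta>_def r_def using prod.remove[of "Pow ?K" "I x" u] Ix(1) by (simp only: mult_ac) simp
      have \<theta>r: "\<theta>1 * r \<in> ?A" unfolding r_def by (rule A_prod_mult[OF _ \<theta>1(1) u(1)]) simp
      have "\<exists>m. a i ^ Suc m * (\<theta>1 * r * g i) \<in> V i" if i: "i \<in> I x" for i
      proof -
        have iK: "i \<in> ?K" using i Ix(1) by blast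
        \<comment> \<open>This is \<open>\<theta>\<close> without the factors h_i and
          \<open>u (I x)\<close>.\<close>
        let ?q = "(one_on X * prod h (?K - {i})) * prod u (Pow ?K - {I x})"
        have "one_on X * prod h (?K - {i}) \<in> ?A"
          by (rule A_prod_mult[OF _ oneX(1) h(1)]) auto
        then have q: "?q \<in> ?A" by (rule A_prod_mult[OF _ _ u(1), rotated]) simp
        have "\<theta>1 = (one_on X * prod h (?K - {i})) * h i"
          unfolding \<theta>1_def prod.remove[OF finite_atLeastAtMost iK] by (simp only: mult_ac)
        then have "\<theta>1 * r * g i = (?q * g i) * h i" unfolding r_def by (simp only: mult_ac)
        then show ?thesis using h(3)[OF iK A_mult[OF q bspec[OF g(1) i]]] by simp
      qed
      then obtain m where m: "\<And>i. i \<in> I x \<Longrightarrow> a i ^ Suc (m i) * (\<theta>1 * r * g i) \<in> V i" by metis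
      \<comment> \<open>Defined for all subsets so that a single factor can be split off; the
        function sought is \<open>P (I x)\<close>.\<close>
      define P where "P L = one_on B * (\<Prod>i\<in>L. \<alpha> i ^ Suc (m i))" for L
      have \<alpha>: "\<alpha> i ^ Suc (m i) \<in> coord_ring B" if "i \<in> I x" for i
        using assms(9) that Ix(1) by (intro B.A_power_Suc) blast
      have P: "P L \<in> coord_ring B" if "L \<subseteq> I x" for L
        unfolding P_def by (rule B.A_prod_mult[OF finite_subset[OF that Ix(2)] one_on_coord_ring]) (use \<alpha> that in blast)
      let ?\<beta> = "P (I x)"
      \<comment> \<open>The power of \<alpha>_i brings the coefficient into V_i; the other factors
        are functions on B and preserve V_i.\<close>
      have "pullback X \<pi> ?\<beta> * (\<theta>1 * r * g i) \<in> V i" if i: "i \<in> I x" for i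
      proof -
        have "?\<beta> = P (I x - {i}) * \<alpha> i ^ Suc (m i)"
          unfolding P_def prod.remove[OF Ix(2) i] by (simp only: mult_ac)
        then have "pullback X \<pi> ?\<beta> * (\<theta>1 * r * g i)
          = pullback X \<pi> (P (I x - {i})) * (a i ^ Suc (m i) * (\<theta>1 * r * g i))"
          unfolding a_def by (simp only: pullback_mult pullback_power_Suc mult.assoc)
        moreover have "pullback X \<pi> (P (I x - {i})) * (a i ^ Suc (m i) * (\<theta>1 * r * g i)) \<in> V i"
          using m[OF i] unfolding V_def by (rule ker_products_mult_right[OF \<eta> pb[OF P[OF Diff_subset]]])
        ultimately show ?thesis by metis
      qed
      then have mem: "\<forall>i\<in>?K. (if i \<in> I x then pullback X \<pi> ?\<beta> * (\<theta>1 * r * g i) else 0) \<in> V i"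
        unfolding V_def by (auto intro: ker_products.zero)
      have "vf_scale (pullback X \<pi> ?\<beta>) (vf_scale \<theta> \<nu>)
        = vf_scale (pullback X \<pi> ?\<beta> * (\<theta>1 * r)) (vf_scale (u (I x)) \<nu>)"
        unfolding \<theta>_split by (simp only: vf_scale_simps(3) mult.assoc)
      also have "\<dots> = (\<Sum>i\<in>I x. vf_scale (pullback X \<pi> ?\<beta> * (\<theta>1 * r * g i)) (\<xi> i))"
        unfolding g(2) unfolding vf_scale_sum vf_scale_simps(3) by (simp only: mult.assoc)
      also have "\<dots> = (\<Sum>i\<in>?K. vf_scale (if i \<in> I x then pullback X \<pi> ?\<beta> * (\<theta>1 * r * g i) else 0) (\<xi> i))"
        by (rule sum.mono_neutral_cong_left) (use Ix vf_scale_simps(4) in auto)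
      finally have "vf_scale (pullback X \<pi> ?\<beta>) (vf_scale \<theta> \<nu>) \<in> E"
        unfolding E_def using mem
        by (intro CollectI exI[of _ "\<lambda>i. if i \<in> I x then pullback X \<pi> ?\<beta> * (\<theta>1 * r * g i) else 0"] conjI)
      then have "?\<beta> \<in> Q" unfolding Q_def using P[OF subset_refl] by blast
      moreover have "P L b \<noteq> 0" if "L \<subseteq> I x" for L
        using finite_subset[OF that Ix(2)] that
      proof (induction L rule: finite_induct)
        case empty
        then show ?case using b by (simp add: P_def zero_outside_def)
      next
        case (insert i L)
        have pw: "(f ^ l) b = f b ^ l" for f :: "'m rfun" and l by (induction l) auto
        have "\<alpha> i b \<noteq> 0" using insert.prems x by (auto simp: I_def a_def pullback_def zero_outside_def)
        moreover have "P (insert i L) = \<alpha> i ^ Suc (m i) * P L"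
          unfolding P_def prod.insert[OF insert.hyps] by (simp only: mult_ac)
        ultimately show ?case using insert by (simp only: times_fun_apply pw) simp
      qed
      ultimately show ?thesis by blast
    qed
    then have "one_on B \<in> Q"
      using assms(2) by (intro nullstellensatz[OF _ ideal]) (auto simp: smooth_affine_variety_def affine_variety_def)
    \<comment> \<open>The unit of \<complex>[B] pulls back to that of \<complex>[X], so all powers
      of the \<alpha>_i have disappeared.\<close>
    then have "vf_scale (one_on X) (vf_scale \<theta> \<nu>) \<in> E"
      unfolding Q_def using pullback_one_on[of \<pi> X B] assms(4) by simp
    moreover have "one_on X * \<theta> = \<theta>" using one_on_mult[OF \<theta>(1)] .
    ultimately show ?thesis by (simp only: vf_scale_simps(3))
  qed

  \<comment> \<open>The principal ideal of \<open>\<theta>\<close> and the submodule of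
    forms\<close>
  define J where "J = {g * \<theta> | g. g \<in> ?A}"
  have J: "is_ideal ?A J"
    unfolding is_ideal_def
  proof (intro conjI ballI)
    show "J \<subseteq> ?A" unfolding J_def using A_mult[OF _ \<theta>(1)] by blast
    have "0 = 0 * \<theta>" by (simp only: mult_zero_left)
    then show "0 \<in> J" unfolding J_def using A_zero by blast
  next
    fix f g assume "f \<in> J" "g \<in> J"
    then obtain f' g' where fg: "f' \<in> ?A" "g' \<in> ?A" "f = f' * \<theta>" "g = g' * \<theta>" unfolding J_def by blast
    have "f + g = (f' + g') * \<theta>" unfolding fg(3,4) by (rule distrib_right[symmetric])
    then show "f + g \<in> J" unfolding J_def using A_add[OF fg(1,2)] by blast
  next
    fix f g assume "f \<in> ?A" "g \<in> J"
    then obtain g' where fg: "f \<in> ?A" "g' \<in> ?A" "g = g' * \<theta>" unfolding J_def by blast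
    have "f * g = f * g' * \<theta>" unfolding fg(3) by (rule mult.assoc[symmetric])
    then show "f * g \<in> J" unfolding J_def using A_mult[OF fg(1,2)] by blast
  qed
  have "\<theta> \<in> J" unfolding J_def using one_on_mult[OF \<theta>(1), symmetric] oneX(1) by blast
  then have J0: "J \<noteq> {0}" using \<theta>(2) by blast
  have JN: "ideal_times_module J N = vf_scale \<theta> ` N"
    unfolding J_def
    by (rule ideal_times_module_principal[OF function_domain_coord_ring[OF affine] assms(14) \<theta>(1)])
  let ?\<iota> = "\<lambda>\<zeta>. interior_product \<zeta> (interior_product \<eta> \<omega>)"
  note form = interior_product_form[OF \<eta> volume]
  have \<theta>N: "vf_scale \<theta> \<nu> \<in> D" if "\<nu> \<in> N" for \<nu> using scale_in_D[OF \<theta>(1) N_D[OF that]] .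
  define M where "M = {?\<iota> \<zeta> | \<zeta>. \<zeta> \<in> vf_scale \<theta> ` N}"
  have M_I: "?\<iota> (vf_scale \<theta> \<nu>) \<in> M" if "\<nu> \<in> N" for \<nu> using that unfolding M_def by blast
  have M_forms: "M \<subseteq> forms ?A (n - 2)"
    unfolding M_def assms(5) using interior_product_form[OF \<theta>N form] by (auto simp: numeral_2_eq_2)
  have "is_form_submodule ?A (n - 2) M"
    unfolding is_form_submodule_def
  proof (intro conjI ballI M_forms)
    have "?\<iota> (vf_scale \<theta> 0) = 0" unfolding vf_scale_simps by (rule interior_zero[OF form])
    moreover have "0 \<in> N" unfolding assms(14) by (rule generated_zero)
    ultimately show "0 \<in> M" using M_I by metis
  next
    fix \<sigma> \<tau> assume "\<sigma> \<in> M" "\<tau> \<in> M"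
    then obtain \<mu> \<nu> where \<mu>: "\<mu> \<in> N" "\<nu> \<in> N" "\<sigma> = ?\<iota> (vf_scale \<theta> \<mu>)" "\<tau> = ?\<iota> (vf_scale \<theta> \<nu>)"
      unfolding M_def by blast
    have "\<sigma> + \<tau> = ?\<iota> (vf_scale \<theta> (\<mu> + \<nu>))"
      unfolding \<mu>(3,4) vf_scale_simps(1) by (rule interior_add[OF form \<theta>N[OF \<mu>(1)] \<theta>N[OF \<mu>(2)], symmetric])
    moreover have "\<mu> + \<nu> \<in> N" using \<mu>(1,2) unfolding assms(14) by (rule generated_add)
    ultimately show "\<sigma> + \<tau> \<in> M" using M_I by metis
  next
    fix f \<tau> assume f: "f \<in> ?A" and "\<tau> \<in> M"
    then obtain \<nu> where \<nu>: "\<nu> \<in> N" "\<tau> = ?\<iota> (vf_scale \<theta> \<nu>)" unfolding M_def by blast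
    have "(\<lambda>vs. f * \<tau> vs) = ?\<iota> (vf_scale f (vf_scale \<theta> \<nu>))"
      unfolding \<nu>(2) by (rule interior_scale[OF form \<theta>N[OF \<nu>(1)] f, symmetric])
    also have "vf_scale f (vf_scale \<theta> \<nu>) = vf_scale \<theta> (vf_scale f \<nu>)"
      by (simp only: vf_scale_simps(3) mult.commute)
    finally have "(\<lambda>vs. f * \<tau> vs) = ?\<iota> (vf_scale \<theta> (vf_scale f \<nu>))" .
    moreover have "vf_scale f \<nu> \<in> N" using f \<nu>(1) unfolding assms(14) by (rule generated_scale)
    ultimately show "(\<lambda>vs. f * \<tau> vs) \<in> M" using M_I by metis
  qed
  moreover have "M \<subseteq> d_preimage X (n - 2) (Theta \<omega> ` Lie_alg X \<omega>)"
  proof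
    fix \<tau> assume \<tau>: "\<tau> \<in> M"
    then obtain \<nu> where \<nu>: "\<nu> \<in> N" "\<tau> = ?\<iota> (vf_scale \<theta> \<nu>)" unfolding M_def by blast
    then have "vf_scale \<theta> \<nu> \<in> Lie_potential \<eta>" using in_E E_potential by blast
    then have "ext_deriv ?A \<tau> \<in> Theta \<omega> ` Lie_alg X \<omega>" unfolding Lie_potential_def \<nu>(2) by blast
    then show "\<tau> \<in> d_preimage X (n - 2) (Theta \<omega> ` Lie_alg X \<omega>)"
      unfolding d_preimage_def using \<tau> M_forms by blast
  qed
  ultimately show ?thesis
    using J J0 unfolding Let_def by (intro exI[of _ J]) (simp only: JN M_def simp_thms)
qed

end
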